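(* There exist absolute constants $C, C', c > 0$ such that the following holds. Let $x_1, \dots, x_n$ be i.i.d. samples from a centered elliptical distribution on $\mathbb{R}^p$ with shape matrix $\Sigma$, where $n \geq C p \log^2 p$. Then with probability at least $1 - \exp(-c\, n/(p\log^2 p))$, Tyler's M-estimator $\widehat{\Sigma}$ of $x_1,\dots,x_n$ exists, and for every $\varepsilon \in (0,1)$ there is a number of iterations $T \leq C'(|\log\det \Sigma| + p + \log(1/\varepsilon))$ such that the output $\overline{\Sigma}$ of Tyler's iterative procedure run for $T$ iterations satisfies $$\|I_p - \widehat{\Sigma}^{1/2}\overline{\Sigma}^{-1}\widehat{\Sigma}^{1/2}\|_F \leq \varepsilon.$$
   Context: A centered elliptical distribution on $\mathbb{R}^p$ with shape matrix $\Sigma$ is the law of $X = u\, \Sigma^{1/2} V$, where $\Sigma$ is a fixed $p \times p$ positive-definite matrix normalized so that $\operatorname{tr}\Sigma = p$, $V$ is uniformly distributed on the unit sphere $\mathbb{S}^{p-1}$, and $u$ is a real random scalar independent of $V$ with $u \neq 0$ almost surely. Given $x_1, \dots, x_n \in \mathbb{R}^p$, Tyler's M-estimator $\widehat{\Sigma}$ is the unique positive-definite $p\times p$ matrix satisfying $\frac{p}{n}\sum_{i=1}^n \frac{x_i x_i^\top}{x_i^\top \widehat{\Sigma}^{-1} x_i} = \widehat{\Sigma}$ and $\operatorname{tr}\widehat{\Sigma} = p$, when such a solution exists and is unique. Tyler's iterative procedure run for $T$ iterations sets $\widehat{\Sigma}_0 = I_p$, then for $t = 1, \dots, T$ sets $\widehat{\Sigma}_t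 = \frac{p}{n}\sum_{i=1}^n \frac{x_i x_i^\top}{x_i^\top \widehat{\Sigma}_{t-1}^{-1} x_i}$, and outputs $\overline{\Sigma} = p\,\widehat{\Sigma}_T / \operatorname{tr}\widehat{\Sigma}_T$. $\|\cdot\|_F$ is the Frobenius norm. *)

theory Defs
  imports
    "HOL-Probability.Probability"
    "Jordan_Normal_Form.Determinant"
    "Jordan_Normal_Form.Gauss_Jordan_Elimination"
begin

unbundle no vec_syntax

hide_const (open) Finite_Cartesian_Product.vec Finite_Cartesian_Product.mat
  Determinants.det Determinants.trace

text \<open>
  The dimension p is quantified inside the theorem, so matrices and vectors are the
  carrier-based ones of Jordan_Normal_Form; the index set 1..n (or 1..p) becomes 0..n-1.
\<close>

subsection \<open>Matrices\<close>

definition mat_trace :: "real mat \<Rightarrow> real" where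
  "mat_trace A = (\<Sum>i<dim_row A. A $$ (i, i))"

definition frobenius_norm :: "real mat \<Rightarrow> real" where
  "frobenius_norm A = sqrt (\<Sum>i<dim_row A. \<Sum>j<dim_col A. (A $$ (i, j))\<^sup>2)"

definition pos_def_mat :: "nat \<Rightarrow> real mat \<Rightarrow> bool" where
  "pos_def_mat p A \<longleftrightarrow> A \<in> carrier_mat p p \<and> transpose_mat A = A \<and>
     (\<forall>v\<in>carrier_vec p. v \<noteq> 0\<^sub>v p \<longrightarrow> v \<bullet> (A *\<^sub>v v) > 0)"

text \<open>Only meaningful for invertible arguments.\<close>

definition mat_inv :: "real mat \<Rightarrow> real mat" where
  "mat_inv A = the (mat_inverse A)"

text \<open>The principal square root, only meaningful for positive definite arguments.\<close>

definition mat_sqrt :: "nat \<Rightarrow> real mat \<Rightarrow> real mat" where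
  "mat_sqrt p A = (THE R. pos_def_mat p R \<and> R * R = A)"

subsection \<open>Elliptical distributions\<close>

text \<open>
  The measurable space of p-dimensional vectors is the product space of (extensional)
  functions on 0..p-1; \<open>vec p\<close> turns such a function into a vector.
\<close>

abbreviation vec_space :: "nat \<Rightarrow> (nat \<Rightarrow> real) measure" where
  "vec_space p \<equiv> PiM {..<p} (\<lambda>_. borel)"

text \<open>
  Uniform distribution on the unit sphere as normalized cone measure: the law of
  \<open>x / |x|\<close> for \<open>x\<close> uniform in the unit ball. For the Euclidean norm this is the
  normalized surface measure. (The origin, where the division is degenerate, is a null
  set.)
\<close>

definition unit_ball :: "nat \<Rightarrow> (nat \<Rightarrow> real) set" where
  "unit_ball p = {x \<in> space (PiM {..<p} (\<lambda>_. lborel)). (\<Sum>i<p. (x i)\<^sup>2) \<le> 1}"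

definition uniform_sphere :: "nat \<Rightarrow> (nat \<Rightarrow> real) measure" where
  "uniform_sphere p =
     distr (uniform_measure (PiM {..<p} (\<lambda>_. lborel)) (unit_ball p)) (vec_space p)
       (\<lambda>x. \<lambda>i\<in>{..<p}. x i / sqrt (\<Sum>j<p. (x j)\<^sup>2))"

text \<open>
  The law of \<open>u \<Sigma>\<^sup>1\<^sup>/\<^sup>2 V\<close>, where \<open>u\<close> has law \<open>\<nu>\<close>; taking the product of the two laws
  expresses that \<open>u\<close> and \<open>V\<close> are independent.
\<close>

definition elliptical_law :: "nat \<Rightarrow> real mat \<Rightarrow> real measure \<Rightarrow> (nat \<Rightarrow> real) measure" where
  "elliptical_law p \<Sigma> \<nu> =
     distr (\<nu> \<Otimes>\<^sub>M uniform_sphere p) (vec_space p)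
       (\<lambda>(u, v). \<lambda>i\<in>{..<p}. (u \<cdot>\<^sub>v (mat_sqrt p \<Sigma> *\<^sub>v vec p v)) $ i)"

definition centered_elliptical :: "nat \<Rightarrow> real mat \<Rightarrow> (nat \<Rightarrow> real) measure \<Rightarrow> bool" where
  "centered_elliptical p \<Sigma> D \<longleftrightarrow>
     pos_def_mat p \<Sigma> \<and> mat_trace \<Sigma> = real p \<and>
     (\<exists>\<nu>. prob_space \<nu> \<and> sets \<nu> = sets borel \<and> (AE u in \<nu>. u \<noteq> 0) \<and>
          D = elliptical_law p \<Sigma> \<nu>)"

lemma unit_ball_sets [measurable]: "unit_ball p \<in> sets (PiM {..<p} (\<lambda>_. lborel))"
  unfolding unit_ball_def by measurable

lemma unit_ball_emeasure:
  assumes "p \<ge> 1"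
  shows "emeasure (PiM {..<p} (\<lambda>_. lborel)) (unit_ball p) \<noteq> 0"
    and "emeasure (PiM {..<p} (\<lambda>_. lborel)) (unit_ball p) \<noteq> \<infinity>"
proof -
  interpret product_sigma_finite "\<lambda>_::nat. lborel :: real measure" by standard
  define r where "r = 1 / sqrt (real p)"
  have r: "r > 0" "r^2 = 1 / real p" using assms by (auto simp: r_def power_divide)
  have sub: "(\<Pi>\<^sub>E i\<in>{..<p}. {0..r}) \<subseteq> unit_ball p"
  proof
    fix x assume x: "x \<in> (\<Pi>\<^sub>E i\<in>{..<p}. {0..r})"
    have "(\<Sum>i<p. (x i)^2) \<le> (\<Sum>i<p. 1 / real p)"
    proof (rule sum_mono)
      fix i assume "i \<in> {..<p}"
      then have "0 \<le> x i" "x i \<le> r" using x by (auto simp: PiE_iff)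
      then show "(x i)^2 \<le> 1 / real p" using r(2) power_mono[of "x i" r 2] by simp
    qed
    then show "x \<in> unit_ball p" using x assms by (auto simp: unit_ball_def space_PiM PiE_iff)
  qed
  have "emeasure (PiM {..<p} (\<lambda>_. lborel)) (\<Pi>\<^sub>E i\<in>{..<p}. {0..r}) = (\<Prod>i<p. ennreal r)"
    using r by (subst emeasure_PiM) auto
  also have "\<dots> \<noteq> 0" using r by auto
  finally show "emeasure (PiM {..<p} (\<lambda>_. lborel)) (unit_ball p) \<noteq> 0"
    using emeasure_mono[OF sub unit_ball_sets] by auto
  have sup: "unit_ball p \<subseteq> (\<Pi>\<^sub>E i\<in>{..<p}. {-1..1::real})"
  proof
    fix x assume x: "x \<in> unit_ball p"
    have "x i \<in> {-1..1}" if "i < p" for i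
    proof -
      have "(x i)^2 \<le> (\<Sum>i<p. (x i)^2)" using that by (intro member_le_sum) auto
      also have "\<dots> \<le> 1" using x by (simp add: unit_ball_def)
      finally have "\<bar>x i\<bar> \<le> 1" by (simp add: abs_square_le_1)
      then show ?thesis by auto
    qed
    then show "x \<in> (\<Pi>\<^sub>E i\<in>{..<p}. {-1..1::real})"
      using x by (auto simp: unit_ball_def space_PiM PiE_iff)
  qed
  have "emeasure (PiM {..<p} (\<lambda>_. lborel)) (\<Pi>\<^sub>E i\<in>{..<p}. {-1..1::real}) = (\<Prod>i<p. 2)"
    by (subst emeasure_PiM) auto
  also have "\<dots> < \<infinity>" by (simp add: power_less_top_ennreal)
  finally have fin: "emeasure (PiM {..<p} (\<lambda>_. lborel)) (\<Pi>\<^sub>E i\<in>{..<p}. {-1..1::real}) < \<infinity>" .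
  have "emeasure (PiM {..<p} (\<lambda>_. lborel)) (unit_ball p) \<le> emeasure (PiM {..<p} (\<lambda>_. lborel)) (\<Pi>\<^sub>E i\<in>{..<p}. {-1..1::real})"
    by (rule emeasure_mono[OF sup]) (auto intro: sets_PiM_I_finite)
  with fin show "emeasure (PiM {..<p} (\<lambda>_. lborel)) (unit_ball p) \<noteq> \<infinity>" by auto
qed

lemma prob_space_uniform_sphere:
  assumes "p \<ge> 1" shows "prob_space (uniform_sphere p)"
  unfolding uniform_sphere_def
proof (rule prob_space.prob_space_distr)
  show "prob_space (uniform_measure (Pi\<^sub>M {..<p} (\<lambda>_. lborel)) (unit_ball p))"
    using unit_ball_emeasure[OF assms] by (rule prob_space_uniform_measure)
qed measurable

lemma prob_space_elliptical_law:
  assumes "p \<ge> 1" "prob_space \<nu>" "sets \<nu> = sets borel" "mat_sqrt p S \<in> carrier_mat p p"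
  shows "prob_space (elliptical_law p S \<nu>)"
proof -
  interpret prob_space \<nu> by fact
  interpret U: prob_space "uniform_sphere p" using prob_space_uniform_sphere assms(1) .
  interpret pair_prob_space \<nu> "uniform_sphere p" ..
  have s[measurable_cong]: "sets \<nu> = sets borel" "sets (uniform_sphere p) = sets (vec_space p)"
    using assms(3) by (auto simp: uniform_sphere_def)
  have eq: "(u \<cdot>\<^sub>v (mat_sqrt p S *\<^sub>v vec p v)) $ i = u * (\<Sum>j<p. mat_sqrt p S $$ (i,j) * v j)"
    if "i < p" for u v i
    using that assms(4) by (auto simp: scalar_prod_def lessThan_atLeast0 intro!: sum.cong)
  have m: "(\<lambda>(u, v). \<lambda>i\<in>{..<p}. (u \<cdot>\<^sub>v (mat_sqrt p S *\<^sub>v vec p v)) $ i)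
     = (\<lambda>(u, v). \<lambda>i\<in>{..<p}. u * (\<Sum>j<p. mat_sqrt p S $$ (i,j) * v j))"
    by (auto simp: fun_eq_iff eq restrict_def)
  show ?thesis unfolding elliptical_law_def m
    by (rule P.prob_space_distr) measurable
qed

subsection \<open>Tyler's M-estimator and Tyler's iterative procedure\<close>

text \<open>
  \<open>tyler_map p n x S\<close> is the matrix \<open>(p/n) \<Sum>\<^sub>i x\<^sub>i x\<^sub>i\<^sup>T / (x\<^sub>i\<^sup>T S\<^sup>-\<^sup>1 x\<^sub>i)\<close>. If \<open>S\<close> is positive
  definite, a denominator vanishes only when \<open>x\<^sub>i = 0\<close>, which has probability zero for
  samples from a centered elliptical distribution.
\<close>

definition tyler_map :: "nat \<Rightarrow> nat \<Rightarrow> (nat \<Rightarrow> real vec) \<Rightarrow> real mat \<Rightarrow> real mat" where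
  "tyler_map p n x S = mat p p (\<lambda>(j, k).
     real p / real n * (\<Sum>i<n. (x i $ j * x i $ k) / (x i \<bullet> (mat_inv S *\<^sub>v x i))))"

definition tyler_solution :: "nat \<Rightarrow> nat \<Rightarrow> (nat \<Rightarrow> real vec) \<Rightarrow> real mat \<Rightarrow> bool" where
  "tyler_solution p n x S \<longleftrightarrow>
     pos_def_mat p S \<and> tyler_map p n x S = S \<and> mat_trace S = real p"

definition is_tyler_estimator :: "nat \<Rightarrow> nat \<Rightarrow> (nat \<Rightarrow> real vec) \<Rightarrow> real mat \<Rightarrow> bool" where
  "is_tyler_estimator p n x S \<longleftrightarrow>
     tyler_solution p n x S \<and> (\<forall>S'. tyler_solution p n x S' \<longrightarrow> S' = S)"

fun tyler_iterate :: "nat \<Rightarrow> nat \<Rightarrow> (nat \<Rightarrow> real vec) \<Rightarrow> nat \<Rightarrow> real mat" where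
  "tyler_iterate p n x 0 = 1\<^sub>m p"
| "tyler_iterate p n x (Suc t) = tyler_map p n x (tyler_iterate p n x t)"

definition tyler_output :: "nat \<Rightarrow> nat \<Rightarrow> (nat \<Rightarrow> real vec) \<Rightarrow> nat \<Rightarrow> real mat" where
  "tyler_output p n x T =
     (real p / mat_trace (tyler_iterate p n x T)) \<cdot>\<^sub>m tyler_iterate p n x T"

end

theory Submission
  imports Defs
begin

text \<open>
  Tyler's map \<open>F\<close> is monotone and homogeneous, hence nonexpansive for Hilbert's projective metric.
  If \<open>m S \<le> S' \<le> M S\<close>, then the Rayleigh quotients of \<open>F(S')\<close> relative to \<open>F(S)\<close> are averages of
  \<open>n\<close> numbers in \<open>[m, M]\<close>, with weights \<open>\<langle>u, x\<^sub>i\<rangle>\<^sup>2 / (x\<^sub>i\<^sup>T S\<^sup>-\<^sup>1 x\<^sub>i)\<close> depending on the direction \<open>u\<close>. If no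
  direction is nearly orthogonal to more than a quarter of the (whitened) sample and \<open>S\<close> is
  comparable to \<open>\<Sigma>\<close>, then the weights for any two directions overlap in a constant fraction of their
  mass, so \<open>M/m - 1\<close> shrinks by a constant factor, as in Doeblin's condition for Markov chains. If
  moreover \<open>F(\<Sigma>)\<close> is within a small constant factor of \<open>\<Sigma>\<close>, the matrices with condition number at
  most 4 relative to \<open>\<Sigma>\<close> are mapped to themselves, and \<open>F\<close> has a unique fixed point, which attracts
  every starting point at a uniform linear rate. The distance of the starting point \<open>I\<close> costs
  \<open>O(|log det \<Sigma>| + p)\<close> iterations, because \<open>\<lambda>\<^sub>m\<^sub>i\<^sub>n(\<Sigma>) \<ge> det(\<Sigma>) / e\<close> when the trace is \<open>p\<close>.

  Both conditions on the sample concern only the marginals \<open>\<langle>w, x\<rangle>\<^sup>2\<close> of the uniform distribution on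
  the sphere, in all directions \<open>w\<close> at once: they follow from volume estimates in the ball, Chernoff
  bounds and a union bound over a net.
\<close>

section \<open>Quadratic forms\<close>

text \<open>The obstacle is that the contraction factor deteriorates with the condition number
  relative to \<open>\<Sigma>\<close>, and the starting point may be badly conditioned. The way out
  is an asymmetry: when \<open>S\<close> and \<open>S'\<close> are compared, only the base point
  \<open>S\<close> has to be well conditioned. With base point \<open>\<Sigma>\<close> the estimate
  yields the invariant region, with base points in that region the fixed point, and with the fixed
  point as base the rate for arbitrary iterates. The gap is measured by \<open>M/m - 1\<close> and
  not by its logarithm, because the oscillation estimate is linear in it however large it is. The
  sample matters only through directions: \<open>F\<close> and both regularity conditions are
  unchanged when each \<open>x i\<close> is multiplied by its own nonzero factor. Hence the law of
  \<open>u\<close> drops out, and the sphere can be replaced by the ball, where volumes are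
  elementary. All constants derive from one small-ball level \<open>\<tau>\<close>. The grid net has
  \<open>p\<close> to the power \<open>O(p)\<close> points, so order \<open>p log p\<close> samples
  pay for the union bound; for \<open>p \<ge> 2\<close> this is dominated by
  \<open>p log^2 p\<close>.\<close>

definition qf :: "real mat \<Rightarrow> real vec \<Rightarrow> real" where
  "qf A u = u \<bullet> (A *\<^sub>v u)"

lemma bilinear_form_sym:
  assumes "A \<in> carrier_mat p p" "A\<^sup>T = A" "u \<in> carrier_vec p" "w \<in> carrier_vec p"
  shows "u \<bullet> (A *\<^sub>v w) = w \<bullet> ((A :: real mat) *\<^sub>v u)"
  using transpose_vec_mult_scalar[of A p p w u] assms
  by (metis comm_scalar_prod mult_mat_vec_carrier)

lemma qf_smult:
  assumes "A \<in> carrier_mat p p" "u \<in> carrier_vec p"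
  shows "qf A (c \<cdot>\<^sub>v u) = c\<^sup>2 * qf A u"
  using assms by (simp add: qf_def mult_mat_vec[of A p p] power2_eq_square)

lemma qf_smult_mat:
  assumes "A \<in> carrier_mat p p" "u \<in> carrier_vec p"
  shows "qf (c \<cdot>\<^sub>m A) u = c * qf A u"
proof -
  have "(c \<cdot>\<^sub>m A) *\<^sub>v u = c \<cdot>\<^sub>v (A *\<^sub>v u)" using assms by (intro eq_vecI) auto
  then show ?thesis using assms by (simp add: qf_def scalar_prod_smult_distrib[of u p])
qed

lemma qf_add:
  assumes "A \<in> carrier_mat p p" "A\<^sup>T = A" "u \<in> carrier_vec p" "w \<in> carrier_vec p"
  shows "qf A (u + w) = qf A u + 2 * (u \<bullet> (A *\<^sub>v w)) + qf A w"
proof -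
  have "qf A (u + w) = (u + w) \<bullet> (A *\<^sub>v u + A *\<^sub>v w)"
    using assms by (simp add: qf_def mult_add_distrib_mat_vec[of A p p])
  also have "\<dots> = u \<bullet> (A *\<^sub>v u) + u \<bullet> (A *\<^sub>v w) + (w \<bullet> (A *\<^sub>v u) + w \<bullet> (A *\<^sub>v w))"
    using assms by (simp add: add_scalar_prod_distrib[of u p] scalar_prod_add_distrib[of _ p])
  finally show ?thesis using bilinear_form_sym[OF assms] by (simp add: qf_def)
qed

lemma qf_diff_mat:
  assumes "A \<in> carrier_mat p p" "B \<in> carrier_mat p p" "u \<in> carrier_vec p"
  shows "qf (A - B) u = qf A u - qf B u"
proof -
  have "(A - B) *\<^sub>v u = A *\<^sub>v u - B *\<^sub>v u"
    using assms by (simp add: minus_mult_distrib_mat_vec)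
  then show ?thesis using assms by (simp add: qf_def scalar_prod_minus_distrib[of u p])
qed

lemma qf_one: "u \<in> carrier_vec p \<Longrightarrow> qf (1\<^sub>m p) u = u \<bullet> u"
  by (simp add: qf_def)

lemma scalar_prod_self: "(u :: real vec) \<in> carrier_vec p \<Longrightarrow> u \<bullet> u = (\<Sum>i<p. (u $ i)\<^sup>2)"
  by (simp add: scalar_prod_def power2_eq_square lessThan_atLeast0)

lemma scalar_prod_self_pos: "(u :: real vec) \<in> carrier_vec p \<Longrightarrow> u \<noteq> 0\<^sub>v p \<Longrightarrow> u \<bullet> u > 0"
  using conjugate_square_greater_0_vec[of u p] by simp

lemma scalar_prod_self_nonneg: "(u :: real vec) \<bullet> u \<ge> 0"
  by (simp add: scalar_prod_def sum_nonneg)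

lemma mat_entry_bilinear:
  assumes "A \<in> carrier_mat p p" "i < p" "j < p"
  shows "unit_vec p i \<bullet> (A *\<^sub>v unit_vec p j) = (A :: real mat) $$ (i, j)"
  using assms by simp

text \<open>Polarization: four times the entry is the difference of the forms at
  \<open>e_i + e_j\<close> and \<open>e_i - e_j\<close>, and the parallelogram law makes the two
  bounds add up to \<open>4 * e\<close>. The case \<open>i = j\<close> is covered because the inner
  product of the two unit vectors is never evaluated.\<close>

lemma abs_mat_entry_le:
  assumes A: "A \<in> carrier_mat p p" "A\<^sup>T = A"
    and le: "\<And>u. u \<in> carrier_vec p \<Longrightarrow> \<bar>qf A u\<bar> \<le> e * (u \<bullet> u)"
    and ij: "i < p" "j < p"
  shows "\<bar>A $$ (i, j)\<bar> \<le> e"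
proof -
  let ?x = "unit_vec p i :: real vec" and ?y = "unit_vec p j :: real vec"
  have c: "?x \<in> carrier_vec p" "?y \<in> carrier_vec p" "-1 \<cdot>\<^sub>v ?y \<in> carrier_vec p" by auto
  have n: "?x \<bullet> ?x = 1" "?y \<bullet> ?y = 1" using ij by auto
  have y: "qf A (-1 \<cdot>\<^sub>v ?y) = qf A ?y" using qf_smult[OF A(1) c(2), of "-1"] by simp
  have xy: "?x \<bullet> (A *\<^sub>v (-1 \<cdot>\<^sub>v ?y)) = - (A $$ (i, j))"
    using mat_entry_bilinear[OF A(1) ij]
    by (simp add: mult_mat_vec[OF A(1) c(2)] scalar_prod_smult_distrib[OF c(1) mult_mat_vec_carrier[OF A(1) c(2)]])
  have p1: "qf A (?x + ?y) = qf A ?x + 2 * A $$ (i, j) + qf A ?y"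
    using qf_add[OF A c(1,2)] mat_entry_bilinear[OF A(1) ij] by simp
  have p2: "qf A (?x + -1 \<cdot>\<^sub>v ?y) = qf A ?x - 2 * A $$ (i, j) + qf A ?y"
    using qf_add[OF A c(1,3)] xy y by simp
  have o1: "transpose_mat (1\<^sub>m p :: real mat) = 1\<^sub>m p" by simp
  have n1: "(?x + ?y) \<bullet> (?x + ?y) = 2 + 2 * (?x \<bullet> ?y)"
    using qf_add[OF one_carrier_mat o1 c(1,2)] n by (simp add: qf_def del: scalar_prod_left_unit scalar_prod_right_unit)
  have n2: "(?x + -1 \<cdot>\<^sub>v ?y) \<bullet> (?x + -1 \<cdot>\<^sub>v ?y) = 2 - 2 * (?x \<bullet> ?y)"
    using qf_add[OF one_carrier_mat o1 c(1,3)] n scalar_prod_smult_distrib[OF c(1,2), of "-1"]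
     qf_smult[OF one_carrier_mat c(2), of "-1"] c
    by (simp add: qf_def del: scalar_prod_left_unit scalar_prod_right_unit)
  have "\<bar>qf A (?x + ?y)\<bar> \<le> e * (2 + 2 * (?x \<bullet> ?y))" "\<bar>qf A (?x + -1 \<cdot>\<^sub>v ?y)\<bar> \<le> e * (2 - 2 * (?x \<bullet> ?y))"
    using le[of "?x + ?y"] le[of "?x + -1 \<cdot>\<^sub>v ?y"] c n1 n2 by (metis add_carrier_vec)+
  moreover have "4 * A $$ (i, j) = qf A (?x + ?y) - qf A (?x + -1 \<cdot>\<^sub>v ?y)" using p1 p2 by simp
  moreover have "e * (2 + 2 * (?x \<bullet> ?y)) + e * (2 - 2 * (?x \<bullet> ?y)) = 4 * e" by (simp add: algebra_simps)
  ultimately show ?thesis by linarith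
qed

lemma mat_eq_if_qf_eq:
  assumes A: "A \<in> carrier_mat p p" "A\<^sup>T = A" and B: "B \<in> carrier_mat p p" "B\<^sup>T = B"
    and eq: "\<And>u. u \<in> carrier_vec p \<Longrightarrow> qf A u = qf B u"
  shows "A = B"
proof (rule eq_matI)
  fix i j assume "i < dim_row B" "j < dim_col B"
  then have ij: "i < p" "j < p" using B by auto
  have t: "transpose_mat (A - B) = A - B" using A B transpose_minus by metis
  have "\<bar>(A - B) $$ (i, j)\<bar> \<le> 0"
    by (rule abs_mat_entry_le[OF _ t _ ij]) (use A B eq in \<open>auto simp: qf_diff_mat\<close>)
  then show "A $$ (i, j) = B $$ (i, j)" using A B ij by simp
qed (use A B in auto)

text \<open>Bounding every entry by \<open>e\<close> loses a factor \<open>sqrt p\<close> against a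
  bound by eigenvalues; this is harmless, since the error enters the number of iterations only
  through a logarithm.\<close>

lemma frobenius_norm_le:
  assumes A: "A \<in> carrier_mat p p" "A\<^sup>T = A"
    and le: "\<And>u. u \<in> carrier_vec p \<Longrightarrow> \<bar>qf A u\<bar> \<le> e * (u \<bullet> u)" and e: "e \<ge> 0"
  shows "frobenius_norm A \<le> real p * e"
proof -
  have "(A $$ (i, j))\<^sup>2 \<le> e\<^sup>2" if "i < p" "j < p" for i j
    using abs_mat_entry_le[OF A le that] by (simp add: abs_le_square_iff[symmetric] e)
  then have "(\<Sum>i<p. \<Sum>j<p. (A $$ (i, j))\<^sup>2) \<le> (\<Sum>i<p. \<Sum>j<p. e\<^sup>2)"
    by (intro sum_mono) auto
  also have "\<dots> = (real p * e)\<^sup>2" by (simp add: power2_eq_square)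
  finally show ?thesis unfolding frobenius_norm_def using A e
    by (simp add: real_le_lsqrt)
qed

section \<open>Positive definite matrices\<close>

lemma pos_def_matD:
  assumes "pos_def_mat p S"
  shows "S \<in> carrier_mat p p" "S\<^sup>T = S" "dim_row S = p" "dim_col S = p"
  using assms by (auto simp: pos_def_mat_def)

lemma qf_pos: "pos_def_mat p S \<Longrightarrow> u \<in> carrier_vec p \<Longrightarrow> u \<noteq> 0\<^sub>v p \<Longrightarrow> qf S u > 0"
  by (auto simp: pos_def_mat_def qf_def)

lemma qf_zero: "A \<in> carrier_mat p p \<Longrightarrow> qf A (0\<^sub>v p) = 0"
  by (simp add: qf_def)

lemma qf_nonneg: "pos_def_mat p S \<Longrightarrow> u \<in> carrier_vec p \<Longrightarrow> qf S u \<ge> 0"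
  using qf_pos[of p S u] qf_zero[of S p] pos_def_matD(1)[of p S] by (cases "u = 0\<^sub>v p") auto

lemma pos_def_matI:
  assumes "A \<in> carrier_mat p p" "A\<^sup>T = A"
    "\<And>u. u \<in> carrier_vec p \<Longrightarrow> u \<noteq> 0\<^sub>v p \<Longrightarrow> qf A u > 0"
  shows "pos_def_mat p A"
  using assms by (auto simp: pos_def_mat_def qf_def)

lemma pos_def_one: "pos_def_mat p (1\<^sub>m p)"
  by (rule pos_def_matI) (auto simp: qf_one scalar_prod_self_pos)

lemma transpose_smult: "(c \<cdot>\<^sub>m A)\<^sup>T = c \<cdot>\<^sub>m A\<^sup>T"
  by (intro eq_matI) auto

lemma pos_def_smult: "pos_def_mat p S \<Longrightarrow> c > 0 \<Longrightarrow> pos_def_mat p (c \<cdot>\<^sub>m S)"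
  using pos_def_matD(1,2)[of p S]
  by (intro pos_def_matI) (simp_all add: transpose_smult qf_smult_mat[of S p] qf_pos)

lemma mat_trace_pos:
  assumes S: "pos_def_mat p S" and p: "p \<ge> 1" shows "mat_trace S > 0"
proof -
  have "S $$ (i, i) > 0" if "i < p" for i
    using qf_pos[OF S, of "unit_vec p i"] mat_entry_bilinear[OF pos_def_matD(1)[OF S] that that] that
    by (simp add: qf_def)
  then show ?thesis unfolding mat_trace_def pos_def_matD(3)[OF S] using p
    by (intro sum_pos) (auto simp: lessThan_empty_iff)
qed

lemma mat_trace_smult: "A \<in> carrier_mat p p \<Longrightarrow> mat_trace (c \<cdot>\<^sub>m A) = c * mat_trace A"
  by (simp add: mat_trace_def sum_distrib_left)

lemma mat_trace_mono:
  assumes "A \<in> carrier_mat p p" "B \<in> carrier_mat p p"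
    "\<And>u. u \<in> carrier_vec p \<Longrightarrow> c * qf A u \<le> qf B u"
  shows "c * mat_trace A \<le> mat_trace B"
proof -
  have "c * A $$ (i, i) \<le> B $$ (i, i)" if "i < p" for i
    using assms(3)[of "unit_vec p i"] mat_entry_bilinear[OF assms(1) that that] mat_entry_bilinear[OF assms(2) that that]
    by (simp add: qf_def)
  then show ?thesis using assms(1,2) by (auto simp: mat_trace_def sum_distrib_left intro!: sum_mono)
qed

lemma mat_trace_mult_comm:
  assumes "A \<in> carrier_mat p p" "B \<in> carrier_mat p p"
  shows "mat_trace (A * B) = mat_trace (B * A)"
proof -
  have "mat_trace (A * B) = (\<Sum>i<p. \<Sum>j<p. A $$ (i, j) * B $$ (j, i))"
    using assms by (simp add: mat_trace_def scalar_prod_def lessThan_atLeast0)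
  also have "\<dots> = (\<Sum>i<p. \<Sum>j<p. B $$ (i, j) * A $$ (j, i))"
    by (subst sum.swap) (simp add: mult.commute)
  also have "\<dots> = mat_trace (B * A)"
    using assms by (simp add: mat_trace_def scalar_prod_def lessThan_atLeast0)
  finally show ?thesis .
qed

lemma mat_trace_conjugate:
  assumes D: "D \<in> carrier_mat p p" "D\<^sup>T = D" and A: "A \<in> carrier_mat p p"
  shows "mat_trace (D * (A * D)) = (\<Sum>j<p. qf A (col D j))"
proof -
  have "(D * (A * D)) $$ (j, j) = qf A (col D j)" if "j < p" for j
  proof -
    have "row D j = col D j" using that D by (metis carrier_matD(1) row_transpose carrier_matD(2))
    then show ?thesis using that D A by (simp add: qf_def)
  qed
  then show ?thesis using D A by (simp add: mat_trace_def)
qed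

lemma mat_inv_pos_def:
  assumes S: "pos_def_mat p S"
  shows "mat_inv S \<in> carrier_mat p p" "S * mat_inv S = 1\<^sub>m p" "mat_inv S * S = 1\<^sub>m p"
    and "transpose_mat (mat_inv S) = mat_inv S"
proof -
  note c = pos_def_matD(1)[OF S]
  have "det S \<noteq> 0"
  proof
    assume "det S = 0"
    then obtain v where v: "v \<in> carrier_vec p" "v \<noteq> 0\<^sub>v p" "S *\<^sub>v v = 0\<^sub>v p"
      using det_0_iff_vec_prod_zero_field[OF c] by auto
    then show False using qf_pos[OF S v(1,2)] by (simp add: qf_def)
  qed
  from det_non_zero_imp_unit[OF c this, of "()"] mat_inverse(1)[OF c, of "()"]
  obtain B where B: "mat_inverse S = Some B" by (cases "mat_inverse S") auto
  have i: "mat_inv S = B" by (simp add: mat_inv_def B)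
  show 1: "mat_inv S \<in> carrier_mat p p" and 2: "S * mat_inv S = 1\<^sub>m p" and 3: "mat_inv S * S = 1\<^sub>m p"
    using mat_inverse(2)[OF c B] i by auto
  have t: "B\<^sup>T \<in> carrier_mat p p" using 1 i by simp
  have "B\<^sup>T * S = 1\<^sub>m p"
    using transpose_mult[OF c 1] 2 i pos_def_matD(2)[OF S] by (metis transpose_one)
  then have "B\<^sup>T = B\<^sup>T * (S * B)" using 2 i t by simp
  also have "\<dots> = (B\<^sup>T * S) * B" using assoc_mult_mat[OF t c] 1 i by simp
  also have "\<dots> = B" using \<open>B\<^sup>T * S = 1\<^sub>m p\<close> 1 i by simp
  finally show "transpose_mat (mat_inv S) = mat_inv S" using i by simp
qed

lemma qf_inv_vec:
  assumes S: "pos_def_mat p S" and x: "x \<in> carrier_vec p"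
  shows "qf S (mat_inv S *\<^sub>v x) = qf (mat_inv S) x"
proof -
  note I = mat_inv_pos_def[OF S] and c = pos_def_matD(1)[OF S]
  have "S *\<^sub>v (mat_inv S *\<^sub>v x) = x"
    using assoc_mult_mat_vec[OF c I(1) x, symmetric] I(2) x by simp
  then show ?thesis using x I(1) by (simp add: qf_def comm_scalar_prod[of _ p])
qed

text \<open>Expand \<open>qf S (y - mat_inv S x) \<ge> 0\<close>. Together with equality at
  \<open>y = mat_inv S x\<close> this is the variational formula: the inverse form is the supremum
  over \<open>y\<close> of \<open>2 * (x \<bullet> y) - qf S y\<close>.\<close>

lemma two_scalar_prod_le_qf:
  assumes S: "pos_def_mat p S" and x: "x \<in> carrier_vec p" and y: "y \<in> carrier_vec p"
  shows "2 * (x \<bullet> y) \<le> qf S y + qf (mat_inv S) x"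
proof -
  note I = mat_inv_pos_def[OF S] and c = pos_def_matD(1,2)[OF S]
  define z where "z = -1 \<cdot>\<^sub>v (mat_inv S *\<^sub>v x)"
  have z: "z \<in> carrier_vec p" using I x by (auto simp: z_def)
  have m: "mat_inv S *\<^sub>v x \<in> carrier_vec p" using I x by auto
  have Sz: "S *\<^sub>v z = -1 \<cdot>\<^sub>v x"
    using assoc_mult_mat_vec[OF c(1) I(1) x, symmetric] I(2) x m by (simp add: z_def mult_mat_vec[OF c(1) m])
  have "0 \<le> qf S (y + z)" using y z by (intro qf_nonneg[OF S]) auto
  also have "\<dots> = qf S y + 2 * (y \<bullet> (S *\<^sub>v z)) + qf S z" by (rule qf_add[OF c y z])
  also have "y \<bullet> (S *\<^sub>v z) = - (x \<bullet> y)" using x y unfolding Sz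
    by (simp add: scalar_prod_smult_distrib[of y p] comm_scalar_prod[of y p])
  also have "qf S z = qf (mat_inv S) x"
    using qf_smult[OF c(1) m, of "-1"] qf_inv_vec[OF S x] by (simp add: z_def)
  finally show ?thesis by simp
qed

lemma qf_inv_eq:
  assumes S: "pos_def_mat p S" and x: "x \<in> carrier_vec p"
  defines "y \<equiv> mat_inv S *\<^sub>v x"
  shows "2 * (x \<bullet> y) = qf S y + qf (mat_inv S) x"
  using qf_inv_vec[OF S x] by (simp add: y_def qf_def)

text \<open>Inversion reverses the Loewner order: the optimal \<open>y\<close> for
  \<open>S'\<close>, rescaled by \<open>a\<close>, is a competitor in the variational formula for
  \<open>S\<close>.\<close>

lemma qf_inv_antimono:
  assumes S: "pos_def_mat p S" and S': "pos_def_mat p S'" and x: "x \<in> carrier_vec p"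
    and a: "a > 0" and le: "\<And>u. u \<in> carrier_vec p \<Longrightarrow> a * qf S u \<le> qf S' u"
  shows "a * qf (mat_inv S') x \<le> qf (mat_inv S) x"
proof -
  define y where "y = mat_inv S' *\<^sub>v x"
  have y: "y \<in> carrier_vec p" using mat_inv_pos_def[OF S'] x by (auto simp: y_def)
  note c = pos_def_matD(1)[OF S]
  have "2 * (x \<bullet> (a \<cdot>\<^sub>v y)) \<le> qf S (a \<cdot>\<^sub>v y) + qf (mat_inv S) x"
    using y by (intro two_scalar_prod_le_qf[OF S x]) auto
  then have "a * (2 * (x \<bullet> y)) \<le> a * (a * qf S y) + qf (mat_inv S) x"
    using x y by (simp add: qf_smult[OF c y] scalar_prod_smult_distrib[OF x y] power2_eq_square mult_ac)
  moreover have "a * (a * qf S y) \<le> a * qf S' y" using le[OF y] a by simp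
  moreover have "2 * (x \<bullet> y) = qf S' y + qf (mat_inv S') x"
    unfolding y_def by (rule qf_inv_eq[OF S' x])
  ultimately show ?thesis by (simp add: algebra_simps)
qed

lemma qf_inv_pos:
  assumes S: "pos_def_mat p S" and x: "x \<in> carrier_vec p" "x \<noteq> 0\<^sub>v p"
  shows "qf (mat_inv S) x > 0"
proof -
  have "mat_inv S *\<^sub>v x \<noteq> 0\<^sub>v p"
  proof
    assume "mat_inv S *\<^sub>v x = 0\<^sub>v p"
    then have "S *\<^sub>v (mat_inv S *\<^sub>v x) = 0\<^sub>v p" using pos_def_matD[OF S]
      by (auto intro!: eq_vecI simp: scalar_prod_def)
    then show False using assoc_mult_mat_vec[OF pos_def_matD(1)[OF S] mat_inv_pos_def(1)[OF S] x(1), symmetric]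
      mat_inv_pos_def(2)[OF S] x by simp
  qed
  then show ?thesis using qf_inv_vec[OF S x(1)] qf_pos[OF S, of "mat_inv S *\<^sub>v x"] mat_inv_pos_def(1)[OF S] x
    by auto
qed

lemma pos_def_inv: "pos_def_mat p S \<Longrightarrow> pos_def_mat p (mat_inv S)"
  by (intro pos_def_matI) (auto simp: mat_inv_pos_def qf_inv_pos)

text \<open>With \<open>D = R - Q\<close>, equality of the squares gives
  \<open>R * D + D * Q = 0\<close>. Multiplying by \<open>D\<close> and taking traces leaves two
  sums of nonnegative forms over the columns of \<open>D\<close>; both vanish, so
  \<open>D = 0\<close>.\<close>

lemma pos_def_sqrt_unique:
  assumes R: "pos_def_mat p R" and Q: "pos_def_mat p Q" and eq: "R * R = Q * Q"
  shows "R = Q"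
proof -
  note r = pos_def_matD(1,2)[OF R] and q = pos_def_matD(1,2)[OF Q]
  define D where "D = R - Q"
  have D: "D \<in> carrier_mat p p" "D\<^sup>T = D" using r q transpose_minus[OF r(1) q(1)] by (auto simp: D_def)
  have RD: "R * D + D * Q = 0\<^sub>m p p"
  proof -
    have "R * D + D * Q = (R * R - R * Q) + (R * Q - Q * Q)"
      using r q by (simp add: D_def mult_minus_distrib_mat[of _ p p] minus_mult_distrib_mat[of _ p p])
    also have "\<dots> = 0\<^sub>m p p" unfolding eq using r q by (intro eq_matI) auto
    finally show ?thesis .
  qed
  note tr = mat_trace_conjugate[OF D]
  have "mat_trace (D * (R * D)) + mat_trace (D * (Q * D)) = 0"
  proof -
    have "D * (Q * D) = (D * Q) * D" by (rule assoc_mult_mat[OF D(1) q(1) D(1), symmetric])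
    then have "mat_trace (D * (Q * D)) = mat_trace (D * (D * Q))"
      using mat_trace_mult_comm[of "D * Q" p D] D q by simp
    moreover have "mat_trace (D * (R * D)) + mat_trace (D * (D * Q)) = mat_trace (D * (R * D) + D * (D * Q))"
      using D r q by (simp add: mat_trace_def sum.distrib)
    moreover have "D * (R * D) + D * (D * Q) = D * (R * D + D * Q)"
      by (rule mult_add_distrib_mat[symmetric, OF D(1) mult_carrier_mat[OF r(1) D(1)] mult_carrier_mat[OF D(1) q(1)]])
    ultimately show ?thesis using D by (simp add: RD mat_trace_def)
  qed
  then have "(\<Sum>j<p. qf R (col D j)) + (\<Sum>j<p. qf Q (col D j)) = 0"
    by (simp add: tr r q)
  moreover have "(\<Sum>j<p. qf R (col D j)) \<ge> 0" "(\<Sum>j<p. qf Q (col D j)) \<ge> 0"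
    using D by (auto intro!: sum_nonneg qf_nonneg[OF R] qf_nonneg[OF Q] simp: carrier_vecI)
  ultimately have "(\<Sum>j<p. qf R (col D j)) = 0" by linarith
  then have z: "qf R (col D j) = 0" if "j < p" for j
    using that D by (subst (asm) sum_nonneg_eq_0_iff) (auto intro!: qf_nonneg[OF R] simp: carrier_vecI)
  have "col D j = 0\<^sub>v p" if "j < p" for j
  proof (rule ccontr)
    assume "col D j \<noteq> 0\<^sub>v p"
    then show False using qf_pos[OF R, of "col D j"] z[OF that] D by (simp add: carrier_vecI)
  qed
  then have "D $$ (i, j) = 0" if "i < p" "j < p" for i j
    using that D by (metis carrier_matD(1) carrier_matD(2) index_col index_zero_vec(1))
  then show ?thesis using r q by (intro eq_matI) (auto simp: D_def)
qed

lemma mat_sqrt_eq: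
  assumes "pos_def_mat p R" "R * R = S" shows "mat_sqrt p S = R"
  unfolding mat_sqrt_def using assms pos_def_sqrt_unique by (intro the_equality) auto

section \<open>The spectral theorem\<close>

text \<open>Pad the \<open>k\<close> vectors with zero rows to a square matrix: its last row is
  zero, so it is singular and has a kernel vector.\<close>

lemma exists_orthogonal_vec:
  fixes c :: "nat \<Rightarrow> real vec"
  assumes c: "\<And>j. j < k \<Longrightarrow> c j \<in> carrier_vec p" and k: "k < p"
  shows "\<exists>u\<in>carrier_vec p. u \<noteq> 0\<^sub>v p \<and> (\<forall>j<k. c j \<bullet> u = 0)"
proof -
  define B where "B = mat p p (\<lambda>(i, j). if i < k then c i $ j else 0)"
  have B: "B \<in> carrier_mat p p" by (simp add: B_def)
  have "B\<^sup>T *\<^sub>v unit_vec p (p - 1) = 0\<^sub>v p"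
    using k by (intro eq_vecI) (auto simp: B_def scalar_prod_right_unit)
  moreover have "unit_vec p (p - 1) \<noteq> (0\<^sub>v p :: real vec)" using k by (intro unit_vec_nonzero) auto
  ultimately have "det (B\<^sup>T) = 0"
    using det_0_iff_vec_prod_zero_field[of "B\<^sup>T" p] B unit_vec_carrier[of p "p - 1"]
    by (metis transpose_carrier_mat)
  then have "det B = 0" using det_transpose[OF B] by simp
  then obtain u where u: "u \<in> carrier_vec p" "u \<noteq> 0\<^sub>v p" "B *\<^sub>v u = 0\<^sub>v p"
    using det_0_iff_vec_prod_zero_field[OF B] by auto
  have "c j \<bullet> u = 0" if "j < k" for j
  proof -
    have "row B j = c j" using that k c[OF that] by (intro eq_vecI) (auto simp: B_def)
    then show ?thesis using arg_cong[OF u(3), of "\<lambda>v. v $ j"] that k B by simp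
  qed
  then show ?thesis using u by auto
qed

text \<open>Compactness is used in the space of real sequences: the constrained unit sphere,
  extended by zero from index \<open>p\<close> on, is a closed subset of a product of intervals,
  which is compact by Tychonoff.\<close>

lemma exists_rayleigh_maximizer:
  fixes c :: "nat \<Rightarrow> real vec"
  assumes A: "A \<in> carrier_mat p p" and c: "\<And>j. j < k \<Longrightarrow> c j \<in> carrier_vec p" and k: "k < p"
  shows "\<exists>u\<in>carrier_vec p. u \<bullet> u = 1 \<and> (\<forall>j<k. c j \<bullet> u = 0) \<and>
    (\<forall>w\<in>carrier_vec p. (\<forall>j<k. c j \<bullet> w = 0) \<longrightarrow> qf A w \<le> qf A u * (w \<bullet> w))"
proof -
  define K where "K = {f :: nat \<Rightarrow> real. (\<forall>i. p \<le> i \<longrightarrow> f i = 0) \<and> (\<Sum>i<p. (f i)\<^sup>2) = 1 \<and>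
    (\<forall>j. j < k \<longrightarrow> (\<Sum>i<p. c j $ i * f i) = 0)}"
  define g where "g = (\<lambda>f :: nat \<Rightarrow> real. \<Sum>i<p. \<Sum>j<p. A $$ (i, j) * (f i * f j))"
  have cont [continuous_intros]: "continuous_on UNIV (\<lambda>f :: nat \<Rightarrow> real. f i)" for i
    by (rule continuous_on_product_coordinates)
  have cl: "closed K" unfolding K_def
    by (intro closed_Collect_conj closed_Collect_all closed_Collect_imp closed_Collect_eq open_Collect_const
        continuous_intros continuous_on_sum continuous_on_power continuous_on_const continuous_on_mult)
  have "compact (PiE UNIV (\<lambda>_ :: nat. {-1..1 :: real}))"
    using compactin_PiE[of "\<lambda>_. euclideanreal" "UNIV :: nat set" "\<lambda>_. {-1..1}"]
    by (simp add: euclidean_product_topology)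
  moreover have "K \<subseteq> PiE UNIV (\<lambda>_ :: nat. {-1..1 :: real})"
  proof (intro subsetI PiE_I)
    fix f and i :: nat assume f: "f \<in> K"
    show "f i \<in> {-1..1}"
    proof (cases "i < p")
      case True
      then have "(f i)\<^sup>2 \<le> (\<Sum>i<p. (f i)\<^sup>2)" by (intro member_le_sum) auto
      also have "\<dots> = 1" using f by (simp add: K_def)
      finally have "\<bar>f i\<bar> \<le> 1" by (simp add: abs_square_le_1)
      then show ?thesis by auto
    qed (use f in \<open>auto simp: K_def\<close>)
  qed auto
  ultimately have "compact K" using cl compact_Int_closed by (metis inf.absorb_iff2)
  define tov where "tov = (\<lambda>f. vec p f :: real vec)"
  have sp: "c j \<bullet> u = (\<Sum>i<p. c j $ i * u $ i)" if "u \<in> carrier_vec p" for u j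
    using that by (simp add: scalar_prod_def lessThan_atLeast0)
  have gq: "qf A u = (\<Sum>i<p. \<Sum>j<p. A $$ (i, j) * (u $ i * u $ j))" if "u \<in> carrier_vec p" for u
    using A that by (simp add: qf_def scalar_prod_def lessThan_atLeast0 sum_distrib_left ac_simps)
  have toK: "(\<lambda>i. if i < p then w $ i / sqrt (w \<bullet> w) else 0) \<in> K" (is "?f \<in> K")
    if w: "w \<in> carrier_vec p" "w \<noteq> 0\<^sub>v p" "\<forall>j<k. c j \<bullet> w = 0" for w
  proof -
    have "(\<Sum>i<p. (?f i)\<^sup>2) = (\<Sum>i<p. (w $ i)\<^sup>2) / (w \<bullet> w)"
      using scalar_prod_self_nonneg[of w] by (simp add: power_divide sum_divide_distrib)
    also have "\<dots> = 1" using scalar_prod_self[OF w(1)] scalar_prod_self_pos[OF w(1,2)] by simp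
    finally have "(\<Sum>i<p. (?f i)\<^sup>2) = 1" .
    moreover have "(\<Sum>i<p. c j $ i * ?f i) = 0" if "j < k" for j
    proof -
      have "(\<Sum>i<p. c j $ i * ?f i) = (\<Sum>i<p. c j $ i * w $ i) / sqrt (w \<bullet> w)"
        by (simp add: sum_divide_distrib)
      then show ?thesis using sp[OF w(1)] w(3) that by simp
    qed
    ultimately show ?thesis by (simp add: K_def)
  qed
  have "\<exists>u\<in>carrier_vec p. u \<noteq> 0\<^sub>v p \<and> (\<forall>j<k. c j \<bullet> u = 0)"
    by (rule exists_orthogonal_vec) (use c k in auto)
  then obtain w0 :: "real vec" where "w0 \<in> carrier_vec p" "w0 \<noteq> 0\<^sub>v p" "\<forall>j<k. c j \<bullet> w0 = 0"
    by auto
  from toK[OF this] have "K \<noteq> {}" by auto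
  moreover have "continuous_on K g" unfolding g_def
    by (rule continuous_on_subset[of UNIV]) (intro continuous_intros continuous_on_sum continuous_on_mult, auto)
  ultimately obtain f where f: "f \<in> K" "\<And>h. h \<in> K \<Longrightarrow> g h \<le> g f"
    using continuous_attains_sup[OF \<open>compact K\<close>] by blast
  define u where "u = vec p f"
  have u: "u \<in> carrier_vec p" by (simp add: u_def)
  have qu: "qf A u = g f" unfolding gq[OF u] g_def by (intro sum.cong) (auto simp: u_def)
  show ?thesis
  proof (intro bexI[of _ u] conjI ballI allI impI)
    show "u \<bullet> u = 1" using f(1) by (simp add: scalar_prod_self[OF u] K_def) (simp add: u_def)
    show "c j \<bullet> u = 0" if "j < k" for j using f(1) that by (simp add: sp[OF u] K_def) (simp add: u_def)
    fix w :: "real vec" assume w: "w \<in> carrier_vec p" "\<forall>j<k. c j \<bullet> w = 0"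
    show "qf A w \<le> qf A u * (w \<bullet> w)"
    proof (cases "w = 0\<^sub>v p")
      case False
      have pos: "w \<bullet> w > 0" by (rule scalar_prod_self_pos[OF w(1) False])
      have "g (\<lambda>i. if i < p then w $ i / sqrt (w \<bullet> w) else 0) \<le> qf A u"
        using f(2)[OF toK[OF w(1) False w(2)]] qu by simp
      also have "g (\<lambda>i. if i < p then w $ i / sqrt (w \<bullet> w) else 0) = qf A w / (w \<bullet> w)"
        unfolding g_def gq[OF w(1)] using pos by (simp add: sum_divide_distrib)
      finally show ?thesis using pos by (simp add: field_simps)
    qed (use A in \<open>auto simp: qf_zero\<close>)
  qed (use u in auto)
qed

text \<open>The maximizer \<open>u\<close> of the Rayleigh quotient orthogonal to the earlier
  eigenvectors has residual \<open>r = A u - a u\<close>. By symmetry of \<open>A\<close> the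
  residual satisfies the same orthogonality constraints, so it is an admissible direction of
  variation, and optimality forces \<open>r = 0\<close>.\<close>

lemma exists_next_eigenvector:
  assumes A: "A \<in> carrier_mat p p" "A\<^sup>T = A"
    and c: "\<And>j. j < k \<Longrightarrow> c j \<in> carrier_vec p" and k: "k < p"
    and eig: "\<And>j. j < k \<Longrightarrow> A *\<^sub>v c j = (l j :: real) \<cdot>\<^sub>v c j"
  shows "\<exists>u\<in>carrier_vec p. u \<bullet> u = 1 \<and> (\<forall>j<k. c j \<bullet> u = 0) \<and> (\<exists>a. A *\<^sub>v u = a \<cdot>\<^sub>v u)"
proof -
  have "\<exists>u\<in>carrier_vec p. u \<bullet> u = 1 \<and> (\<forall>j<k. c j \<bullet> u = 0) \<and>
    (\<forall>w\<in>carrier_vec p. (\<forall>j<k. c j \<bullet> w = 0) \<longrightarrow> qf A w \<le> qf A u * (w \<bullet> w))"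
    by (rule exists_rayleigh_maximizer) (use A c k in auto)
  then obtain u :: "real vec" where u: "u \<in> carrier_vec p" "u \<bullet> u = 1" "\<forall>j<k. c j \<bullet> u = 0"
    and max: "\<And>w. w \<in> carrier_vec p \<Longrightarrow> \<forall>j<k. c j \<bullet> w = 0 \<Longrightarrow> qf A w \<le> qf A u * (w \<bullet> w)"
    by auto
  define a where "a = qf A u"
  define r where "r = A *\<^sub>v u + (- a) \<cdot>\<^sub>v u"
  have Au: "A *\<^sub>v u \<in> carrier_vec p" using A u by simp
  have r: "r \<in> carrier_vec p" using Au u by (simp add: r_def)
  have cr: "\<forall>j<k. c j \<bullet> r = 0"
  proof (intro allI impI)
    fix j assume j: "j < k"
    have "c j \<bullet> (A *\<^sub>v u) = u \<bullet> (A *\<^sub>v c j)" by (rule bilinear_form_sym[OF A c[OF j] u(1)])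
    also have "\<dots> = l j * (c j \<bullet> u)" using u c[OF j] by (simp add: eig[OF j] comm_scalar_prod[OF u(1) c[OF j]])
    finally show "c j \<bullet> r = 0" using u j c[OF j] Au
      by (simp add: r_def scalar_prod_add_distrib[of _ p])
  qed
  have ur: "u \<bullet> r = 0" using u Au by (simp add: r_def scalar_prod_add_distrib[of _ p] a_def qf_def)
  have o: "transpose_mat (1\<^sub>m p :: real mat) = 1\<^sub>m p" by simp
  have rr: "u \<bullet> (A *\<^sub>v r) = r \<bullet> r"
  proof -
    have "u \<bullet> (A *\<^sub>v r) = r \<bullet> (A *\<^sub>v u)" by (rule bilinear_form_sym[OF A u(1) r])
    also have "A *\<^sub>v u = r + a \<cdot>\<^sub>v u" unfolding r_def using Au u A(1) by (intro eq_vecI) auto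
    also have "r \<bullet> \<dots> = r \<bullet> r" using r u ur by (simp add: scalar_prod_add_distrib[of _ p] comm_scalar_prod[of r p u])
    finally show ?thesis .
  qed
  \<comment> \<open>first-order optimality of the maximizer in the direction of the residual r\<close>
  have key: "2 * t * (r \<bullet> r) + t\<^sup>2 * qf A r \<le> a * t\<^sup>2 * (r \<bullet> r)" for t
  proof -
    have tr: "t \<cdot>\<^sub>v r \<in> carrier_vec p" using r by simp
    have "\<forall>j<k. c j \<bullet> (u + t \<cdot>\<^sub>v r) = 0"
      using u r cr c by (simp add: scalar_prod_add_distrib[of _ p])
    then have "qf A (u + t \<cdot>\<^sub>v r) \<le> a * qf (1\<^sub>m p) (u + t \<cdot>\<^sub>v r)"
      using max[of "u + t \<cdot>\<^sub>v r"] u r by (simp add: a_def qf_one)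
    then show ?thesis
      using u r ur rr unfolding qf_add[OF A u(1) tr] qf_add[OF one_carrier_mat o u(1) tr]
      by (simp add: qf_smult[OF A(1) r] qf_smult[OF one_carrier_mat r] qf_one[OF u(1)] qf_one[OF r]
          mult_mat_vec[OF A(1) r] scalar_prod_smult_distrib[OF u(1)] mult_mat_vec_carrier[OF A(1) r]
          a_def[symmetric] algebra_simps)
  qed
  have "r \<bullet> r \<le> 0"
  proof (rule ccontr)
    assume "\<not> r \<bullet> r \<le> 0"
    then have pos: "r \<bullet> r > 0" by simp
    \<comment> \<open>\<open>m\<close> dominates the second-order coefficient, so at
      \<open>t = (r \<bullet> r) / m\<close> the second-order term is at most half of the
      first-order gain.\<close>
    define m where "m = \<bar>a * (r \<bullet> r) - qf A r\<bar> + 1"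
    define t where "t = (r \<bullet> r) / m"
    have m: "m > 0" by (simp add: m_def)
    have t: "t > 0" using m pos by (simp add: t_def)
    have "t * (2 * (r \<bullet> r)) \<le> t * (t * (a * (r \<bullet> r) - qf A r))"
      using key[of t] by (simp add: algebra_simps power2_eq_square)
    then have "2 * (r \<bullet> r) \<le> t * (a * (r \<bullet> r) - qf A r)" using t by simp
    also have "\<dots> \<le> t * m" using t by (simp add: m_def)
    also have "\<dots> = r \<bullet> r" using m by (simp add: t_def)
    finally show False using pos by simp
  qed
  then have "r = 0\<^sub>v p" using scalar_prod_self_pos[OF r] by fastforce
  then have "A *\<^sub>v u = a \<cdot>\<^sub>v u"
  proof -
    have "A *\<^sub>v u = r + a \<cdot>\<^sub>v u" unfolding r_def using Au u A(1) by (intro eq_vecI) auto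
    then show ?thesis using \<open>r = 0\<^sub>v p\<close> u by simp
  qed
  then show ?thesis using u by blast
qed

lemma exists_orthonormal_eigenvectors:
  assumes A: "A \<in> carrier_mat p p" "A\<^sup>T = A" and "k \<le> p"
  shows "\<exists>(q :: nat \<Rightarrow> real vec) l. (\<forall>i<k. q i \<in> carrier_vec p \<and> A *\<^sub>v q i = l i \<cdot>\<^sub>v q i) \<and>
    (\<forall>i<k. \<forall>j<k. q i \<bullet> q j = (if i = j then 1 else 0))"
  using \<open>k \<le> p\<close>
proof (induction k)
  case (Suc k)
  then obtain q :: "nat \<Rightarrow> real vec" and l where q: "\<forall>i<k. q i \<in> carrier_vec p \<and> A *\<^sub>v q i = l i \<cdot>\<^sub>v q i"
    "\<forall>i<k. \<forall>j<k. q i \<bullet> q j = (if i = j then 1 else 0)" by auto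
  from exists_next_eigenvector[OF A, of k q l] q Suc.prems obtain u :: "real vec" and a where
    u: "u \<in> carrier_vec p" "u \<bullet> u = 1" "\<forall>j<k. q j \<bullet> u = 0" "A *\<^sub>v u = a \<cdot>\<^sub>v u" by auto
  have "u \<bullet> q j = 0" if "j < k" for j using u q that by (metis comm_scalar_prod)
  then show ?case using q u
    by (intro exI[of _ "q(k := u)"] exI[of _ "l(k := a)"]) (auto simp: less_Suc_eq)
qed auto

theorem symmetric_mat_diagonalization:
  assumes A: "A \<in> carrier_mat p p" "A\<^sup>T = (A :: real mat)"
  shows "\<exists>U l. U \<in> carrier_mat p p \<and> U\<^sup>T * U = 1\<^sub>m p \<and> U * U\<^sup>T = 1\<^sub>m p \<and>
    A = U * mat_diag p l * U\<^sup>T"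
proof -
  obtain q :: "nat \<Rightarrow> real vec" and l where q: "\<forall>i<p. q i \<in> carrier_vec p \<and> A *\<^sub>v q i = l i \<cdot>\<^sub>v q i"
    "\<forall>i<p. \<forall>j<p. q i \<bullet> q j = (if i = j then 1 else 0)"
    using exists_orthonormal_eigenvectors[OF A order_refl] by blast
  define U where "U = mat p p (\<lambda>(i, j). q j $ i)"
  define D where "D = mat_diag p l"
  have U: "U \<in> carrier_mat p p" "U\<^sup>T \<in> carrier_mat p p" by (auto simp: U_def)
  have D: "D \<in> carrier_mat p p" by (simp add: D_def)
  have col: "col U j = q j" if "j < p" for j using that q(1) by (intro eq_vecI) (auto simp: U_def)
  have 1: "U\<^sup>T * U = 1\<^sub>m p"
    using U q(2) col by (intro eq_matI) (auto simp: row_transpose)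
  then have 2: "U * U\<^sup>T = 1\<^sub>m p" using mat_mult_left_right_inverse[OF U(2,1)] by blast
  have "A * U = U * D"
  proof (rule eq_matI)
    fix i j assume "i < dim_row (U * D)" "j < dim_col (U * D)"
    then have ij: "i < p" "j < p" using U D by auto
    have "(A * U) $$ (i, j) = (A *\<^sub>v q j) $ i" using ij A U by (simp add: col)
    also have "\<dots> = l j * q j $ i" using ij q(1) by (metis carrier_vecD index_smult_vec(1))
    also have "\<dots> = (U * D) $$ (i, j)"
      using ij by (simp add: D_def mat_diag_mult_right[OF U(1)]) (simp add: U_def mult.commute)
    finally show "(A * U) $$ (i, j) = (U * D) $$ (i, j)" .
  qed (use A U D in auto)
  then have "U * D * U\<^sup>T = A * (U * U\<^sup>T)"
    using assoc_mult_mat[OF A(1) U] by simp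
  then have "A = U * D * U\<^sup>T" using 2 A by simp
  then show ?thesis using U 1 2 unfolding D_def by blast
qed

lemma qf_diagonalization:
  assumes "U \<in> carrier_mat p p" "u \<in> carrier_vec p"
  shows "qf (U * mat_diag p l * U\<^sup>T) u =
    (\<Sum>i<p. l i * ((U\<^sup>T *\<^sub>v u) $ i)\<^sup>2)" (is "qf (U * ?D * _) u = _")
proof -
  define y where "y = U\<^sup>T *\<^sub>v u"
  have y: "y \<in> carrier_vec p" using assms by (simp add: y_def)
  have D: "?D \<in> carrier_mat p p" by simp
  have "(U * ?D * U\<^sup>T) *\<^sub>v u = U *\<^sub>v (?D *\<^sub>v y)"
    using assms D by (simp add: y_def assoc_mult_mat_vec[of _ p p _ p])
  then have "qf (U * ?D * U\<^sup>T) u = y \<bullet> (?D *\<^sub>v y)"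
    using transpose_vec_mult_scalar[OF assms(1) mult_mat_vec_carrier[OF D y] assms(2)] assms y
      comm_scalar_prod[OF mult_mat_vec_carrier[OF D y]] mult_mat_vec_carrier[OF D y]
    by (simp add: qf_def y_def comm_scalar_prod[of u p])
  also have "\<dots> = (\<Sum>i<p. \<Sum>j<p. y $ i * ((if i = j then l j else 0) * y $ j))"
    using y by (simp add: mat_diag_def scalar_prod_def lessThan_atLeast0 sum_distrib_left)
  also have "\<dots> = (\<Sum>i<p. \<Sum>j<p. if i = j then l i * (y $ i)\<^sup>2 else 0)"
    by (intro sum.cong) (auto simp: power2_eq_square)
  finally show ?thesis by (simp add: y_def)
qed

lemma orthogonal_norm:
  assumes "U \<in> carrier_mat p p" "U * U\<^sup>T = 1\<^sub>m p" "u \<in> carrier_vec p"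
  shows "(\<Sum>i<p. ((U\<^sup>T *\<^sub>v u) $ i)\<^sup>2) = (u :: real vec) \<bullet> u"
  using qf_diagonalization[OF assms(1,3), of "\<lambda>_. 1"] assms by (simp add: qf_one)

lemma pos_def_diagonalization:
  assumes S: "pos_def_mat p S"
  obtains U l where "U \<in> carrier_mat p p" "U\<^sup>T * U = 1\<^sub>m p" "U * U\<^sup>T = 1\<^sub>m p"
    "S = U * mat_diag p l * U\<^sup>T" "\<And>i. i < p \<Longrightarrow> l i > 0"
proof -
  note c = pos_def_matD(1,2)[OF S]
  from symmetric_mat_diagonalization[OF c] obtain U l where U: "U \<in> carrier_mat p p"
    "U\<^sup>T * U = 1\<^sub>m p" "U * U\<^sup>T = 1\<^sub>m p"
    "S = U * mat_diag p l * U\<^sup>T" by blast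
  have "l i > 0" if i: "i < p" for i
  proof -
    define u where "u = U *\<^sub>v unit_vec p i"
    have u: "u \<in> carrier_vec p" using U by (simp add: u_def)
    have Uu: "U\<^sup>T *\<^sub>v u = unit_vec p i"
      using assoc_mult_mat_vec[of "U\<^sup>T" p p U p "unit_vec p i"] U by (simp add: u_def)
    have "u \<bullet> u = 1"
      using orthogonal_norm[OF U(1,3) u] scalar_prod_self[OF unit_vec_carrier[of p i]] i by (simp add: Uu)
    then have "u \<noteq> 0\<^sub>v p" by auto
    then have "qf S u > 0" by (rule qf_pos[OF S u])
    also have "qf S u = (\<Sum>j<p. l j * (unit_vec p i $ j)\<^sup>2)"
      unfolding U(4) qf_diagonalization[OF U(1) u] Uu by simp
    also have "\<dots> = (\<Sum>j<p. if j = i then l i else 0)" using i by (intro sum.cong) auto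
    finally show ?thesis using i by simp
  qed
  then show ?thesis using that U by blast
qed

text \<open>\<open>U diag(sqrt l) U^T\<close> is a positive definite root, and uniqueness of such a
  root identifies it with the definite description \<open>mat_sqrt\<close>.\<close>

lemma mat_sqrt_props:
  assumes S: "pos_def_mat p S"
  shows "pos_def_mat p (mat_sqrt p S)" "mat_sqrt p S * mat_sqrt p S = S"
proof -
  obtain U l where U: "U \<in> carrier_mat p p" "U\<^sup>T * U = 1\<^sub>m p" "U * U\<^sup>T = 1\<^sub>m p"
    and SU: "S = U * mat_diag p l * U\<^sup>T"
    and l: "\<And>i. i < p \<Longrightarrow> l i > 0"
    using pos_def_diagonalization[OF S] by blast
  define D where "D = mat_diag p (\<lambda>i. sqrt (l i))"
  define V where "V = U\<^sup>T"
  define R where "R = U * D * V"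
  have D: "D \<in> carrier_mat p p" "D\<^sup>T = D" by (auto simp: D_def mat_diag_def intro!: eq_matI)
  have V: "V \<in> carrier_mat p p" using U by (simp add: V_def)
  have R: "R \<in> carrier_mat p p" using U V D by (simp add: R_def)
  have UD: "U * D \<in> carrier_mat p p" using U D by simp
  have "R\<^sup>T = U * (D * V)"
    unfolding R_def using transpose_mult[OF UD V] transpose_mult[OF U(1) D(1)] D(2) by (simp add: V_def)
  then have Rt: "R\<^sup>T = R" using assoc_mult_mat[OF U(1) D(1) V] by (simp add: R_def)
  have DD: "D * D = mat_diag p l"
    unfolding D_def mat_diag_diag using l by (intro eq_matI) (auto simp: mat_diag_def abs_of_pos)
  have DV: "D * V \<in> carrier_mat p p" using D V by simp
  have "R * R = U * D * (V * (U * D * V))"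
    unfolding R_def by (rule assoc_mult_mat[OF UD V mult_carrier_mat[OF UD V]])
  also have "V * (U * D * V) = D * V"
    unfolding assoc_mult_mat[OF U(1) D(1) V] assoc_mult_mat[OF V U(1) DV, symmetric]
    using U(2) left_mult_one_mat[OF DV] by (simp add: V_def)
  also have "U * D * (D * V) = U * (D * D) * V"
    using assoc_mult_mat[OF UD D(1) V] assoc_mult_mat[OF U(1) D(1) D(1)] by simp
  finally have RR: "R * R = S" by (simp add: SU DD V_def)
  have Rp: "pos_def_mat p R"
  proof (rule pos_def_matI[OF R Rt])
    fix u :: "real vec" assume u: "u \<in> carrier_vec p" "u \<noteq> 0\<^sub>v p"
    have q: "qf R u = (\<Sum>i<p. sqrt (l i) * ((U\<^sup>T *\<^sub>v u) $ i)\<^sup>2)"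
      unfolding R_def D_def V_def by (rule qf_diagonalization[OF U(1) u(1)])
    have "\<exists>i<p. (U\<^sup>T *\<^sub>v u) $ i \<noteq> 0"
    proof (rule ccontr)
      assume "\<not> ?thesis"
      then have "(\<Sum>i<p. ((U\<^sup>T *\<^sub>v u) $ i)\<^sup>2) = 0" by (intro sum.neutral) auto
      then show False using orthogonal_norm[OF U(1,3) u(1)] scalar_prod_self_pos[OF u] by simp
    qed
    then obtain i where i: "i < p" "(U\<^sup>T *\<^sub>v u) $ i \<noteq> 0" by blast
    have "0 < sqrt (l i) * ((U\<^sup>T *\<^sub>v u) $ i)\<^sup>2" using i l by simp
    also have "\<dots> \<le> qf R u" unfolding q using i l
      by (intro member_le_sum) (auto simp: less_imp_le)
    finally show "qf R u > 0" .
  qed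
  show "pos_def_mat p (mat_sqrt p S)" "mat_sqrt p S * mat_sqrt p S = S"
    using mat_sqrt_eq[OF Rp RR] Rp RR by simp_all
qed

lemma qf_sqrt:
  fixes w :: "real vec"
  assumes S: "pos_def_mat p S" and w: "w \<in> carrier_vec p"
  shows "(mat_sqrt p S *\<^sub>v w) \<bullet> (mat_sqrt p S *\<^sub>v w) = qf S w"
    and "qf (mat_inv S) (mat_sqrt p S *\<^sub>v w) = w \<bullet> w"
proof -
  define y where "y = mat_sqrt p S *\<^sub>v w"
  define R where "R = mat_sqrt p S"
  note Rp = mat_sqrt_props[OF S, folded R_def]
  note R = pos_def_matD(1,2)[OF Rp(1)] and I = mat_inv_pos_def[OF S]
  have y: "y \<in> carrier_vec p" "y = R *\<^sub>v w" using R w by (simp_all add: y_def R_def)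
  have "y \<bullet> y = w \<bullet> (R *\<^sub>v y)" using bilinear_form_sym[OF R w y(1)] y(2) by simp
  then show "(mat_sqrt p S *\<^sub>v w) \<bullet> (mat_sqrt p S *\<^sub>v w) = qf S w"
    using assoc_mult_mat_vec[OF R(1) R(1) w] Rp(2) y(2) by (simp add: qf_def R_def)
  define v where "v = mat_inv S *\<^sub>v y"
  have v: "v \<in> carrier_vec p" using I y by (simp add: v_def)
  have "S *\<^sub>v v = y" unfolding v_def
    using assoc_mult_mat_vec[OF pos_def_matD(1)[OF S] I(1) y(1)] I(2) y by simp
  then have "R *\<^sub>v (R *\<^sub>v v) = R *\<^sub>v w" using assoc_mult_mat_vec[OF R(1) R(1) v] Rp(2) y(2) by simp
  then have "R *\<^sub>v v = w"
    using mat_inv_pos_def[OF Rp(1)] assoc_mult_mat_vec[of "mat_inv R" p p R p] R w v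
    by (metis mult_mat_vec_carrier one_mult_mat_vec)
  then show "qf (mat_inv S) (mat_sqrt p S *\<^sub>v w) = w \<bullet> w"
    using bilinear_form_sym[OF R w v] comm_scalar_prod[OF y(1) v] y(2)
    by (simp add: qf_def v_def R_def)
qed

lemma mat_trace_mult_sqrt:
  assumes B: "pos_def_mat p B" and X: "X \<in> carrier_mat p p"
  shows "mat_trace (B * X) = (\<Sum>j<p. qf X (col (mat_sqrt p B) j))"
proof -
  define R where "R = mat_sqrt p B"
  note Rp = mat_sqrt_props[OF B, folded R_def]
  note R = pos_def_matD(1,2)[OF Rp(1)]
  have "B * X = R * (R * X)" using assoc_mult_mat[OF R(1) R(1) X] Rp(2) by simp
  then have "mat_trace (B * X) = mat_trace ((R * X) * R)" using R X by (simp add: mat_trace_mult_comm[of R p "R * X"])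
  also have "(R * X) * R = R * (X * R)" by (rule assoc_mult_mat[OF R(1) X R(1)])
  finally show ?thesis using mat_trace_conjugate[OF R X] by (simp add: R_def)
qed

text \<open>For the lower bound, \<open>ln l \<le> l - 1\<close> is applied to all eigenvalues but
  one. As the eigenvalues sum to \<open>p\<close>, these contribute at most 1 to
  \<open>ln (det S)\<close>, so the remaining one is at least \<open>det S / e\<close>.\<close>

lemma qf_bounds_trace_det:
  assumes S: "pos_def_mat p S" and tr: "mat_trace S = real p" and u: "u \<in> carrier_vec p"
  shows "qf S u \<le> real p * (u \<bullet> u)" and "det S > 0" and "det S * exp (-1) * (u \<bullet> u) \<le> qf S u"
proof -
  obtain U l where U: "U \<in> carrier_mat p p" "U\<^sup>T * U = 1\<^sub>m p" "U * U\<^sup>T = 1\<^sub>m p"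
    and SU: "S = U * mat_diag p l * U\<^sup>T"
    and l: "\<And>i. i < p \<Longrightarrow> l i > 0"
    using pos_def_diagonalization[OF S] by blast
  define D where "D = mat_diag p l"
  have D: "D \<in> carrier_mat p p" by (simp add: D_def)
  have Ut: "U\<^sup>T \<in> carrier_mat p p" using U by simp
  have "mat_trace S = mat_trace (U\<^sup>T * (U * D))"
    unfolding SU D_def[symmetric] using U D by (intro mat_trace_mult_comm) auto
  also have "U\<^sup>T * (U * D) = D" using assoc_mult_mat[OF Ut U(1) D] U(2) D by simp
  finally have suml: "(\<Sum>i<p. l i) = real p" using tr by (simp add: D_def mat_diag_def mat_trace_def)
  have "det (U\<^sup>T) * det U = 1" using det_mult[OF Ut U(1)] U(2) by simp
  then have "det S = det D" unfolding SU D_def[symmetric] using U D Ut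
    by (simp add: det_mult[of _ p] mult_ac)
  also have "det D = (\<Prod>i<p. l i)"
    by (subst det_upper_triangular[OF _ D]) (auto simp: D_def mat_diag_def prod_list_diag_prod lessThan_atLeast0)
  finally have detS: "det S = (\<Prod>i<p. l i)" .
  show dp: "det S > 0" unfolding detS using l by (intro prod_pos) auto
  have le: "l i \<le> real p" if "i < p" for i
    unfolding suml[symmetric] using that l by (intro member_le_sum) (auto simp: less_imp_le)
  have ge: "det S * exp (-1) \<le> l i" if i: "i < p" for i
  proof -
    have "ln (det S) = (\<Sum>j<p. ln (l j))" unfolding detS using l by (intro ln_prod) (auto simp: less_le)
    also have "\<dots> = ln (l i) + (\<Sum>j\<in>{..<p} - {i}. ln (l j))" using i by (simp add: sum.remove)
    also have "(\<Sum>j\<in>{..<p} - {i}. ln (l j)) \<le> (\<Sum>j\<in>{..<p} - {i}. l j - 1)"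
      using l by (intro sum_mono ln_le_minus_one) auto
    also have "\<dots> = (\<Sum>j<p. l j) - l i - (real p - 1)" using i
      by (simp add: sum_subtractf sum.remove[of "{..<p}" i l] of_nat_diff)
    also have "\<dots> \<le> 1" using suml l[OF i] by simp
    finally have "ln (det S) \<le> ln (l i) + 1" by simp
    then have "exp (ln (det S) + - 1) \<le> exp (ln (l i))" by simp
    then show ?thesis unfolding exp_add using dp l[OF i] by simp
  qed
  have q: "qf S u = (\<Sum>i<p. l i * ((U\<^sup>T *\<^sub>v u) $ i)\<^sup>2)"
    unfolding SU by (rule qf_diagonalization[OF U(1) u])
  have n: "(\<Sum>i<p. a * ((U\<^sup>T *\<^sub>v u) $ i)\<^sup>2) = a * (u \<bullet> u)" for a
    unfolding sum_distrib_left[symmetric] orthogonal_norm[OF U(1,3) u] ..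
  show "qf S u \<le> real p * (u \<bullet> u)" unfolding q n[symmetric] using le
    by (intro sum_mono mult_right_mono) auto
  show "det S * exp (-1) * (u \<bullet> u) \<le> qf S u" unfolding q n[symmetric] using ge
    by (intro sum_mono mult_right_mono) auto
qed

section \<open>Contraction of Tyler's map\<close>

definition sandwiched :: "nat \<Rightarrow> real \<Rightarrow> real \<Rightarrow> real mat \<Rightarrow> real mat \<Rightarrow> bool" where
  "sandwiched p m M S S' \<longleftrightarrow> (\<forall>u\<in>carrier_vec p. m * qf S u \<le> qf S' u \<and> qf S' u \<le> M * qf S u)"

text \<open>In terms of Hilbert's projective metric this says that the distance is at most \<open>ln (1 + e)\<close>.\<close>

definition proj_close :: "nat \<Rightarrow> real \<Rightarrow> real mat \<Rightarrow> real mat \<Rightarrow> bool" where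
  "proj_close p e S S' \<longleftrightarrow> (\<exists>m>0. sandwiched p m (m * (1 + e)) S S')"

lemma sandwichedD:
  assumes "sandwiched p m M S S'" "u \<in> carrier_vec p"
  shows "m * qf S u \<le> qf S' u" "qf S' u \<le> M * qf S u"
  using assms by (auto simp: sandwiched_def)

lemma sandwiched_trans:
  assumes "sandwiched p m M S S'" "sandwiched p m' M' S' S''" "m' \<ge> 0" "M' \<ge> 0"
  shows "sandwiched p (m' * m) (M' * M) S S''"
  unfolding sandwiched_def
proof (intro ballI conjI)
  fix u :: "real vec" assume u: "u \<in> carrier_vec p"
  note a = sandwichedD[OF assms(1) u] and b = sandwichedD[OF assms(2) u]
  show "m' * m * qf S u \<le> qf S'' u" using mult_left_mono[OF a(1) assms(3)] b by simp
  show "qf S'' u \<le> M' * M * qf S u" using mult_left_mono[OF a(2) assms(4)] b by simp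
qed

lemma sandwiched_sym:
  assumes "sandwiched p m M S S'" "m > 0" "M > 0"
  shows "sandwiched p (1 / M) (1 / m) S' S"
  using assms by (auto simp: sandwiched_def field_simps)

lemma sandwiched_mono:
  assumes "sandwiched p m M S S'" "m' \<le> m" "M \<le> M'" "pos_def_mat p S"
  shows "sandwiched p m' M' S S'"
  unfolding sandwiched_def
proof (intro ballI conjI)
  fix u :: "real vec" assume u: "u \<in> carrier_vec p"
  note a = sandwichedD[OF assms(1) u] and q = qf_nonneg[OF assms(4) u]
  show "m' * qf S u \<le> qf S' u" using mult_right_mono[OF assms(2) q] a by simp
  show "qf S' u \<le> M' * qf S u" using mult_right_mono[OF assms(3) q] a by simp
qed

lemma sandwiched_bounds_le:
  assumes "sandwiched p m M S S'" "pos_def_mat p S" "p \<ge> 1" shows "m \<le> M"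
proof -
  have "unit_vec p 0 \<noteq> (0\<^sub>v p :: real vec)" using assms(3) by (intro unit_vec_nonzero) auto
  then have "qf S (unit_vec p 0) > 0" by (intro qf_pos[OF assms(2)]) auto
  moreover have "m * qf S (unit_vec p 0) \<le> M * qf S (unit_vec p 0)"
    using sandwichedD[OF assms(1), of "unit_vec p 0"] by simp
  ultimately show ?thesis by simp
qed

lemma sandwiched_inv:
  assumes "sandwiched p m M S S'" "pos_def_mat p S" "pos_def_mat p S'" "m > 0" "M > 0" "x \<in> carrier_vec p"
  shows "m * qf (mat_inv S') x \<le> qf (mat_inv S) x" "qf (mat_inv S) x \<le> M * qf (mat_inv S') x"
proof -
  show "m * qf (mat_inv S') x \<le> qf (mat_inv S) x"
    by (rule qf_inv_antimono[OF assms(2,3,6,4)]) (use sandwichedD[OF assms(1)] in auto)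
  have "1 / M * qf (mat_inv S) x \<le> qf (mat_inv S') x"
    by (rule qf_inv_antimono[OF assms(3,2,6)]) (use sandwichedD[OF assms(1)] assms(5) in \<open>auto simp: field_simps\<close>)
  then show "qf (mat_inv S) x \<le> M * qf (mat_inv S') x" using assms(5) by (simp add: field_simps)
qed

text \<open>Rescaling to trace \<open>p\<close> makes the trace and determinant bounds available.
  The purpose is that any two positive definite matrices have finite projective distance.\<close>

lemma pos_def_bounds:
  assumes S: "pos_def_mat p S" and p: "p \<ge> 1"
  shows "\<exists>a>0. \<exists>b>0. sandwiched p a b (1\<^sub>m p) S"
proof -
  define c where "c = real p / mat_trace S"
  have c: "c > 0" using mat_trace_pos[OF S p] p by (simp add: c_def)
  have cS: "pos_def_mat p (c \<cdot>\<^sub>m S)" by (rule pos_def_smult[OF S c])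
  have tr: "mat_trace (c \<cdot>\<^sub>m S) = real p"
    using mat_trace_smult[OF pos_def_matD(1)[OF S]] mat_trace_pos[OF S p] by (simp add: c_def)
  note B = qf_bounds_trace_det[OF cS tr]
  have d: "det (c \<cdot>\<^sub>m S) > 0" using B(2)[of "0\<^sub>v p"] by simp
  have "sandwiched p (det (c \<cdot>\<^sub>m S) * exp (-1) / c) (real p / c) (1\<^sub>m p) S"
    unfolding sandwiched_def
  proof
    fix u :: "real vec" assume u: "u \<in> carrier_vec p"
    show "det (c \<cdot>\<^sub>m S) * exp (- 1) / c * qf (1\<^sub>m p) u \<le> qf S u \<and> qf S u \<le> real p / c * qf (1\<^sub>m p) u"
      using B(1,3)[OF u] c unfolding qf_smult_mat[OF pos_def_matD(1)[OF S] u] qf_one[OF u]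
      by (simp add: field_simps)
  qed
  moreover have "det (c \<cdot>\<^sub>m S) * exp (-1) / c > 0" "real p / c > 0" using c d p by auto
  ultimately show ?thesis by blast
qed

lemma pos_def_proj_close:
  assumes S: "pos_def_mat p S" and S': "pos_def_mat p S'" and p: "p \<ge> 1"
  shows "\<exists>e\<ge>0. proj_close p e S S'"
proof -
  obtain a b where ab: "a > 0" "b > 0" "sandwiched p a b (1\<^sub>m p) S" using pos_def_bounds[OF S p] by blast
  obtain a' b' where ab': "a' > 0" "b' > 0" "sandwiched p a' b' (1\<^sub>m p) S'" using pos_def_bounds[OF S' p] by blast
  have s: "sandwiched p (a' * (1 / b)) (b' * (1 / a)) S S'"
    by (rule sandwiched_trans[OF sandwiched_sym[OF ab(3)] ab'(3)]) (use ab ab' in auto)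
  have le: "a' * (1 / b) \<le> b' * (1 / a)" by (rule sandwiched_bounds_le[OF s S p])
  show ?thesis unfolding proj_close_def
    using s ab(1,2) ab'(1,2) le
    by (intro exI[of _ "b' * (1 / a) / (a' * (1 / b)) - 1"] conjI exI[of _ "a' * (1 / b)"]) (auto simp: field_simps)
qed

lemma proj_close_weaken:
  assumes "proj_close p e S S'" "e \<le> e'" "pos_def_mat p S" shows "proj_close p e' S S'"
proof -
  obtain m where m: "m > 0" "sandwiched p m (m * (1 + e)) S S'" using assms by (auto simp: proj_close_def)
  have "sandwiched p m (m * (1 + e')) S S'"
    by (rule sandwiched_mono[OF m(2) order_refl _ assms(3)]) (use m assms(2) in auto)
  then show ?thesis using m by (auto simp: proj_close_def)
qed

lemma proj_close_smult:
  assumes "proj_close p e S S'" "c > 0" "pos_def_mat p S'"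
  shows "proj_close p e S (c \<cdot>\<^sub>m S')"
proof -
  obtain m where m: "m > 0" "sandwiched p m (m * (1 + e)) S S'" using assms by (auto simp: proj_close_def)
  have "sandwiched p c c S' (c \<cdot>\<^sub>m S')" by (auto simp: sandwiched_def qf_smult_mat[OF pos_def_matD(1)[OF assms(3)]])
  from sandwiched_trans[OF m(2) this] assms(2) have "sandwiched p (c * m) (c * m * (1 + e)) S (c \<cdot>\<^sub>m S')"
    by (simp add: mult.assoc)
  then show ?thesis unfolding proj_close_def using m assms(2) by (intro exI[of _ "c * m"]) auto
qed

lemma mat_eq_if_sandwiched:
  assumes S: "pos_def_mat p S" and S': "pos_def_mat p S'" and d: "d \<longlonglongrightarrow> 0"
    and s: "\<And>t :: nat. sandwiched p (exp (- d t)) (exp (d t)) S S'"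
  shows "S' = S"
proof (rule mat_eq_if_qf_eq[OF pos_def_matD(1,2)[OF S'] pos_def_matD(1,2)[OF S]])
  fix u :: "real vec" assume u: "u \<in> carrier_vec p"
  have "exp (- 0) * qf S u \<le> qf S' u"
    by (rule LIMSEQ_le_const2[of "\<lambda>t. exp (- d t) * qf S u"]) (use sandwichedD(1)[OF s u] in \<open>auto intro!: tendsto_eq_intros d\<close>)
  moreover have "qf S' u \<le> exp 0 * qf S u"
    by (rule LIMSEQ_le_const[of "\<lambda>t. exp (d t) * qf S u"]) (use sandwichedD(2)[OF s u] in \<open>auto intro!: tendsto_eq_intros d\<close>)
  ultimately show "qf S' u = qf S u" by simp
qed

section \<open>Tyler's map of an arbitrary sample without zero vectors\<close>

locale tyler_data =
  fixes p n :: nat and x :: "nat \<Rightarrow> real vec"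
  assumes p: "p \<ge> 1" and n: "n \<ge> 1"
    and x: "\<And>i. i < n \<Longrightarrow> x i \<in> carrier_vec p" "\<And>i. i < n \<Longrightarrow> x i \<noteq> 0\<^sub>v p"
begin

abbreviation "F \<equiv> tyler_map p n x"

lemma tyler_map_carrier: "F S \<in> carrier_mat p p" and tyler_map_sym: "transpose_mat (F S) = F S"
  by (auto simp: tyler_map_def mult.commute intro!: eq_matI)

lemma qf_tyler_map:
  assumes u: "u \<in> carrier_vec p"
  shows "qf (F S) u = real p / real n * (\<Sum>i<n. (u \<bullet> x i)\<^sup>2 / qf (mat_inv S) (x i))"
proof -
  define d where "d = (\<lambda>i. qf (mat_inv S) (x i))"
  have "qf (F S) u = (\<Sum>j<p. \<Sum>k<p. u $ j * (F S $$ (j, k) * u $ k))"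
    using u tyler_map_carrier[of S] by (simp add: qf_def scalar_prod_def lessThan_atLeast0 sum_distrib_left)
  also have "\<dots> = (\<Sum>j<p. \<Sum>k<p. \<Sum>i<n. real p / real n * ((u $ j * x i $ j) * (u $ k * x i $ k) / d i))"
    by (intro sum.cong refl)
      (simp add: tyler_map_def d_def qf_def sum_distrib_left sum_distrib_right, simp add: algebra_simps)
  also have "\<dots> = (\<Sum>j<p. \<Sum>i<n. \<Sum>k<p. real p / real n * ((u $ j * x i $ j) * (u $ k * x i $ k) / d i))"
    by (intro sum.cong refl sum.swap)
  also have "\<dots> = (\<Sum>i<n. \<Sum>j<p. \<Sum>k<p. real p / real n * ((u $ j * x i $ j) * (u $ k * x i $ k) / d i))"
    by (rule sum.swap)
  also have "\<dots> = (\<Sum>i<n. real p / real n * ((\<Sum>j<p. u $ j * x i $ j) * (\<Sum>k<p. u $ k * x i $ k) / d i))"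
    by (simp only: sum_product) (simp only: sum_distrib_left sum_divide_distrib)
  also have "\<dots> = (\<Sum>i<n. real p / real n * ((u \<bullet> x i)\<^sup>2 / d i))"
  proof (intro sum.cong refl)
    fix i assume "i \<in> {..<n}"
    then have "u \<bullet> x i = (\<Sum>j<p. u $ j * x i $ j)" using x(1)[of i] by (simp add: scalar_prod_def lessThan_atLeast0)
    then show "real p / real n * ((\<Sum>j<p. u $ j * x i $ j) * (\<Sum>k<p. u $ k * x i $ k) / d i) =
        real p / real n * ((u \<bullet> x i)\<^sup>2 / d i)" by (simp only: power2_eq_square)
  qed
  finally show ?thesis by (simp only: d_def sum_distrib_left)
qed

text \<open>Two order reversals cancel: the inversion of \<open>S\<close> and the division by the
  inverse forms. The bounds therefore hold term by term in the sum over the sample.\<close>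

lemma tyler_map_sandwiched:
  assumes S: "pos_def_mat p S" and S': "pos_def_mat p S'" and m: "m > 0" and s: "sandwiched p m M S S'"
  shows "sandwiched p m M (F S) (F S')"
proof -
  have M: "M > 0" using sandwiched_bounds_le[OF s S p] m by simp
  have 1: "m * ((u \<bullet> x i)\<^sup>2 / qf (mat_inv S) (x i)) \<le> (u \<bullet> x i)\<^sup>2 / qf (mat_inv S') (x i)"
    and 2: "(u \<bullet> x i)\<^sup>2 / qf (mat_inv S') (x i) \<le> M * ((u \<bullet> x i)\<^sup>2 / qf (mat_inv S) (x i))" if i: "i < n" for i u
  proof -
    define a b where "a = qf (mat_inv S) (x i)" and "b = qf (mat_inv S') (x i)"
    have pos: "a > 0" "b > 0"
      using qf_inv_pos[OF S x(1,2)] qf_inv_pos[OF S' x(1,2)] i by (auto simp: a_def b_def)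
    have le: "m * b \<le> a" "a \<le> M * b"
      using sandwiched_inv[OF s S S' m M x(1)[OF i]] by (auto simp: a_def b_def)
    have "m / a \<le> 1 / b" "1 / b \<le> M / a" using le pos by (auto simp: field_simps)
    from mult_right_mono[OF this(1), of "(u \<bullet> x i)\<^sup>2"] mult_right_mono[OF this(2), of "(u \<bullet> x i)\<^sup>2"]
    show "m * ((u \<bullet> x i)\<^sup>2 / qf (mat_inv S) (x i)) \<le> (u \<bullet> x i)\<^sup>2 / qf (mat_inv S') (x i)"
      "(u \<bullet> x i)\<^sup>2 / qf (mat_inv S') (x i) \<le> M * ((u \<bullet> x i)\<^sup>2 / qf (mat_inv S) (x i))"
      by (simp_all add: a_def b_def)
  qed
  show ?thesis unfolding sandwiched_def
  proof (intro ballI conjI)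
    fix u :: "real vec" assume u: "u \<in> carrier_vec p"
    show "m * qf (F S) u \<le> qf (F S') u" "qf (F S') u \<le> M * qf (F S) u"
      unfolding qf_tyler_map[OF u] mult.left_commute[of _ "real p / real n"] unfolding sum_distrib_left[of m] sum_distrib_left[of M]
      by (intro mult_left_mono sum_mono 1 2; simp)+
  qed
qed

text \<open>Homogeneity is the degenerate case \<open>m = M = c\<close> of the sandwich
  estimate.\<close>

lemma tyler_map_smult:
  assumes S: "pos_def_mat p S" and c: "c > 0"
  shows "F (c \<cdot>\<^sub>m S) = c \<cdot>\<^sub>m F S"
proof (rule mat_eq_if_qf_eq[OF tyler_map_carrier tyler_map_sym])
  show "c \<cdot>\<^sub>m F S \<in> carrier_mat p p" using tyler_map_carrier by simp
  show "(c \<cdot>\<^sub>m F S)\<^sup>T = c \<cdot>\<^sub>m F S" by (simp add: transpose_smult tyler_map_sym)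
  fix u :: "real vec" assume u: "u \<in> carrier_vec p"
  have "sandwiched p c c S (c \<cdot>\<^sub>m S)"
    using qf_smult_mat[OF pos_def_matD(1)[OF S]] by (auto simp: sandwiched_def)
  from sandwichedD[OF tyler_map_sandwiched[OF S pos_def_smult[OF S c] c this] u]
  show "qf (F (c \<cdot>\<^sub>m S)) u = qf (c \<cdot>\<^sub>m F S) u" unfolding qf_smult_mat[OF tyler_map_carrier u] by simp
qed

text \<open>The trace of \<open>S\<^sup>-\<^sup>1 F(S)\<close> is \<open>p\<close>, so \<open>F(S)\<close> lies neither strictly above nor strictly below \<open>S\<close>.\<close>

lemma sandwiched_tyler_map_self:
  assumes S: "pos_def_mat p S" and s: "sandwiched p m M S (F S)"
  shows "m \<le> 1" "1 \<le> M"
proof -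
  define R where "R = mat_sqrt p (mat_inv S)"
  note I = pos_def_inv[OF S]
  note R = pos_def_matD[OF mat_sqrt_props(1)[OF I], folded R_def]
  have c: "col R j \<in> carrier_vec p" for j using R by (simp add: carrier_vecI)
  have one: "(\<Sum>j<p. qf S (col R j)) = real p"
    using mat_trace_mult_sqrt[OF I pos_def_matD(1)[OF S]] mat_inv_pos_def(3)[OF S]
    by (simp add: R_def mat_trace_def)
  \<comment> \<open>Summed over the columns of \<open>R\<close>, the numerators belonging to
    \<open>x i\<close> add up to its denominator, so every sample contributes exactly
    \<open>p / n\<close> to the trace.\<close>
  have sumsq: "(\<Sum>j<p. (col R j \<bullet> x i)\<^sup>2) = qf (mat_inv S) (x i)" if i: "i < n" for i
  proof -
    have Rx: "R *\<^sub>v x i \<in> carrier_vec p" using R x(1)[OF i] by simp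
    have "col R j = row R j" if "j < p" for j using that R by (metis row_transpose)
    then have "col R j \<bullet> x i = (R *\<^sub>v x i) $ j" if "j < p" for j using that R by simp
    then have "(\<Sum>j<p. (col R j \<bullet> x i)\<^sup>2) = (R *\<^sub>v x i) \<bullet> (R *\<^sub>v x i)" by (simp add: scalar_prod_self[OF Rx])
    then show ?thesis using qf_sqrt(1)[OF I x(1)[OF i]] by (simp add: R_def)
  qed
  have "(\<Sum>j<p. qf (F S) (col R j)) = real p / real n * (\<Sum>j<p. \<Sum>i<n. (col R j \<bullet> x i)\<^sup>2 / qf (mat_inv S) (x i))"
    by (simp only: qf_tyler_map[OF c] sum_distrib_left)
  also have "(\<Sum>j<p. \<Sum>i<n. (col R j \<bullet> x i)\<^sup>2 / qf (mat_inv S) (x i)) =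
      (\<Sum>i<n. (\<Sum>j<p. (col R j \<bullet> x i)\<^sup>2) / qf (mat_inv S) (x i))"
    by (subst sum.swap) (simp only: sum_divide_distrib)
  also have "(\<Sum>i<n. (\<Sum>j<p. (col R j \<bullet> x i)\<^sup>2) / qf (mat_inv S) (x i)) = (\<Sum>i<n. 1)"
    using sumsq qf_inv_pos[OF S x] by (intro sum.cong) (auto simp: less_le)
  finally have tot: "(\<Sum>j<p. qf (F S) (col R j)) = real p" using n by simp
  have "m * (\<Sum>j<p. qf S (col R j)) \<le> (\<Sum>j<p. qf (F S) (col R j))"
    "(\<Sum>j<p. qf (F S) (col R j)) \<le> M * (\<Sum>j<p. qf S (col R j))"
    unfolding sum_distrib_left by (intro sum_mono sandwichedD[OF s c])+
  then show "m \<le> 1" "1 \<le> M" using p by (auto simp: one tot)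
qed

end

section \<open>Samples that are regular with respect to a reference matrix\<close>

text \<open>After division by both forms, \<open>spread\<close> speaks of \<open>p\<close> times the
  squared component of a whitened, normalized sample in one direction. With a quarter of exceptions
  per direction, any two directions leave at least half of the samples good for both. The tolerance
  \<open>\<tau> / 8\<close> keeps the drift of the reference point below the gain by
  contraction.\<close>

locale tyler_regular = tyler_data +
  fixes \<Sigma> :: "real mat" and \<tau> :: real
  assumes Sigma: "pos_def_mat p \<Sigma>" and tau: "0 < \<tau>" "\<tau> \<le> 1"
    and near_fixed: "sandwiched p (1 - \<tau> / 8) (1 + \<tau> / 8) \<Sigma> (tyler_map p n x \<Sigma>)"
    and spread: "\<And>u. u \<in> carrier_vec p \<Longrightarrow>
      real (card {i. i < n \<and> real p * (u \<bullet> x i)\<^sup>2 < \<tau> * qf (mat_inv \<Sigma>) (x i) * qf \<Sigma> u}) \<le> real n / 4"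
begin

text \<open>Positivity is inherited from \<open>F \<Sigma>\<close>: a positive multiple of
  \<open>\<Sigma>\<close> lies below \<open>S\<close>, and \<open>F\<close> preserves this
  order.\<close>

lemma tyler_map_pos_def:
  assumes S: "pos_def_mat p S" shows "pos_def_mat p (F S)"
proof -
  obtain e where e: "e \<ge> 0" "proj_close p e \<Sigma> S" using pos_def_proj_close[OF Sigma S p] by blast
  then obtain m where m: "m > 0" "sandwiched p m (m * (1 + e)) \<Sigma> S" by (auto simp: proj_close_def)
  note F = tyler_map_sandwiched[OF Sigma S m]
  show ?thesis
  proof (rule pos_def_matI[OF tyler_map_carrier tyler_map_sym])
    fix u :: "real vec" assume u: "u \<in> carrier_vec p" "u \<noteq> 0\<^sub>v p"
    have "0 < m * ((1 - \<tau> / 8) * qf \<Sigma> u)" using m tau qf_pos[OF Sigma u] by simp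
    also have "\<dots> \<le> m * qf (F \<Sigma>) u" using sandwichedD(1)[OF near_fixed u(1)] m by simp
    also have "\<dots> \<le> qf (F S) u" by (rule sandwichedD(1)[OF F u(1)])
    finally show "qf (F S) u > 0" .
  qed
qed

text \<open>Comparability with \<open>\<Sigma>\<close> is required of the base point
  \<open>S\<close> only, while \<open>S'\<close> may be arbitrarily far away: the weights belong to
  \<open>S\<close>, and \<open>S'\<close> enters only through the ratios \<open>r i\<close>. This
  asymmetry is what makes a badly conditioned iterate harmless.\<close>

lemma tyler_map_contraction:
  assumes S: "pos_def_mat p S" and S': "pos_def_mat p S'" and e: "e \<ge> 0" and close: "proj_close p e S S'"
    and K: "K \<ge> 1" and l: "l > 0" and cond: "sandwiched p l (K * l) \<Sigma> S"
  shows "proj_close p ((1 - \<tau> / (2 * K * (1 + \<tau> / 8))) * e) (F S) (F S')"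
proof -
  obtain m where m: "m > 0" and s: "sandwiched p m (m * (1 + e)) S S'" using close by (auto simp: proj_close_def)
  define M where "M = m * (1 + e)"
  have M: "M > 0" using m e by (simp add: M_def)
  \<comment> \<open>\<open>c / n\<close> is the guaranteed share of a good sample in the total
    weight: \<open>\<tau>\<close> comes from \<open>spread\<close>, \<open>K\<close> from replacing
    \<open>S\<close> by \<open>\<Sigma>\<close>, and \<open>1 + \<tau> / 8\<close> from bounding the
    total weight through \<open>F \<Sigma>\<close>.\<close>
  define c where "c = \<tau> / (K * (1 + \<tau> / 8))"
  have c: "c > 0" using tau K by (simp add: c_def)
  define d d' g where "d = (\<lambda>i. qf (mat_inv S) (x i))" and "d' = (\<lambda>i. qf (mat_inv S') (x i))"
    and "g = (\<lambda>i. qf (mat_inv \<Sigma>) (x i))"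
  have pos: "d i > 0" "d' i > 0" "g i > 0" if "i < n" for i
    using qf_inv_pos[OF S x(1,2)] qf_inv_pos[OF S' x(1,2)] qf_inv_pos[OF Sigma x(1,2)] that
    by (auto simp: d_def d'_def g_def)
  define r where "r = (\<lambda>i. d i / d' i)"
  have r: "m \<le> r i" "r i \<le> M" if i: "i < n" for i
    using sandwiched_inv[OF s S S' m _ x(1)[OF i]] M pos[OF i]
    by (auto simp: r_def d_def d'_def M_def field_simps)
  have dg: "l * d i \<le> g i" "g i \<le> K * l * d i" if i: "i < n" for i
    using sandwiched_inv[OF cond Sigma S l _ x(1)[OF i]] K l by (auto simp: d_def g_def)
  define a where "a = (\<lambda>u i. (u \<bullet> x i)\<^sup>2 / d i)"
  define W where "W = (\<lambda>u. \<Sum>i<n. a u i)"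
  define \<rho> where "\<rho> = (\<lambda>u. (\<Sum>i<n. a u i * r i) / W u)"
  define bad where "bad = (\<lambda>u. {i. i < n \<and> real p * (u \<bullet> x i)\<^sup>2 < \<tau> * g i * qf \<Sigma> u})"
  have a0: "a u i \<ge> 0" if "i < n" for u i using pos[OF that] by (simp add: a_def)
  have FS: "qf (F S) u = real p / real n * W u" if "u \<in> carrier_vec p" for u
    unfolding qf_tyler_map[OF that] by (simp add: W_def a_def d_def)
  have FS': "qf (F S') u = real p / real n * (\<Sum>i<n. a u i * r i)" if "u \<in> carrier_vec p" for u
  proof -
    have "(u \<bullet> x i)\<^sup>2 / d' i = a u i * r i" if "i < n" for i
      using pos[OF that] by (simp add: a_def r_def)
    then show ?thesis unfolding qf_tyler_map[OF that] by (simp add: d'_def)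
  qed
  have bad: "real (card (bad u)) \<le> real n / 4" "finite (bad u)" "bad u \<subseteq> {..<n}" if "u \<in> carrier_vec p" for u
    using spread[OF that] by (auto simp: bad_def g_def)
  have weight: "c / real n * W u \<le> a u i" if u: "u \<in> carrier_vec p" and i: "i < n" "i \<notin> bad u" for u i
  proof -
    have "W u \<le> (\<Sum>i<n. K * l * ((u \<bullet> x i)\<^sup>2 / g i))"
      unfolding W_def
    proof (rule sum_mono)
      fix i assume i: "i \<in> {..<n}"
      then have "1 / d i \<le> K * l / g i" using dg[of i] pos[of i] by (simp add: field_simps)
      from mult_right_mono[OF this, of "(u \<bullet> x i)\<^sup>2"] show "a u i \<le> K * l * ((u \<bullet> x i)\<^sup>2 / g i)"
        by (simp add: a_def)
    qed
    also have "\<dots> = K * l * (real n / real p * qf (F \<Sigma>) u)"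
      unfolding qf_tyler_map[OF u] using p n by (simp add: g_def sum_distrib_left)
    also have "\<dots> \<le> K * l * (real n / real p * ((1 + \<tau> / 8) * qf \<Sigma> u))"
      using sandwichedD(2)[OF near_fixed u] K l by (intro mult_left_mono) auto
    finally have W: "W u \<le> K * l * (real n / real p * ((1 + \<tau> / 8) * qf \<Sigma> u))" .
    have "c / real n * W u \<le> c / real n * (K * l * (real n / real p * ((1 + \<tau> / 8) * qf \<Sigma> u)))"
      using c n by (intro mult_left_mono[OF W]) auto
    also have "\<dots> = l * (\<tau> * qf \<Sigma> u / real p)"
    proof -
      have "1 + \<tau> / 8 > 0" using tau by simp
      then show ?thesis using K n p by (simp add: c_def divide_simps)
    qed
    also have "\<dots> \<le> l * ((u \<bullet> x i)\<^sup>2 / g i)"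
      using i pos[OF i(1)] l p by (intro mult_left_mono) (auto simp: bad_def field_simps)
    also have "\<dots> \<le> a u i"
    proof -
      have "l / g i \<le> 1 / d i" using dg[of i] pos[of i] i by (simp add: field_simps)
      from mult_right_mono[OF this, of "(u \<bullet> x i)\<^sup>2"] show ?thesis by (simp add: a_def)
    qed
    finally show ?thesis .
  qed
  have Wpos: "W u > 0" if u: "u \<in> carrier_vec p" "u \<noteq> 0\<^sub>v p" for u
    using qf_pos[OF tyler_map_pos_def[OF S] u] FS[OF u(1)] p n
    by (simp add: zero_less_mult_iff zero_less_divide_iff)
  have average: "c / real n * (\<Sum>i\<in>G. z i) \<le> (\<Sum>i<n. a u i * z i) / W u"
    if u: "u \<in> carrier_vec p" "u \<noteq> 0\<^sub>v p" and G: "G \<subseteq> {..<n}" "G \<inter> bad u = {}" and z: "\<And>i. i < n \<Longrightarrow> z i \<ge> 0"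
    for u G and z :: "nat \<Rightarrow> real"
  proof -
    have "c / real n * (\<Sum>i\<in>G. z i) \<le> (\<Sum>i\<in>G. a u i * z i) / W u"
      unfolding sum_distrib_left sum_divide_distrib
    proof (rule sum_mono)
      fix i assume "i \<in> G"
      then have i: "i < n" "i \<notin> bad u" using G by auto
      have "c / real n \<le> a u i / W u" using weight[OF u(1) i] Wpos[OF u] by (simp add: field_simps)
      from mult_right_mono[OF this z[OF i(1)]] show "c / real n * z i \<le> a u i * z i / W u" by simp
    qed
    also have "\<dots> \<le> (\<Sum>i<n. a u i * z i) / W u"
      using Wpos[OF u] G a0 z by (intro divide_right_mono sum_mono2) (auto simp: mult_nonneg_nonneg)
    finally show ?thesis .
  qed
  \<comment> \<open>For each sample good for both directions, the shortfall of
    \<open>\<rho> u\<close> below \<open>M\<close> and the excess of \<open>\<rho> w\<close> over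
    \<open>m\<close> together gain \<open>c / n\<close> times \<open>M - m\<close>; at least
    \<open>n / 2\<close> samples are of this kind.\<close>
  have diff: "\<rho> u - \<rho> w \<le> (1 - c / 2) * (M - m)"
    if u: "u \<in> carrier_vec p" "u \<noteq> 0\<^sub>v p" and w: "w \<in> carrier_vec p" "w \<noteq> 0\<^sub>v p" for u w
  proof -
    define G where "G = {..<n} - (bad u \<union> bad w)"
    have G: "G \<subseteq> {..<n}" "finite G" by (auto simp: G_def)
    have "real n - real (card (bad u \<union> bad w)) \<le> real (card G)"
      using bad[OF u(1)] bad[OF w(1)] card_mono[of "{..<n}" "bad u \<union> bad w"]
      by (simp add: G_def card_Diff_subset of_nat_diff)
    moreover have "real (card (bad u \<union> bad w)) \<le> real n / 4 + real n / 4"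
      using bad[OF u(1)] bad[OF w(1)] card_Un_le[of "bad u" "bad w"] by linarith
    ultimately have cG: "real n / 2 \<le> real (card G)" by simp
    have up: "c / real n * (\<Sum>i\<in>G. M - r i) \<le> M - \<rho> u"
    proof -
      have "(\<Sum>i<n. a u i * (M - r i)) = M * W u - (\<Sum>i<n. a u i * r i)"
        by (simp add: W_def sum_subtractf sum_distrib_left algebra_simps)
      then show ?thesis using average[OF u G(1), of "\<lambda>i. M - r i"] r Wpos[OF u]
        by (auto simp: \<rho>_def G_def diff_divide_distrib)
    qed
    have lo: "c / real n * (\<Sum>i\<in>G. r i - m) \<le> \<rho> w - m"
    proof -
      have "(\<Sum>i<n. a w i * (r i - m)) = (\<Sum>i<n. a w i * r i) - m * W w"
        by (simp add: W_def sum_subtractf sum_distrib_left algebra_simps)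
      then show ?thesis using average[OF w G(1), of "\<lambda>i. r i - m"] r Wpos[OF w]
        by (auto simp: \<rho>_def G_def diff_divide_distrib)
    qed
    have "(\<Sum>i\<in>G. M - r i) + (\<Sum>i\<in>G. r i - m) = real (card G) * (M - m)"
      by (simp add: sum.distrib[symmetric])
    then have "c / real n * (\<Sum>i\<in>G. M - r i) + c / real n * (\<Sum>i\<in>G. r i - m) = c / real n * (real (card G) * (M - m))"
      by (metis distrib_left)
    moreover have "c / real n * (real n / 2 * (M - m)) \<le> c / real n * (real (card G) * (M - m))"
      using cG c m e by (intro mult_left_mono mult_right_mono) (auto simp: M_def algebra_simps)
    moreover have "c / real n * (real n / 2 * (M - m)) = c / 2 * (M - m)" using n by simp
    ultimately have "c / 2 * (M - m) \<le> (M - \<rho> u) + (\<rho> w - m)" using up lo by linarith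
    then show ?thesis by (simp add: algebra_simps)
  qed
  have rho_ge: "m \<le> \<rho> u" if u: "u \<in> carrier_vec p" "u \<noteq> 0\<^sub>v p" for u
  proof -
    have "m * W u \<le> (\<Sum>i<n. a u i * r i)"
      unfolding W_def sum_distrib_left using r a0 by (intro sum_mono) (auto simp: mult.commute intro!: mult_right_mono)
    then show ?thesis using Wpos[OF u] by (simp add: \<rho>_def field_simps)
  qed
  define X where "X = {u :: real vec. u \<in> carrier_vec p \<and> u \<noteq> 0\<^sub>v p}"
  \<comment> \<open>The best lower constant. The upper one is read off from \<open>diff\<close>,
    whose right-hand side does not depend on the directions.\<close>
  define m' where "m' = (INF u\<in>X. \<rho> u)"
  have "unit_vec p 0 \<noteq> (0\<^sub>v p :: real vec)" using p by (intro unit_vec_nonzero) auto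
  then have X: "X \<noteq> {}" by (auto simp: X_def intro!: exI[of _ "unit_vec p 0"])
  have bdd: "bdd_below (\<rho> ` X)" using rho_ge by (intro bdd_belowI2[of _ m]) (auto simp: X_def)
  have m': "m \<le> m'" unfolding m'_def using X rho_ge by (intro cINF_greatest) (auto simp: X_def)
  have m'_le: "m' \<le> \<rho> u" if "u \<in> X" for u unfolding m'_def by (rule cINF_lower[OF bdd that])
  have rho_le: "\<rho> u \<le> m' + (1 - c / 2) * (M - m)" if u: "u \<in> X" for u
  proof -
    have "\<rho> u - (1 - c / 2) * (M - m) \<le> m'" unfolding m'_def
      using diff u X by (intro cINF_greatest) (auto simp: X_def algebra_simps)
    then show ?thesis by simp
  qed
  have q: "0 \<le> 1 - c / 2"
  proof -
    have "1 \<le> K * (1 + \<tau> / 8)" using K tau mult_mono[of 1 K 1 "1 + \<tau> / 8"] by simp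
    then have "c \<le> \<tau>" using tau mult_left_mono[of 1 "K * (1 + \<tau> / 8)" \<tau>]
      by (simp add: c_def divide_le_eq)
    then show ?thesis using tau by simp
  qed
  \<comment> \<open>The width shrinks by \<open>1 - c / 2\<close> and is now compared with
    \<open>m'\<close>, which is no smaller than \<open>m\<close>; so the relative gap shrinks at
    least by the same factor.\<close>
  have "(1 - c / 2) * (M - m) = (1 - c / 2) * e * m" by (simp add: M_def algebra_simps)
  also have "\<dots> \<le> (1 - c / 2) * e * m'" using m' q e by (intro mult_left_mono) auto
  finally have width: "m' + (1 - c / 2) * (M - m) \<le> m' * (1 + (1 - c / 2) * e)" by (simp add: algebra_simps)
  have "sandwiched p m' (m' * (1 + (1 - c / 2) * e)) (F S) (F S')"
    unfolding sandwiched_def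
  proof (intro ballI conjI)
    fix u :: "real vec" assume u: "u \<in> carrier_vec p"
    have "m' * qf (F S) u \<le> qf (F S') u \<and> qf (F S') u \<le> m' * (1 + (1 - c / 2) * e) * qf (F S) u"
    proof (cases "u = 0\<^sub>v p")
      case True
      then show ?thesis using qf_zero[OF tyler_map_carrier] by simp
    next
      case False
      then have uX: "u \<in> X" using u by (simp add: X_def)
      have eq: "qf (F S') u = \<rho> u * qf (F S) u"
        using Wpos[OF u False] unfolding FS[OF u] FS'[OF u] by (simp add: \<rho>_def)
      have q0: "qf (F S) u \<ge> 0" using qf_nonneg[OF tyler_map_pos_def[OF S] u] .
      show ?thesis unfolding eq using m'_le[OF uX] rho_le[OF uX] width q0
        by (auto intro!: mult_right_mono)
    qed
    then show "m' * qf (F S) u \<le> qf (F S') u" "qf (F S') u \<le> m' * (1 + (1 - c / 2) * e) * qf (F S) u" by auto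
  qed
  then have "proj_close p ((1 - c / 2) * e) (F S) (F S')"
    unfolding proj_close_def using m m' by (intro exI[of _ m']) auto
  then show ?thesis by (simp add: c_def mult.assoc mult.left_commute)
qed

section \<open>The invariant region and the fixed point\<close>

lemma proj_close_reference_invariant:
  assumes S: "pos_def_mat p S" and close: "proj_close p 3 \<Sigma> S"
  shows "proj_close p 3 \<Sigma> (F S)"
proof -
  define q where "q = 1 - \<tau> / (2 * (1 + \<tau> / 8))"
  have "sandwiched p 1 (1 * 1) \<Sigma> \<Sigma>" by (simp add: sandwiched_def)
  from tyler_map_contraction[OF Sigma S _ close _ _ this]
  have "proj_close p (q * 3) (F \<Sigma>) (F S)" by (simp add: q_def)
  then obtain m where m: "m > 0" and s: "sandwiched p m (m * (1 + q * 3)) (F \<Sigma>) (F S)" by (auto simp: proj_close_def)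
  have t: "1 + \<tau> / 8 > 0" "1 - \<tau> / 8 > 0" using tau by auto
  have q: "q \<ge> 0" using tau by (simp add: q_def field_simps)
  \<comment> \<open>Passing from \<open>F \<Sigma>\<close> back to \<open>\<Sigma>\<close> costs
    \<open>4 * \<tau> / 8\<close> at either end, in total \<open>\<tau>\<close>, while the
    contraction with \<open>K = 1\<close> gains \<open>3 * \<tau> / 2\<close>. This balance governs
    the tolerance in \<open>near_fixed\<close>.\<close>
  have "(1 + q * 3) * (1 + \<tau> / 8) = 4 * (1 + \<tau> / 8) - 3 * \<tau> / 2"
    using t by (simp add: q_def field_simps)
  also have "\<dots> \<le> 4 * (1 - \<tau> / 8)" using tau by simp
  finally have le: "(1 + q * 3) * (1 + \<tau> / 8) \<le> 4 * (1 - \<tau> / 8)" .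
  have "sandwiched p (m * (1 - \<tau> / 8)) (m * (1 + q * 3) * (1 + \<tau> / 8)) \<Sigma> (F S)"
    by (rule sandwiched_trans[OF near_fixed s]) (use m q in auto)
  then have "sandwiched p (m * (1 - \<tau> / 8)) (m * (1 - \<tau> / 8) * (1 + 3)) \<Sigma> (F S)"
    by (rule sandwiched_mono[OF _ order_refl _ Sigma]) (use le m in \<open>simp add: mult.assoc mult.commute\<close>)
  then show ?thesis unfolding proj_close_def using m t by (intro exI[of _ "m * (1 - \<tau> / 8)"]) auto
qed

text \<open>The factor \<open>1 - \<tau> / 12\<close> dominates the contraction factors for all condition numbers up to 5.\<close>

lemma tyler_map_contraction':
  assumes S: "pos_def_mat p S" and S': "pos_def_mat p S'" and e: "e \<ge> 0" and close: "proj_close p e S S'"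
    and cond: "proj_close p 4 \<Sigma> S"
  shows "proj_close p ((1 - \<tau> / 12) * e) (F S) (F S')"
proof -
  obtain l where l: "l > 0" "sandwiched p l (5 * l) \<Sigma> S" using cond by (auto simp: proj_close_def mult.commute)
  have "proj_close p ((1 - \<tau> / (2 * 5 * (1 + \<tau> / 8))) * e) (F S) (F S')"
    by (rule tyler_map_contraction[OF S S' e close _ l]) simp
  moreover have "1 - \<tau> / (2 * 5 * (1 + \<tau> / 8)) \<le> 1 - \<tau> / 12" using tau by (simp add: field_simps)
  ultimately show ?thesis
    by (rule proj_close_weaken[OF _ mult_right_mono[OF _ e] tyler_map_pos_def[OF S]])
qed

text \<open>The trace identity gives \<open>m \<le> 1 \<le> m * (1 + e)\<close>, so projective
  closeness of consecutive iterates is already two-sided closeness and the orbit needs no rescaling.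
  In exponential form such bounds compose by addition.\<close>

lemma proj_close_tyler_map_exp:
  assumes S: "pos_def_mat p S" and e: "e \<ge> 0" and close: "proj_close p e S (F S)"
  shows "sandwiched p (exp (- e)) (exp e) S (F S)"
proof -
  obtain m where m: "m > 0" "sandwiched p m (m * (1 + e)) S (F S)" using close by (auto simp: proj_close_def)
  note b = sandwiched_tyler_map_self[OF S m(2)]
  have "exp (- e) \<le> 1 / (1 + e)" using e exp_ge_add_one_self[of e] by (simp add: exp_minus field_simps)
  also have "\<dots> \<le> m" using b(2) e by (simp add: field_simps)
  finally have 1: "exp (- e) \<le> m" .
  have "m * (1 + e) \<le> 1 * (1 + e)" using b(1) e by (intro mult_right_mono) auto
  also have "\<dots> \<le> exp e" by simp
  finally show ?thesis by (intro sandwiched_mono[OF m(2) 1 _ S])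
qed

text \<open>The orbit of \<open>\<Sigma>\<close> stays in the invariant region, so the logarithmic
  sizes of its steps are summable. Convergence is read off from monotone sequences of quadratic
  forms, and the fixed point equation from monotonicity of \<open>F\<close>.\<close>

lemma tyler_fixed_point_exists:
  "\<exists>S. pos_def_mat p S \<and> F S = S \<and> proj_close p 4 \<Sigma> S"
proof -
  define q where "q = 1 - \<tau> / 12"
  have q: "0 \<le> q" "q < 1" using tau by (auto simp: q_def)
  define A where "A = (\<lambda>t. (F ^^ t) \<Sigma>)"
  have A_Suc: "A (Suc t) = F (A t)" for t by (simp add: A_def)
  have Apd: "pos_def_mat p (A t)" for t
    by (induction t) (use Sigma tyler_map_pos_def in \<open>auto simp: A_def\<close>)
  have Acond: "proj_close p 3 \<Sigma> (A t)" for t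
  proof (induction t)
    case 0
    have "sandwiched p 1 (1 * (1 + 3)) \<Sigma> \<Sigma>" using qf_nonneg[OF Sigma] by (auto simp: sandwiched_def)
    then show ?case by (auto simp: A_def proj_close_def intro!: exI[of _ 1])
  qed (use Apd proj_close_reference_invariant A_Suc in auto)
  have Acond4: "proj_close p 4 \<Sigma> (A t)" for t by (rule proj_close_weaken[OF Acond _ Sigma]) simp
  have Astep: "proj_close p (q ^ t * 3) (A t) (A (Suc t))" for t
  proof (induction t)
    case 0
    then show ?case using Acond[of 1] by (simp add: A_def)
  next
    case (Suc t)
    from tyler_map_contraction'[OF Apd Apd _ this Acond4] q
    show ?case by (simp add: A_Suc q_def[symmetric] mult.assoc)
  qed
  have step: "sandwiched p (exp (- (q ^ t * 3))) (exp (q ^ t * 3)) (A t) (A (Suc t))" for t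
    unfolding A_Suc by (rule proj_close_tyler_map_exp[OF Apd]) (use q Astep[of t] A_Suc in auto)
  \<comment> \<open>The tail from \<open>t\<close> on of the geometric series of step sizes; it
    bounds the distance of \<open>A t\<close> from the limit.\<close>
  define \<delta> where "\<delta> = (\<lambda>t. 3 * q ^ t / (1 - q))"
  have delta0: "\<delta> t \<ge> 0" for t using q by (simp add: \<delta>_def)
  have delta_lim: "\<delta> \<longlonglongrightarrow> 0"
  proof -
    have "(\<lambda>t. 3 * q ^ t / (1 - q)) \<longlonglongrightarrow> 3 * 0 / (1 - q)" using q by (intro tendsto_intros LIMSEQ_power_zero) auto
    then show ?thesis by (simp add: \<delta>_def[abs_def])
  qed
  have geom: "\<delta> t = q ^ t * 3 + \<delta> (Suc t)" for t
  proof -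
    have "\<delta> t - \<delta> (Suc t) = 3 * q ^ t * (1 - q) / (1 - q)"
      by (simp add: \<delta>_def diff_divide_distrib[symmetric] algebra_simps)
    then show ?thesis using q by simp
  qed
  \<comment> \<open>The factors \<open>exp (\<delta> t)\<close> and
    \<open>exp (- \<delta> t)\<close> compensate all remaining steps in advance, hence the
    monotonicity.\<close>
  have dec: "decseq (\<lambda>t. exp (\<delta> t) * qf (A t) u)" and inc: "incseq (\<lambda>t. exp (- \<delta> t) * qf (A t) u)"
    if u: "u \<in> carrier_vec p" for u
  proof -
    have e: "exp (\<delta> t) = exp (\<delta> (Suc t)) * exp (q ^ t * 3)" "exp (- \<delta> t) = exp (- \<delta> (Suc t)) * exp (- (q ^ t * 3))" for t
      unfolding exp_add[symmetric] by (simp_all add: geom[of t])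
    have "exp (\<delta> (Suc t)) * qf (A (Suc t)) u \<le> exp (\<delta> t) * qf (A t) u"
      "exp (- \<delta> t) * qf (A t) u \<le> exp (- \<delta> (Suc t)) * qf (A (Suc t)) u" for t
      unfolding e[of t] mult.assoc by (intro mult_left_mono sandwichedD[OF step u], simp)+
    then show "decseq (\<lambda>t. exp (\<delta> t) * qf (A t) u)" "incseq (\<lambda>t. exp (- \<delta> t) * qf (A t) u)"
      by (auto intro: decseq_SucI incseq_SucI)
  qed
  have conv: "convergent (\<lambda>t. qf (A t) u)" if u: "u \<in> carrier_vec p" for u
  proof -
    have "0 \<le> exp (\<delta> t) * qf (A t) u" for t using qf_nonneg[OF Apd u] by simp
    then obtain L where "(\<lambda>t. exp (\<delta> t) * qf (A t) u) \<longlonglongrightarrow> L"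
      using decseq_convergent[OF dec[OF u]] by blast
    then have "(\<lambda>t. exp (- \<delta> t) * (exp (\<delta> t) * qf (A t) u)) \<longlonglongrightarrow> exp (- 0) * L"
      by (intro tendsto_intros delta_lim)
    then show ?thesis by (auto simp: convergent_def mult.assoc[symmetric] exp_add[symmetric])
  qed
  \<comment> \<open>Polarization carries convergence over from the forms to the entries, from which
    the limit matrix is built.\<close>
  have entry: "A t $$ (i, j) = (qf (A t) (unit_vec p i + unit_vec p j) - qf (A t) (unit_vec p i) - qf (A t) (unit_vec p j)) / 2"
    if "i < p" "j < p" for i j t
    using qf_add[OF pos_def_matD(1,2)[OF Apd[of t]], of "unit_vec p i" "unit_vec p j"]
      mat_entry_bilinear[OF pos_def_matD(1)[OF Apd[of t]] that] by simp
  have "convergent (\<lambda>t. A t $$ (i, j))" if "i < p" "j < p" for i j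
    unfolding entry[OF that]
    by (intro convergent_diff conv bounded_linear.convergent[OF bounded_linear_divide]) auto
  then have lim: "(\<lambda>t. A t $$ (i, j)) \<longlonglongrightarrow> lim (\<lambda>t. A t $$ (i, j))" if "i < p" "j < p" for i j
    using that by (simp add: convergent_LIMSEQ_iff)
  define B where "B = mat p p (\<lambda>(i, j). lim (\<lambda>t. A t $$ (i, j)))"
  have B: "B \<in> carrier_mat p p" by (simp add: B_def)
  have qsum: "qf M u = (\<Sum>i<p. \<Sum>j<p. u $ i * (M $$ (i, j) * u $ j))"
    if "M \<in> carrier_mat p p" "u \<in> carrier_vec p" for M u
    using that by (simp add: qf_def scalar_prod_def lessThan_atLeast0 sum_distrib_left)
  have qlim: "(\<lambda>t. qf (A t) u) \<longlonglongrightarrow> qf B u" if u: "u \<in> carrier_vec p" for u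
    unfolding qsum[OF pos_def_matD(1)[OF Apd] u] qsum[OF B u]
    by (intro tendsto_intros) (use lim in \<open>auto simp: B_def\<close>)
  have lims: "sandwiched p (exp (- \<delta> t)) (exp (\<delta> t)) (A t) B" for t
    unfolding sandwiched_def
  proof (intro ballI conjI)
    fix u :: "real vec" assume u: "u \<in> carrier_vec p"
    have "(\<lambda>t. exp (- \<delta> t) * qf (A t) u) \<longlonglongrightarrow> exp (- 0) * qf B u"
      "(\<lambda>t. exp (\<delta> t) * qf (A t) u) \<longlonglongrightarrow> exp 0 * qf B u"
      by (intro tendsto_intros delta_lim qlim[OF u])+
    then show "exp (- \<delta> t) * qf (A t) u \<le> qf B u" "qf B u \<le> exp (\<delta> t) * qf (A t) u"
      using incseq_le[OF inc[OF u]] decseq_ge[OF dec[OF u]] by auto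
  qed
  have Bsym: "B\<^sup>T = B"
  proof (rule eq_matI)
    fix i j assume "i < dim_row B" "j < dim_col B"
    then have ij: "i < p" "j < p" using B by auto
    have "A t $$ (j, i) = A t $$ (i, j)" for t
      using pos_def_matD[OF Apd[of t]] ij by (metis index_transpose_mat(1))
    then show "B\<^sup>T $$ (i, j) = B $$ (i, j)" using ij by (simp add: B_def)
  qed (use B in auto)
  have Bpd: "pos_def_mat p B"
  proof (rule pos_def_matI[OF B Bsym])
    fix u :: "real vec" assume u: "u \<in> carrier_vec p" "u \<noteq> 0\<^sub>v p"
    have "0 < exp (- \<delta> 0) * qf (A 0) u" using qf_pos[OF Apd u] by simp
    also have "\<dots> \<le> qf B u" by (rule sandwichedD(1)[OF lims u(1)])
    finally show "qf B u > 0" .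
  qed
  \<comment> \<open>\<open>A (Suc t)\<close> is within \<open>\<delta> t\<close> of
    \<open>F B\<close>, since \<open>F\<close> preserves sandwiches, and within
    \<open>\<delta> (Suc t)\<close> of \<open>B\<close>; both bounds tend to 0.\<close>
  have fixB: "F B = B"
  proof (rule mat_eq_if_sandwiched[OF Bpd tyler_map_pos_def[OF Bpd]])
    show "(\<lambda>t. \<delta> t + \<delta> (Suc t)) \<longlonglongrightarrow> 0" using tendsto_add[OF delta_lim LIMSEQ_Suc[OF delta_lim]] by simp
    fix t
    have "sandwiched p (exp (- \<delta> t)) (exp (\<delta> t)) (A (Suc t)) (F B)"
      unfolding A_Suc by (rule tyler_map_sandwiched[OF Apd Bpd _ lims]) simp
    from sandwiched_trans[OF sandwiched_sym[OF lims[of "Suc t"]] this]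
    show "sandwiched p (exp (- (\<delta> t + \<delta> (Suc t)))) (exp (\<delta> t + \<delta> (Suc t))) B (F B)"
      by (simp add: exp_minus exp_add exp_diff field_simps)
  qed
  have "\<forall>\<^sub>F t in sequentially. \<delta> t < ln (5 / 4) / 2" using delta_lim by (intro order_tendstoD(2)) auto
  then obtain t where t: "\<delta> t < ln (5 / 4) / 2" by (auto simp: eventually_sequentially)
  obtain m where m: "m > 0" "sandwiched p m (m * (1 + 3)) \<Sigma> (A t)" using Acond[of t] by (auto simp: proj_close_def)
  have sB: "sandwiched p (exp (- \<delta> t) * m) (exp (\<delta> t) * (m * (1 + 3))) \<Sigma> B"
    by (rule sandwiched_trans[OF m(2) lims]) auto
  \<comment> \<open>Going from \<open>A t\<close> to \<open>B\<close> loses a factor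
    \<open>exp (2 * \<delta> t)\<close> in the condition number. The choice of \<open>t\<close>
    keeps this factor below \<open>5 / 4\<close>, so 4 becomes at most 5: the origin of
    \<open>proj_close p 4\<close> beside \<open>proj_close p 3\<close>.\<close>
  have le: "exp (\<delta> t) * (m * (1 + 3)) \<le> exp (- \<delta> t) * m * (1 + 4)"
  proof -
    have "2 * \<delta> t \<le> ln (5 / 4)" using t by linarith
    then have "exp (2 * \<delta> t) \<le> exp (ln (5 / 4))" by (simp only: exp_le_cancel_iff)
    also have "\<dots> = 5 / 4" by (rule exp_ln) simp
    finally have "exp (\<delta> t) * exp (\<delta> t) \<le> 5 / 4" unfolding exp_add[symmetric] mult_2[symmetric] .
    then have "exp (\<delta> t) * 4 \<le> exp (- \<delta> t) * 5" by (simp add: exp_minus field_simps)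
    then show ?thesis using m by (simp add: algebra_simps)
  qed
  have "sandwiched p (exp (- \<delta> t) * m) (exp (- \<delta> t) * m * (1 + 4)) \<Sigma> B"
    by (rule sandwiched_mono[OF sB order_refl le Sigma])
  then have "proj_close p 4 \<Sigma> B" unfolding proj_close_def using m by (intro exI[of _ "exp (- \<delta> t) * m"]) simp
  then show ?thesis using Bpd fixB by blast
qed

text \<open>Equal traces exclude both \<open>m > 1\<close> and \<open>m * (1 + e) < 1\<close>. A
  common normalization thus does for two matrices what the trace identity does for \<open>S\<close>
  and \<open>F S\<close>.\<close>

lemma proj_close_same_trace:
  assumes S: "pos_def_mat p S" and S': "pos_def_mat p S'" and e: "e \<ge> 0" and close: "proj_close p e S S'"
    and tr: "mat_trace S = mat_trace S'"
  shows "sandwiched p (1 / (1 + e)) (1 + e) S S'"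
proof -
  obtain m where m: "m > 0" and s: "sandwiched p m (m * (1 + e)) S S'" using close by (auto simp: proj_close_def)
  note c = pos_def_matD(1)[OF S] pos_def_matD(1)[OF S'] and tp = mat_trace_pos[OF S p]
  have "m * mat_trace S \<le> mat_trace S'" by (rule mat_trace_mono[OF c]) (rule sandwichedD(1)[OF s])
  then have 1: "m \<le> 1" using tr tp by simp
  have "1 / (m * (1 + e)) * mat_trace S' \<le> mat_trace S"
    by (rule mat_trace_mono[OF c(2,1)]) (use sandwichedD(2)[OF s] m e in \<open>simp add: pos_divide_le_eq mult.commute\<close>)
  then have "1 / (m * (1 + e)) * mat_trace S \<le> 1 * mat_trace S" using tr by simp
  then have "1 / (m * (1 + e)) \<le> 1" by (rule mult_right_le_imp_le[OF _ tp])
  then have 2: "1 \<le> m * (1 + e)" using m e by (simp add: pos_divide_le_eq del: divide_le_eq_1)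
  show ?thesis
    by (rule sandwiched_mono[OF s _ _ S])
      (use 1 2 m e mult_right_mono[OF 1, of "1 + e"] in \<open>auto simp: field_simps\<close>)
qed

theorem tyler_estimator_exists:
  "\<exists>S. is_tyler_estimator p n x S \<and> pos_def_mat p S \<and> F S = S \<and> mat_trace S = real p \<and> proj_close p 4 \<Sigma> S"
proof -
  obtain B where B: "pos_def_mat p B" "F B = B" "proj_close p 4 \<Sigma> B" using tyler_fixed_point_exists by blast
  define c where "c = real p / mat_trace B"
  have c: "c > 0" using mat_trace_pos[OF B(1) p] p by (simp add: c_def)
  define S where "S = c \<cdot>\<^sub>m B"
  have S: "pos_def_mat p S" unfolding S_def by (rule pos_def_smult[OF B(1) c])
  have FS: "F S = S" unfolding S_def tyler_map_smult[OF B(1) c] B(2) ..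
  have tr: "mat_trace S = real p" using mat_trace_pos[OF B(1) p]
    by (simp add: S_def mat_trace_smult[OF pos_def_matD(1)[OF B(1)]] c_def)
  have close: "proj_close p 4 \<Sigma> S" unfolding S_def by (rule proj_close_smult[OF B(3) c B(1)])
  define q where "q = 1 - \<tau> / 12"
  have q: "0 \<le> q" "q < 1" using tau by (auto simp: q_def)
  \<comment> \<open>Both matrices are fixed by \<open>F\<close>, so each contraction step improves a
    bound \<open>e\<close> on their distance to \<open>q * e\<close>; all that is needed at the
    start is that some finite bound exists.\<close>
  have unique: "S' = S" if "tyler_solution p n x S'" for S'
  proof -
    have S': "pos_def_mat p S'" "F S' = S'" "mat_trace S' = real p" using that by (auto simp: tyler_solution_def)
    obtain e where e: "e \<ge> 0" "proj_close p e S S'" using pos_def_proj_close[OF S S'(1) p] by blast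
    have et: "proj_close p (q ^ t * e) S S'" for t
    proof (induction t)
      case (Suc t)
      from tyler_map_contraction'[OF S S'(1) _ this close] q e
      show ?case by (simp add: FS S' q_def[symmetric] mult.assoc)
    qed (use e in auto)
    show ?thesis
    proof (rule mat_eq_if_sandwiched[OF S S'(1)])
      have "(\<lambda>t. q ^ t * e) \<longlonglongrightarrow> 0 * e" using q by (intro tendsto_intros LIMSEQ_power_zero) auto
      then show "(\<lambda>t. q ^ t * e) \<longlonglongrightarrow> 0" by simp
      fix t
      have pos: "0 \<le> q ^ t * e" using q e by simp
      have "sandwiched p (1 / (1 + q ^ t * e)) (1 + q ^ t * e) S S'"
        by (rule proj_close_same_trace[OF S S'(1) pos et]) (use tr S' in auto)
      then show "sandwiched p (exp (- (q ^ t * e))) (exp (q ^ t * e)) S S'"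
        by (rule sandwiched_mono[OF _ _ _ S])
          (use pos exp_ge_add_one_self[of "q ^ t * e"] in \<open>auto simp: exp_minus field_simps\<close>)
    qed
  qed
  have "tyler_solution p n x S" using S FS tr by (simp add: tyler_solution_def)
  then have "is_tyler_estimator p n x S" using unique unfolding is_tyler_estimator_def by blast
  then show ?thesis using S FS tr close by blast
qed

section \<open>Rate of convergence from the identity matrix\<close>

text \<open>The contraction is anchored at the fixed point, which is well conditioned relative to
  \<open>\<Sigma>\<close>; the iterates may lie far outside the invariant region.\<close>

lemma tyler_iterate_proj_close:
  assumes S: "pos_def_mat p S" "F S = S" "proj_close p 4 \<Sigma> S" and e: "e \<ge> 0" "proj_close p e S (1\<^sub>m p)"
  shows "pos_def_mat p (tyler_iterate p n x t) \<and> proj_close p ((1 - \<tau> / 12) ^ t * e) S (tyler_iterate p n x t)"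
proof (induction t)
  case 0
  then show ?case using e pos_def_one by simp
next
  case (Suc t)
  have "0 \<le> (1 - \<tau> / 12) ^ t * e" using tau e by simp
  then show ?case using tyler_map_contraction'[OF S(1) _ _ _ S(3), of "tyler_iterate p n x t"] Suc S(2)
    by (simp add: tyler_map_pos_def mult.assoc)
qed

text \<open>The substitution \<open>y = mat_sqrt p S *\<^sub>v w\<close> turns the form of the
  conjugated inverse into \<open>qf (mat_inv S') y\<close> and \<open>w \<bullet> w\<close> into
  \<open>qf (mat_inv S) y\<close>, which the sandwich compares.\<close>

lemma frobenius_norm_error_le:
  assumes S: "pos_def_mat p S" and S': "pos_def_mat p S'" and e: "e \<ge> 0"
    and s: "sandwiched p (1 / (1 + e)) (1 + e) S S'"
  shows "frobenius_norm (1\<^sub>m p - mat_sqrt p S * mat_inv S' * mat_sqrt p S) \<le> real p * e"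
proof -
  define R where "R = mat_sqrt p S"
  define B where "B = R * mat_inv S' * R"
  note Rp = mat_sqrt_props[OF S, folded R_def]
  note R = pos_def_matD(1,2)[OF Rp(1)] and I' = mat_inv_pos_def[OF S'] and I = mat_inv_pos_def[OF S]
  have B: "B \<in> carrier_mat p p" using R I' by (simp add: B_def)
  have RI: "R * mat_inv S' \<in> carrier_mat p p" using R I' by simp
  have "B\<^sup>T = R * (mat_inv S' * R)"
    unfolding B_def transpose_mult[OF RI R(1)] transpose_mult[OF R(1) I'(1)] R(2) I'(4) by simp
  then have Bt: "B\<^sup>T = B" using assoc_mult_mat[OF R(1) I'(1) R(1)] by (simp add: B_def)
  have one: "transpose_mat (1\<^sub>m p - B) = 1\<^sub>m p - B" using transpose_minus[OF one_carrier_mat B] Bt by simp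
  have "frobenius_norm (1\<^sub>m p - B) \<le> real p * e"
  proof (rule frobenius_norm_le[OF _ one _ e])
    fix w :: "real vec" assume w: "w \<in> carrier_vec p"
    define y where "y = R *\<^sub>v w"
    have y: "y \<in> carrier_vec p" using R w by (simp add: y_def)
    have z: "mat_inv S' *\<^sub>v y \<in> carrier_vec p" using I' y by simp
    have "B *\<^sub>v w = R *\<^sub>v (mat_inv S' *\<^sub>v y)"
      unfolding B_def y_def using assoc_mult_mat_vec[OF RI R(1) w] assoc_mult_mat_vec[OF R(1) I'(1) y[unfolded y_def]] by simp
    then have qB: "qf B w = qf (mat_inv S') y"
      using bilinear_form_sym[OF R w z] comm_scalar_prod[OF z y] by (simp add: qf_def y_def)
    have qS: "qf (mat_inv S) y = w \<bullet> w" using qf_sqrt(2)[OF S w] by (simp add: y_def R_def)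
    have pos: "1 / (1 + e) > 0" "1 + e > 0" using e by auto
    note b = sandwiched_inv[OF s S S' pos y, unfolded qS]
    have w0: "w \<bullet> w \<ge> 0" by (rule scalar_prod_self_nonneg)
    have q0: "qf (mat_inv S') y \<ge> 0" using qf_nonneg[OF pos_def_inv[OF S'] y] .
    have up: "qf (mat_inv S') y \<le> (1 + e) * (w \<bullet> w)" using b(1) pos by (simp add: field_simps)
    have "(1 - e) * (w \<bullet> w) \<le> qf (mat_inv S') y"
    proof (cases "e \<le> 1")
      case True
      have "(1 - e) * (w \<bullet> w) \<le> (1 - e) * ((1 + e) * qf (mat_inv S') y)"
        using b(2) True by (intro mult_left_mono) auto
      also have "\<dots> = (1 - e * e) * qf (mat_inv S') y" by (simp add: algebra_simps)
      also have "\<dots> \<le> 1 * qf (mat_inv S') y" using q0 e by (intro mult_right_mono) auto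
      finally show ?thesis by simp
    next
      case False
      then have "(1 - e) * (w \<bullet> w) \<le> 0" using w0 by (simp add: mult_nonpos_nonneg)
      then show ?thesis using q0 by simp
    qed
    then show "\<bar>qf (1\<^sub>m p - B) w\<bar> \<le> e * (w \<bullet> w)"
      using up unfolding qf_diff_mat[OF one_carrier_mat B w] qf_one[OF w] qB
      by (simp add: abs_le_iff algebra_simps)
  qed (use B in auto)
  then show ?thesis by (simp add: B_def R_def)
qed

theorem tyler_iteration_converges:
  assumes tr: "mat_trace \<Sigma> = real p"
  shows "\<exists>S. is_tyler_estimator p n x S \<and>
    (\<forall>\<epsilon>::real. 0 < \<epsilon> \<and> \<epsilon> < 1 \<longrightarrow>
      (\<exists>T::nat. real T \<le> 73 / \<tau> * (\<bar>ln (det \<Sigma>)\<bar> + real p + ln (1 / \<epsilon>)) \<and>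
        frobenius_norm (1\<^sub>m p - mat_sqrt p S * mat_inv (tyler_output p n x T) * mat_sqrt p S) \<le> \<epsilon>))"
proof -
  obtain S where est: "is_tyler_estimator p n x S" and S: "pos_def_mat p S" "F S = S"
    and trS: "mat_trace S = real p" and close: "proj_close p 4 \<Sigma> S"
    using tyler_estimator_exists by blast
  obtain l where l: "l > 0" and sl: "sandwiched p l (l * (1 + 4)) \<Sigma> S" using close by (auto simp: proj_close_def)
  note bd = qf_bounds_trace_det[OF Sigma tr]
  have d: "det \<Sigma> > 0" using bd(2)[of "0\<^sub>v p"] by simp
  \<comment> \<open>The ratio of the sandwich constants of the identity relative to
    \<open>S\<close>: 5 from \<open>S\<close> against \<open>\<Sigma>\<close>, and \<open>p\<close>
    and \<open>det \<Sigma> / e\<close> from the upper and lower eigenvalue bounds for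
    \<open>\<Sigma>\<close>.\<close>
  define e0 where "e0 = 5 * real p * exp 1 / det \<Sigma>"
  have e0: "e0 > 0" using d p by (simp add: e0_def)
  have "sandwiched p (det \<Sigma> * exp (-1)) (real p) (1\<^sub>m p) \<Sigma>"
    using bd by (auto simp: sandwiched_def qf_one)
  from sandwiched_sym[OF sandwiched_trans[OF this sl]] l d p
  have s1: "sandwiched p (1 / (l * (1 + 4) * real p)) (1 / (l * (det \<Sigma> * exp (-1)))) S (1\<^sub>m p)" by simp
  have "1 / (l * (det \<Sigma> * exp (-1))) = 1 / (l * (1 + 4) * real p) * e0"
    using l d p by (simp add: e0_def exp_minus field_simps)
  also have "\<dots> \<le> 1 / (l * (1 + 4) * real p) * (1 + e0)" using l p by (intro mult_left_mono) auto
  finally have "sandwiched p (1 / (l * (1 + 4) * real p)) (1 / (l * (1 + 4) * real p) * (1 + e0)) S (1\<^sub>m p)"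
    by (rule sandwiched_mono[OF s1 order_refl _ S(1)])
  then have c0: "proj_close p e0 S (1\<^sub>m p)" unfolding proj_close_def
    using l p by (intro exI[of _ "1 / (l * (1 + 4) * real p)"]) auto
  have err: "frobenius_norm (1\<^sub>m p - mat_sqrt p S * mat_inv (tyler_output p n x T) * mat_sqrt p S) \<le>
      real p * ((1 - \<tau> / 12) ^ T * e0)" for T
  proof -
    define A where "A = tyler_iterate p n x T"
    define e where "e = (1 - \<tau> / 12) ^ T * e0"
    have e: "e \<ge> 0" using tau e0 by (simp add: e_def)
    have A: "pos_def_mat p A" "proj_close p e S A"
      using tyler_iterate_proj_close[OF S close _ c0] e0 by (auto simp: A_def e_def)
    define c where "c = real p / mat_trace A"
    have c: "c > 0" using mat_trace_pos[OF A(1) p] p by (simp add: c_def)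
    have out: "tyler_output p n x T = c \<cdot>\<^sub>m A" by (simp add: tyler_output_def c_def A_def)
    have cA: "pos_def_mat p (c \<cdot>\<^sub>m A)" by (rule pos_def_smult[OF A(1) c])
    have trA: "mat_trace (c \<cdot>\<^sub>m A) = real p" using mat_trace_pos[OF A(1) p]
      by (simp add: mat_trace_smult[OF pos_def_matD(1)[OF A(1)]] c_def)
    have "proj_close p e S (c \<cdot>\<^sub>m A)" by (rule proj_close_smult[OF A(2) c A(1)])
    from frobenius_norm_error_le[OF S(1) cA e proj_close_same_trace[OF S(1) cA e this]]
    show ?thesis using trA trS by (simp add: out e_def)
  qed
  have main: "\<exists>T::nat. real T \<le> 73 / \<tau> * (\<bar>ln (det \<Sigma>)\<bar> + real p + ln (1 / \<epsilon>)) \<and>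
        frobenius_norm (1\<^sub>m p - mat_sqrt p S * mat_inv (tyler_output p n x T) * mat_sqrt p S) \<le> \<epsilon>"
    if eps: "0 < \<epsilon>" "\<epsilon> < 1" for \<epsilon> :: real
  proof -
    \<comment> \<open>The real solution of
      \<open>p * e0 * exp (- \<tau> / 12 * B) = \<epsilon>\<close>. Its sign is not examined, hence
      \<open>max 0 B\<close> below.\<close>
    define B where "B = 12 / \<tau> * ln (real p * e0 / \<epsilon>)"
    define T where "T = nat \<lceil>B\<rceil>"
    define L where "L = \<bar>ln (det \<Sigma>)\<bar> + real p + ln (1 / \<epsilon>)"
    have lnp: "ln (real p) \<le> real p - 1" "0 \<le> ln (real p)" using p ln_le_minus_one[of "real p"] by auto
    have le: "ln (1 / \<epsilon>) \<ge> 0" using eps by simp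
    have ln5: "ln (5 :: real) \<le> 4" using ln_le_minus_one[of "5 :: real"] by simp
    have "ln (real p * e0 / \<epsilon>) = ln (real p) + (ln 5 + ln (real p) + 1 - ln (det \<Sigma>)) + ln (1 / \<epsilon>)"
      using p d eps e0 by (simp add: e0_def ln_mult ln_div)
    also have "\<dots> \<le> 2 * real p + 3 + \<bar>ln (det \<Sigma>)\<bar> + ln (1 / \<epsilon>)" using lnp ln5 by linarith
    also have "\<dots> \<le> 6 * L"
    proof -
      have "2 * x + 3 + y + z \<le> 6 * (y + x + z)" if "x \<ge> 1" "y \<ge> 0" "z \<ge> 0" for x y z :: real
        using that by simp
      from this[of "real p" "\<bar>ln (det \<Sigma>)\<bar>" "ln (1 / \<epsilon>)"] show ?thesis using le p unfolding L_def by simp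
    qed
    finally have lnB: "ln (real p * e0 / \<epsilon>) \<le> 6 * L" .
    have L1: "L \<ge> 1" using p le unfolding L_def by linarith
    \<comment> \<open>\<open>73 = 12 * 6 + 1\<close>: the 1 pays for rounding up, which costs at
      most \<open>L / \<tau>\<close> because \<open>L \<ge> 1\<close> and
      \<open>\<tau> \<le> 1\<close>.\<close>
    have "real T \<le> max 0 B + 1" unfolding T_def by linarith
    also have "\<dots> \<le> 72 / \<tau> * L + 1 * 1"
    proof -
      have "12 / \<tau> * ln (real p * e0 / \<epsilon>) \<le> 12 / \<tau> * (6 * L)" using lnB tau by (intro mult_left_mono) auto
      moreover have "0 \<le> 12 / \<tau> * (6 * L)" using tau L1 by simp
      ultimately show ?thesis by (simp add: B_def)
    qed
    also have "\<dots> \<le> 72 / \<tau> * L + 1 / \<tau> * L"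
      using L1 tau by (intro add_left_mono mult_mono) auto
    also have "\<dots> = 73 / \<tau> * L" by (simp add: field_simps)
    finally have T: "real T \<le> 73 / \<tau> * L" .
    have "(1 - \<tau> / 12) ^ T \<le> exp (- \<tau> / 12) ^ T"
      using exp_ge_add_one_self[of "- \<tau> / 12"] tau by (intro power_mono) auto
    also have "\<dots> = exp (- (\<tau> / 12 * real T))" by (simp add: exp_of_nat_mult[symmetric] mult.commute)
    also have "\<dots> \<le> exp (- ln (real p * e0 / \<epsilon>))"
    proof -
      have "B \<le> real T" unfolding T_def by linarith
      then have "\<tau> / 12 * B \<le> \<tau> / 12 * real T" using tau by (intro mult_left_mono) auto
      then show ?thesis using tau by (simp add: B_def)
    qed
    also have "\<dots> = \<epsilon> / (real p * e0)" using p e0 eps by (simp add: exp_minus)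
    finally have "real p * ((1 - \<tau> / 12) ^ T * e0) \<le> real p * (\<epsilon> / (real p * e0) * e0)"
      using e0 by (intro mult_left_mono mult_right_mono) auto
    also have "\<dots> = \<epsilon>" using p e0 by simp
    finally show ?thesis using T err[of T] unfolding L_def by (intro exI[of _ T]) auto
  qed
  show ?thesis using est main by blast
qed

end

section \<open>Lebesgue measure under affine maps\<close>

abbreviation leb :: "nat \<Rightarrow> (nat \<Rightarrow> real) measure" where
  "leb p \<equiv> PiM {..<p} (\<lambda>_. lborel)"

lemma emeasure_lborel_affine:
  fixes c r :: real
  assumes "r \<noteq> 0" "A \<in> sets borel"
  shows "emeasure lborel A = ennreal \<bar>r\<bar> * emeasure lborel ((\<lambda>x. c + r * x) -` A)"
proof -
  have "emeasure lborel A = emeasure (density (distr lborel borel (\<lambda>x. c + r * x)) (\<lambda>_. ennreal \<bar>r\<bar>)) A"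
    using lborel_real_affine[OF assms(1), of c] by simp
  also have "\<dots> = ennreal \<bar>r\<bar> * emeasure (distr lborel borel (\<lambda>x. c + r * x)) A"
    using assms(2) by (subst emeasure_density_const) auto
  also have "emeasure (distr lborel borel (\<lambda>x. c + r * x)) A = emeasure lborel ((\<lambda>x. c + r * x) -` A)"
    using assms(2) by (subst emeasure_distr) auto
  finally show ?thesis .
qed

text \<open>One change of variables for two purposes: the identity permutation with a constant
  factor gives volumes of scaled translates, and factors of absolute value 1 give invariance under
  signed permutations. It is checked on rectangles, whose preimages are again rectangles.\<close>

lemma emeasure_leb_affine:
  fixes c r :: "nat \<Rightarrow> real"
  assumes \<pi>: "\<pi> permutes {..<p}" and r: "\<And>i. i < p \<Longrightarrow> r i \<noteq> 0" and A: "A \<in> sets (leb p)"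
  defines "T \<equiv> \<lambda>x. \<lambda>i\<in>{..<p}. c i + r i * x (\<pi> i)"
  shows "T \<in> measurable (leb p) (leb p)"
    and "emeasure (leb p) A = ennreal (\<Prod>i<p. \<bar>r i\<bar>) * emeasure (leb p) (T -` A \<inter> space (leb p))"
proof -
  interpret product_sigma_finite "\<lambda>_::nat. lborel :: real measure" by standard
  have pi: "\<pi> i < p" if "i < p" for i using permutes_in_image[OF \<pi>, of i] that by auto
  show T [measurable]: "T \<in> measurable (leb p) (leb p)"
    unfolding T_def by (intro measurable_restrict borel_measurable_add borel_measurable_times
        measurable_const measurable_compose[OF measurable_component_singleton]) (use pi in auto)
  define \<sigma> where "\<sigma> = inv_into UNIV \<pi>"
  note \<sigma> = permutes_inv[OF \<pi>, folded \<sigma>_def] permutes_inverses[OF \<pi>, folded \<sigma>_def]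
  define P where "P = scale_measure (ennreal (\<Prod>i<p. \<bar>r i\<bar>)) (distr (leb p) (leb p) T)"
  have "P = leb p"
  proof (rule PiM_eqI)
    fix E :: "nat \<Rightarrow> real set" assume E: "\<And>i. i \<in> {..<p} \<Longrightarrow> E i \<in> sets lborel"
    define G where "G = (\<lambda>j. (\<lambda>x. c (\<sigma> j) + r (\<sigma> j) * x) -` E (\<sigma> j))"
    have inv: "\<sigma> i < p" if "i < p" for i
      using permutes_in_image[OF \<sigma>(1), of i] that by auto
    have G: "G j \<in> sets lborel" if "j < p" for j
      using measurable_sets[of "\<lambda>x. c (\<sigma> j) + r (\<sigma> j) * x" borel borel "E (\<sigma> j)"] E inv[OF that]
      by (simp add: G_def)
    have "T -` PiE {..<p} E \<inter> space (leb p) = PiE {..<p} G"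
    proof (rule Set.set_eqI)
      fix x
      have "(\<forall>i<p. c i + r i * x (\<pi> i) \<in> E i) \<longleftrightarrow> (\<forall>j<p. c (\<sigma> j) + r (\<sigma> j) * x j \<in> E (\<sigma> j))"
        using pi inv \<sigma>(2,3) by metis
      then show "x \<in> T -` PiE {..<p} E \<inter> space (leb p) \<longleftrightarrow> x \<in> PiE {..<p} G"
        by (auto simp: T_def G_def space_PiM PiE_iff)
    qed
    moreover have "emeasure (leb p) (PiE {..<p} G) = (\<Prod>j<p. emeasure lborel (G j))"
      using G by (subst emeasure_PiM) auto
    moreover have "(\<Prod>j<p. emeasure lborel (G j)) = (\<Prod>i<p. emeasure lborel ((\<lambda>x. c i + r i * x) -` E i))"
      using prod.permute[OF \<sigma>(1), of "\<lambda>i. emeasure lborel ((\<lambda>x. c i + r i * x) -` E i)"]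
      by (simp add: G_def comp_def)
    ultimately have "emeasure P (PiE {..<p} E) =
        (\<Prod>i<p. ennreal \<bar>r i\<bar>) * (\<Prod>i<p. emeasure lborel ((\<lambda>x. c i + r i * x) -` E i))"
      using E by (simp add: P_def emeasure_distr prod_ennreal)
    also have "\<dots> = (\<Prod>i<p. emeasure lborel (E i))"
      unfolding prod.distrib[symmetric]
      by (intro prod.cong refl emeasure_lborel_affine[symmetric] r) (use E in auto)
    finally show "emeasure P (PiE {..<p} E) = (\<Prod>i<p. emeasure lborel (E i))" .
  qed (auto simp: P_def)
  then have "emeasure (leb p) A = emeasure P A" by simp
  then show "emeasure (leb p) A = ennreal (\<Prod>i<p. \<bar>r i\<bar>) * emeasure (leb p) (T -` A \<inter> space (leb p))"
    using A by (simp add: P_def emeasure_distr)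
qed

section \<open>The uniform distribution on the ball\<close>

definition ip :: "nat \<Rightarrow> (nat \<Rightarrow> real) \<Rightarrow> (nat \<Rightarrow> real) \<Rightarrow> real" where
  "ip p w x = (\<Sum>i<p. w i * x i)"

lemma ip_self: "ip p x x = (\<Sum>i<p. (x i)\<^sup>2)" by (simp add: ip_def power2_eq_square)

lemma ip_self_nonneg: "ip p x x \<ge> 0" by (simp add: ip_self sum_nonneg)

lemma ip_commute: "ip p w x = ip p x w" by (simp add: ip_def mult.commute)

lemma ip_cauchy_schwarz: "(ip p w x)\<^sup>2 \<le> ip p w w * ip p x x"
  unfolding ip_self unfolding ip_def by (rule Cauchy_Schwarz_ineq_sum)

lemma ip_affine:
  assumes "\<And>i. i < p \<Longrightarrow> y i = a * x i + b * w i"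
  shows "ip p v y = a * ip p v x + b * ip p v w"
proof -
  have "ip p v y = (\<Sum>i<p. a * (v i * x i) + b * (v i * w i))"
    unfolding ip_def using assms by (intro sum.cong) (auto simp: algebra_simps)
  then show ?thesis by (simp add: ip_def sum.distrib sum_distrib_left)
qed

lemma ip_self_affine:
  assumes "\<And>i. i < p \<Longrightarrow> y i = a * x i + b * w i"
  shows "ip p y y = a\<^sup>2 * ip p x x + 2 * a * b * ip p w x + b\<^sup>2 * ip p w w"
proof -
  have "ip p y y = a * ip p y x + b * ip p y w" by (rule ip_affine[OF assms])
  also have "ip p y x = a * ip p x x + b * ip p x w" using ip_affine[OF assms, where v = x] by (simp add: ip_commute)
  also have "ip p y w = a * ip p w x + b * ip p w w" using ip_affine[OF assms, where v = w] by (simp add: ip_commute)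
  finally show ?thesis by (simp add: algebra_simps power2_eq_square ip_commute[of p x w])
qed

lemma measurable_ip [measurable]: "ip p w \<in> borel_measurable (leb p)" "ip p w \<in> borel_measurable (vec_space p)"
  unfolding ip_def by measurable

lemma measurable_ip_self [measurable]: "(\<lambda>x. ip p x x) \<in> borel_measurable (leb p)"
  "(\<lambda>x. ip p x x) \<in> borel_measurable (vec_space p)"
  unfolding ip_def by measurable

lemma unit_ball_ip: "unit_ball p = {x \<in> space (leb p). ip p x x \<le> 1}"
  by (simp add: unit_ball_def ip_self)

definition ball_measure :: "nat \<Rightarrow> (nat \<Rightarrow> real) measure" where
  "ball_measure p = uniform_measure (leb p) (unit_ball p)"

lemma sets_ball_measure [measurable_cong, simp]: "sets (ball_measure p) = sets (leb p)"
  and space_ball_measure [simp]: "space (ball_measure p) = space (leb p)"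
  by (simp_all add: ball_measure_def)

lemma prob_space_ball_measure: "p \<ge> 1 \<Longrightarrow> prob_space (ball_measure p)"
  unfolding ball_measure_def using unit_ball_emeasure by (intro prob_space_uniform_measure)

lemma measure_ball_measure:
  assumes "p \<ge> 1" "A \<in> sets (leb p)"
  shows "measure (ball_measure p) A = measure (leb p) (unit_ball p \<inter> A) / measure (leb p) (unit_ball p)"
  unfolding ball_measure_def using unit_ball_emeasure[OF assms(1)] assms(2)
  by (intro measure_uniform_measure) (auto simp: less_top)

lemma fmeasurable_ball: "p \<ge> 1 \<Longrightarrow> unit_ball p \<in> fmeasurable (leb p)"
  using unit_ball_emeasure by (intro fmeasurableI) (auto simp: less_top)

lemma fmeasurable_ball_Collect:
  assumes "p \<ge> 1" "{x \<in> space (leb p). Q x} \<in> sets (leb p)"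
  shows "{x \<in> unit_ball p. Q x} \<in> fmeasurable (leb p)"
proof -
  have "{x \<in> unit_ball p. Q x} = unit_ball p \<inter> {x \<in> space (leb p). Q x}" by (auto simp: unit_ball_ip)
  then show ?thesis using fmeasurable_Int_fmeasurable[OF fmeasurable_ball assms(2)] assms(1) by simp
qed

lemma measure_unit_ball_pos: "p \<ge> 1 \<Longrightarrow> measure (leb p) (unit_ball p) > 0"
  using unit_ball_emeasure[of p] by (simp add: measure_def enn2real_positive_iff less_top zero_less_iff_neq_zero)

text \<open>\<open>T\<close> sends \<open>x\<close> to \<open>(x - c) / r\<close>, so the preimage
  is \<open>c + r A\<close>; the inclusion of \<open>A\<close> in the ball supplies
  finiteness.\<close>

lemma measure_scaled_translate:
  fixes c :: "nat \<Rightarrow> real"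
  assumes p: "p \<ge> 1" and r: "r > 0" and A: "A \<in> sets (leb p)" "A \<subseteq> unit_ball p"
  defines "T \<equiv> \<lambda>x. \<lambda>i\<in>{..<p}. - c i / r + 1 / r * x i"
  shows "T -` A \<inter> space (leb p) \<in> fmeasurable (leb p)"
    and "measure (leb p) (T -` A \<inter> space (leb p)) = r ^ p * measure (leb p) A"
proof -
  have T: "T = (\<lambda>x. \<lambda>i\<in>{..<p}. - c i / r + 1 / r * x (id i))" by (simp add: T_def)
  have "emeasure (leb p) A = ennreal (\<Prod>i<p. \<bar>1 / r\<bar>) * emeasure (leb p) (T -` A \<inter> space (leb p))"
    unfolding T using r by (intro emeasure_leb_affine A permutes_id) auto
  then have e: "emeasure (leb p) A = ennreal ((1 / r) ^ p) * emeasure (leb p) (T -` A \<inter> space (leb p))"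
    using r by simp
  have T_meas: "T \<in> measurable (leb p) (leb p)"
    unfolding T using r by (intro emeasure_leb_affine(1)[OF permutes_id _ A(1)]) auto
  have "emeasure (leb p) A < \<infinity>"
    using emeasure_mono[OF A(2), of "leb p"] unit_ball_emeasure[OF p] by (auto simp: less_top top.extremum_uniqueI)
  moreover have pos: "(1 / r) ^ p > 0" using r by simp
  ultimately have "emeasure (leb p) (T -` A \<inter> space (leb p)) < \<infinity>"
    using e r by (metis ennreal_mult_eq_top_iff ennreal_eq_0_iff infinity_ennreal_def less_top not_le)
  then show "T -` A \<inter> space (leb p) \<in> fmeasurable (leb p)"
    using measurable_sets[OF T_meas A(1)] by (intro fmeasurableI)
  have "measure (leb p) A = (1 / r) ^ p * measure (leb p) (T -` A \<inter> space (leb p))"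
    using e pos by (simp add: measure_def enn2real_mult)
  then show "measure (leb p) (T -` A \<inter> space (leb p)) = r ^ p * measure (leb p) A"
    using r by (simp add: field_simps)
qed

text \<open>The cone over a cap, cut off at radius 1, lies in a smaller ball around \<open>(t/2) w\<close>.\<close>

lemma measure_cap:
  assumes p: "p \<ge> 1" and w: "ip p w w = 1" and t: "0 \<le> t" "t \<le> 1"
  shows "measure (leb p) {x \<in> unit_ball p. ip p w x \<ge> t * sqrt (ip p x x)} \<le>
    exp (- 3 * real p * t\<^sup>2 / 8) * measure (leb p) (unit_ball p)"
proof -
  define C where "C = {x \<in> unit_ball p. ip p w x \<ge> t * sqrt (ip p x x)}"
  \<comment> \<open>For a point of the cone at radius \<open>s\<close>, the squared distance to
    \<open>(t / 2) w\<close> is at most \<open>s^2 - t^2 * s + t^2 / 4\<close>. On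
    \<open>[0, 1]\<close> this is largest at \<open>s = 1\<close>, where it equals
    \<open>r^2\<close>.\<close>
  define r where "r = sqrt (1 - 3 * t\<^sup>2 / 4)"
  have t2: "t\<^sup>2 \<le> 1" using t by (simp add: power_le_one)
  have r2: "r\<^sup>2 = 1 - 3 * t\<^sup>2 / 4" using t2 by (simp add: r_def)
  have r: "r > 0" using t2 by (simp add: r_def)
  define T where "T = (\<lambda>x. \<lambda>i\<in>{..<p}. - (t / 2 * w i) / r + 1 / r * x i :: real)"
  note B = unit_ball_sets[of p] order_refl[of "unit_ball p"]
  note m = measure_scaled_translate[OF p r B, of "\<lambda>i. t / 2 * w i", folded T_def]
  have "C \<subseteq> T -` unit_ball p \<inter> space (leb p)"
  proof
    fix x assume x: "x \<in> C"
    then have xs: "x \<in> space (leb p)" and x1: "ip p x x \<le> 1" and xw: "ip p w x \<ge> t * sqrt (ip p x x)"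
      by (auto simp: C_def unit_ball_ip)
    define s where "s = sqrt (ip p x x)"
    have s: "0 \<le> s" "s \<le> 1" "ip p x x = s\<^sup>2" using x1 ip_self_nonneg[of p x] by (auto simp: s_def)
    have "ip p (T x) (T x) = (1 / r)\<^sup>2 * ip p x x + 2 * (1 / r) * (- (t / 2) / r) * ip p w x + (- (t / 2) / r)\<^sup>2 * ip p w w"
      by (rule ip_self_affine) (simp add: T_def)
    also have "\<dots> = (s\<^sup>2 - t * ip p w x + t\<^sup>2 / 4) / r\<^sup>2"
      unfolding w s(3) using r by (simp add: field_simps power2_eq_square)
    also have "\<dots> \<le> 1"
    proof -
      have "t * (t * s) \<le> t * ip p w x" using xw t by (intro mult_left_mono) (auto simp: s_def)
      moreover have "0 \<le> (1 - s) * (1 + s - t\<^sup>2)" using s t2 by (intro mult_nonneg_nonneg) auto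
      ultimately have "s\<^sup>2 - t * ip p w x + t\<^sup>2 / 4 \<le> r\<^sup>2"
        unfolding r2 by (simp add: algebra_simps power2_eq_square)
      then show ?thesis using r by simp
    qed
    finally show "x \<in> T -` unit_ball p \<inter> space (leb p)"
      using xs by (auto simp: unit_ball_ip T_def space_PiM)
  qed
  moreover have "C \<in> sets (leb p)"
    unfolding C_def by (rule fmeasurableD, intro fmeasurable_ball_Collect p) measurable
  ultimately have "measure (leb p) C \<le> r ^ p * measure (leb p) (unit_ball p)"
    using measure_mono_fmeasurable[OF _ _ m(1), of C] m(2) by simp
  also have "r ^ p \<le> exp (- 3 * real p * t\<^sup>2 / 8)"
  proof -
    have "r\<^sup>2 \<le> (exp (- 3 * t\<^sup>2 / 8))\<^sup>2"
      using exp_ge_add_one_self[of "- 3 * t\<^sup>2 / 4"] by (simp add: r2 exp_double[symmetric])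
    then have "r \<le> exp (- 3 * t\<^sup>2 / 8)" by (rule power2_le_imp_le) simp
    then have "r ^ p \<le> exp (- 3 * t\<^sup>2 / 8) ^ p" using r by (intro power_mono) auto
    also have "\<dots> = exp (- 3 * real p * t\<^sup>2 / 8)" by (simp add: exp_of_nat_mult[symmetric] algebra_simps)
    finally show ?thesis .
  qed
  finally show ?thesis by (simp add: C_def mult_right_mono)
qed

text \<open>
  A thin slab, slightly shrunk, has many disjoint translates inside the ball.
\<close>

lemma measure_slab:
  assumes p: "p \<ge> 1" and w: "ip p w w = 1" and J: "J \<ge> (1::nat)"
  defines "s \<equiv> 1 / (6 * real J * sqrt (real p))"
  shows "measure (leb p) {x \<in> unit_ball p. \<bar>ip p w x\<bar> \<le> s} \<le> 2 / real J * measure (leb p) (unit_ball p)"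
proof -
  define A where "A = {x \<in> unit_ball p. \<bar>ip p w x\<bar> \<le> s}"
  have "A \<in> sets (leb p)" unfolding A_def by (rule fmeasurableD, intro fmeasurable_ball_Collect p) measurable
  then have A: "A \<in> sets (leb p)" "A \<subseteq> unit_ball p" by (auto simp: A_def)
  \<comment> \<open>This shrinking leaves room in the ball for translations of length up to
    \<open>1 / (2 * sqrt p)\<close>, yet keeps \<open>r ^ p \<ge> 1 / 2\<close>. The half-width
    \<open>s\<close> is such that \<open>J\<close> steps of length \<open>3 * s\<close> cover
    exactly that length.\<close>
  define r where "r = sqrt (1 - 3 / (4 * real p))"
  have p1: "real p \<ge> 1" using p by simp
  have r2: "r\<^sup>2 = 1 - 3 / (4 * real p)" using p1 by (simp add: r_def field_simps)
  have "3 / (4 * real p) \<le> 3 / 4" using p1 by (simp add: field_simps)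
  then have r: "r > 0" by (simp add: r_def)
  have r1: "r \<le> 1" by (simp add: r_def)
  have s: "s > 0" using J p1 by (simp add: s_def)
  define T where "T = (\<lambda>j x. \<lambda>i\<in>{..<p}. - (3 * s * real j * w i) / r + 1 / r * x i :: real)"
  define D where "D = (\<lambda>j. T j -` A \<inter> space (leb p))"
  have D: "D j \<in> fmeasurable (leb p)" "measure (leb p) (D j) = r ^ p * measure (leb p) A" for j
    using measure_scaled_translate[OF p r A, of "\<lambda>i. 3 * s * real j * w i"] by (simp_all add: D_def T_def)
  have in_D: "ip p x x \<le> 1 \<and> \<bar>ip p w x - 3 * s * real j\<bar> \<le> s" if x: "x \<in> D j" and j: "j < J" for x j
  proof -
    define y t where "y = T j x" and "t = 3 * s * real j"
    have y: "ip p y y \<le> 1" "\<bar>ip p w y\<bar> \<le> s" using x by (auto simp: D_def A_def unit_ball_ip y_def)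
    have xy: "x i = r * y i + t * w i" if "i < p" for i using that r by (simp add: y_def T_def t_def field_simps)
    have wx: "ip p w x = r * ip p w y + t" using ip_affine[OF xy, where v = w] w by simp
    have "\<bar>r * ip p w y\<bar> \<le> 1 * s" unfolding abs_mult using y r r1 by (intro mult_mono) auto
    then have 1: "\<bar>ip p w x - t\<bar> \<le> s" using wx by simp
    have t0: "t \<ge> 0" using s by (simp add: t_def)
    have "t \<le> 3 * s * real J" using j s by (simp add: t_def)
    also have "\<dots> = 1 / (2 * sqrt (real p))" using J by (simp add: s_def field_simps)
    finally have t1: "t \<le> 1 / (2 * sqrt (real p))" .
    have s1: "s \<le> 1 / (6 * sqrt (real p))" unfolding s_def using J p1 by (intro divide_left_mono) auto
    have "t * s \<le> 1 / (2 * sqrt (real p)) * (1 / (6 * sqrt (real p)))" using t1 s1 s by (intro mult_mono) auto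
    also have "\<dots> = 1 / (12 * (sqrt (real p) * sqrt (real p)))" by simp
    finally have ts: "t * s \<le> 1 / (12 * real p)" by simp
    have "t * t \<le> 1 / (2 * sqrt (real p)) * (1 / (2 * sqrt (real p)))" using t1 t0 by (intro mult_mono) auto
    also have "\<dots> = 1 / (4 * (sqrt (real p) * sqrt (real p)))" by simp
    finally have tt: "t * t \<le> 1 / (4 * real p)" by simp
    have "ip p x x = r\<^sup>2 * ip p y y + 2 * r * t * ip p w y + t\<^sup>2 * ip p w w" by (rule ip_self_affine[OF xy])
    also have "\<dots> \<le> r\<^sup>2 * 1 + 2 * (t * s) + t * t"
    proof -
      have "r\<^sup>2 * ip p y y \<le> r\<^sup>2 * 1" using y by (intro mult_left_mono) auto
      moreover have "t * (r * ip p w y) \<le> t * s" using \<open>\<bar>r * ip p w y\<bar> \<le> 1 * s\<close> t0 by (intro mult_left_mono) auto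
      ultimately show ?thesis unfolding w by (simp add: power2_eq_square algebra_simps)
    qed
    also have "\<dots> \<le> 1 - 3 / (4 * real p) + 2 * (1 / (12 * real p)) + 1 / (4 * real p)" using ts tt r2 by simp
    also have "\<dots> \<le> 1" using p1 by (simp add: field_simps)
    finally show ?thesis using 1 by (simp add: t_def)
  qed
  \<comment> \<open>The centres are \<open>3 * s\<close> apart, while the half-widths are at most
    \<open>s\<close>.\<close>
  have disj: "disjoint_family_on D {..<J}"
    unfolding disjoint_family_on_def
  proof (intro ballI impI, rule ccontr)
    fix j k assume jk: "j \<in> {..<J}" "k \<in> {..<J}" "j \<noteq> k" "D j \<inter> D k \<noteq> {}"
    then obtain x where "x \<in> D j" "x \<in> D k" by auto
    then have "\<bar>ip p w x - 3 * s * real j\<bar> \<le> s" "\<bar>ip p w x - 3 * s * real k\<bar> \<le> s" using in_D jk by auto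
    then have "\<bar>3 * s * real j - 3 * s * real k\<bar> \<le> 2 * s" by linarith
    also have "3 * s * real j - 3 * s * real k = 3 * s * (real j - real k)" by (simp add: algebra_simps)
    finally have "3 * s * \<bar>real j - real k\<bar> \<le> 2 * s" using s by (simp add: abs_mult)
    then have "3 * \<bar>real j - real k\<bar> \<le> 2" using s by simp
    moreover have "\<bar>real j - real k\<bar> \<ge> 1" using jk(3) by linarith
    ultimately show False by simp
  qed
  have "real J * (r ^ p * measure (leb p) A) = (\<Sum>j<J. measure (leb p) (D j))" by (simp add: D)
  also have "\<dots> = measure (leb p) (\<Union>j<J. D j)"
    using D(1) disj by (intro measure_UNION_AE[symmetric] pairwiseI AE_I2)
      (auto simp: disjoint_family_on_def disjnt_def)
  also have "\<dots> \<le> measure (leb p) (unit_ball p)"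
  proof (rule measure_mono_fmeasurable[OF _ _ fmeasurable_ball[OF p]])
    show "(\<Union>j<J. D j) \<subseteq> unit_ball p" using in_D by (auto simp: unit_ball_ip D_def)
    show "(\<Union>j<J. D j) \<in> sets (leb p)" using D(1) by (intro sets.finite_UN) (auto dest: fmeasurableD)
  qed
  finally have le: "real J * (r ^ p * measure (leb p) A) \<le> measure (leb p) (unit_ball p)" .
  have "(1 / 2)\<^sup>2 \<le> (r ^ p)\<^sup>2"
  proof -
    \<comment> \<open>Bernoulli's inequality gives \<open>r ^ (2 * p) \<ge> 1 / 4\<close>; its
      square root is the origin of the factor 2 in the slab bound.\<close>
    have "1 + real p * (- (3 / (4 * real p))) \<le> (1 + - (3 / (4 * real p))) ^ p"
      by (rule Bernoulli_inequality) (use \<open>3 / (4 * real p) \<le> 3 / 4\<close> in linarith)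
    moreover have "(r ^ p)\<^sup>2 = (r\<^sup>2) ^ p" by (simp add: power_mult[symmetric] mult.commute)
    ultimately show ?thesis using p1 r2 by (simp add: power_divide)
  qed
  then have "1 / 2 \<le> r ^ p" by (rule power2_le_imp_le) (use r in simp)
  then have "real J * (1 / 2 * measure (leb p) A) \<le> real J * (r ^ p * measure (leb p) A)"
    by (intro mult_left_mono mult_right_mono) auto
  with le have "real J * (1 / 2 * measure (leb p) A) \<le> measure (leb p) (unit_ball p)" by linarith
  then show ?thesis using J by (simp add: A_def field_simps)
qed

lemma ip_self_signed_permutation:
  fixes r :: "nat \<Rightarrow> real"
  assumes \<pi>: "\<pi> permutes {..<p}" and r: "\<And>i. i < p \<Longrightarrow> \<bar>r i\<bar> = 1"
  shows "ip p (\<lambda>i\<in>{..<p}. r i * x (\<pi> i)) (\<lambda>i\<in>{..<p}. r i * x (\<pi> i)) = ip p x x"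
proof -
  have "(r i)\<^sup>2 = 1" if "i < p" for i using r[OF that] abs_square_eq_1[of "r i"] by simp
  then have "ip p (\<lambda>i\<in>{..<p}. r i * x (\<pi> i)) (\<lambda>i\<in>{..<p}. r i * x (\<pi> i)) = (\<Sum>i<p. (x (\<pi> i))\<^sup>2)"
    unfolding ip_self by (intro sum.cong) (auto simp: power_mult_distrib)
  also have "\<dots> = ip p x x" unfolding ip_self
    using sum.permute[OF \<pi>, of "\<lambda>i. (x i)\<^sup>2"] by (simp add: comp_def)
  finally show ?thesis .
qed

text \<open>Signed permutations preserve both Lebesgue measure and the ball. They carry enough
  symmetry to determine the second moments of a random direction.\<close>

lemma distr_ball_measure_signed_permutation:
  assumes p: "p \<ge> 1" and \<pi>: "\<pi> permutes {..<p}" and r: "\<And>i. i < p \<Longrightarrow> \<bar>r i\<bar> = (1 :: real)"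
  defines "T \<equiv> \<lambda>x. \<lambda>i\<in>{..<p}. r i * x (\<pi> i)"
  shows "T \<in> measurable (ball_measure p) (ball_measure p)" "distr (ball_measure p) (ball_measure p) T = ball_measure p"
proof -
  have r0: "r i \<noteq> 0" if "i < p" for i using r[OF that] by auto
  have T: "T \<in> measurable (leb p) (leb p)"
    using emeasure_leb_affine(1)[where r = r and c = "\<lambda>_. 0" and A = "{}", OF \<pi> r0] by (simp add: T_def)
  then show Tb: "T \<in> measurable (ball_measure p) (ball_measure p)" by (simp cong: measurable_cong_sets)
  have inv: "emeasure (leb p) (T -` A \<inter> space (leb p)) = emeasure (leb p) A" if "A \<in> sets (leb p)" for A
    using emeasure_leb_affine(2)[where r = r and c = "\<lambda>_. 0", OF \<pi> r0 that] r by (simp add: T_def)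
  have nT: "ip p (T x) (T x) = ip p x x" for x unfolding T_def by (rule ip_self_signed_permutation[OF \<pi> r])
  show "distr (ball_measure p) (ball_measure p) T = ball_measure p"
  proof (rule measure_eqI)
    fix A assume "A \<in> sets (distr (ball_measure p) (ball_measure p) T)"
    then have A: "A \<in> sets (leb p)" by simp
    have "unit_ball p \<inter> (T -` A \<inter> space (leb p)) = T -` (unit_ball p \<inter> A) \<inter> space (leb p)"
      using measurable_space[OF T] by (auto simp: unit_ball_ip nT)
    moreover have "emeasure (leb p) (T -` (unit_ball p \<inter> A) \<inter> space (leb p)) = emeasure (leb p) (unit_ball p \<inter> A)"
      using A by (intro inv) auto
    ultimately show "emeasure (distr (ball_measure p) (ball_measure p) T) A = emeasure (ball_measure p) A"
      using A measurable_sets[OF T A] by (simp add: emeasure_distr[OF Tb]) (simp add: ball_measure_def)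
  qed simp
qed

section \<open>One-dimensional marginals of the uniform distribution on the sphere\<close>

text \<open>For \<open>x\<close> uniform in the ball, \<open>x / |x|\<close> is uniform on the sphere.\<close>

definition marg :: "nat \<Rightarrow> (nat \<Rightarrow> real) \<Rightarrow> (nat \<Rightarrow> real) \<Rightarrow> real" where
  "marg p w x = real p * (ip p w x)\<^sup>2 / ip p x x"

lemma measurable_marg [measurable]: "marg p w \<in> borel_measurable (leb p)" "marg p w \<in> borel_measurable (vec_space p)"
  unfolding marg_def by measurable

lemma marg_nonneg: "marg p w x \<ge> 0"
  by (simp add: marg_def ip_self_nonneg)

lemma marg_le: assumes "ip p w w = 1" shows "marg p w x \<le> real p"
proof -
  have "real p * (ip p w x)\<^sup>2 \<le> real p * ip p x x"
    using ip_cauchy_schwarz[of p w x] assms by (intro mult_left_mono) auto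
  then show ?thesis using ip_self_nonneg[of p x] by (simp add: marg_def divide_le_eq)
qed

lemma AE_ball_nonzero:
  assumes p: "p \<ge> 1"
  shows "AE x in ball_measure p. ip p x x \<noteq> 0"
proof -
  interpret product_sigma_finite "\<lambda>_::nat. lborel :: real measure" by standard
  have "PiE {..<p} (\<lambda>_. {0 :: real}) \<in> null_sets (leb p)"
  proof (rule null_setsI)
    have "emeasure (leb p) (PiE {..<p} (\<lambda>_. {0 :: real})) = (\<Prod>i<p. emeasure lborel {0 :: real})"
      by (subst emeasure_PiM) auto
    then show "emeasure (leb p) (PiE {..<p} (\<lambda>_. {0 :: real})) = 0" using p by simp
  qed (rule sets_PiM_I_finite, auto)
  moreover have "{x \<in> space (leb p). \<not> ip p x x \<noteq> 0} \<subseteq> PiE {..<p} (\<lambda>_. {0 :: real})"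
  proof
    fix x assume x: "x \<in> {x \<in> space (leb p). \<not> ip p x x \<noteq> 0}"
    then have "(\<Sum>i<p. (x i)\<^sup>2) = 0" by (simp add: ip_self)
    then have "\<forall>i\<in>{..<p}. (x i)\<^sup>2 = 0" by (subst (asm) sum_nonneg_eq_0_iff) auto
    moreover have "x \<in> extensional {..<p}" using x by (simp add: space_PiM PiE_iff)
    ultimately show "x \<in> PiE {..<p} (\<lambda>_. {0})" unfolding PiE_iff by simp
  qed
  ultimately have "AE x in leb p. ip p x x \<noteq> 0" by (rule AE_I')
  then show ?thesis unfolding ball_measure_def by (intro AE_uniform_measureI) auto
qed

text \<open>A marginal of at least \<open>y\<close> puts the point into one of two opposite cones
  with \<open>t = sqrt (y / p)\<close>. The dimension cancels in the exponent of the cap bound, and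
  values \<open>y > p\<close> do not occur.\<close>

lemma marg_tail:
  assumes p: "p \<ge> 1" and w: "ip p w w = 1" and y: "y \<ge> 0"
  shows "measure (ball_measure p) {x \<in> space (leb p). y \<le> marg p w x} \<le> 2 * exp (- 3 * y / 8)"
proof (cases "0 < y \<and> y \<le> real p")
  case False
  show ?thesis
  proof (cases "y = 0")
    case True
    interpret prob_space "ball_measure p" by (rule prob_space_ball_measure[OF p])
    show ?thesis unfolding True by (rule order_trans[OF prob_le_1]) simp
  next
    case nz: False
    then have "y > real p" using False y by linarith
    then have "\<not> y \<le> marg p w x" for x using marg_le[OF w, of x] by linarith
    then show ?thesis by simp
  qed
next
  case y: True
  define t where "t = sqrt (y / real p)"
  have t: "0 \<le> t" "t \<le> 1" "real p * t\<^sup>2 = y" using y p by (auto simp: t_def)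
  define w' where "w' = (\<lambda>i. - w i)"
  have ipw': "ip p w' x = - ip p w x" for x by (simp add: w'_def ip_def sum_negf)
  have w': "ip p w' w' = 1" using w by (simp add: w'_def ip_def)
  define C where "C = (\<lambda>w. {x \<in> unit_ball p. ip p w x \<ge> t * sqrt (ip p x x)})"
  have C: "C v \<in> fmeasurable (leb p)" for v
    unfolding C_def by (intro fmeasurable_ball_Collect p) measurable
  define A where "A = {x \<in> space (leb p). y \<le> marg p w x}"
  have A: "A \<in> sets (leb p)" unfolding A_def by measurable
  have sub: "unit_ball p \<inter> A \<subseteq> C w \<union> C w'"
  proof
    fix x assume x: "x \<in> unit_ball p \<inter> A"
    then have "0 < marg p w x" "y \<le> marg p w x" using y by (auto simp: A_def)
    then have "ip p x x > 0" using ip_self_nonneg[of p x] by (cases "ip p x x = 0") (auto simp: marg_def)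
    then have "y * ip p x x \<le> real p * (ip p w x)\<^sup>2" using \<open>y \<le> marg p w x\<close> by (simp add: marg_def field_simps)
    then have "real p * (t\<^sup>2 * ip p x x) \<le> real p * (ip p w x)\<^sup>2"
      by (simp only: mult.assoc[symmetric] t(3))
    then have "t\<^sup>2 * ip p x x \<le> (ip p w x)\<^sup>2" by (rule mult_left_le_imp_le) (use p in simp)
    then have "(t * sqrt (ip p x x))\<^sup>2 \<le> \<bar>ip p w x\<bar>\<^sup>2" using ip_self_nonneg[of p x] by (simp add: power_mult_distrib)
    then have "t * sqrt (ip p x x) \<le> \<bar>ip p w x\<bar>" by (rule power2_le_imp_le) simp
    then show "x \<in> C w \<union> C w'" using x by (auto simp: C_def ipw' abs_if split: if_splits)
  qed
  have "measure (leb p) (unit_ball p \<inter> A) \<le> measure (leb p) (C w \<union> C w')"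
    using A by (intro measure_mono_fmeasurable[OF sub] fmeasurable.Un C) auto
  also have "\<dots> \<le> measure (leb p) (C w) + measure (leb p) (C w')" by (intro measure_Un_le fmeasurableD C)
  also have "\<dots> \<le> 2 * (exp (- 3 * real p * t\<^sup>2 / 8) * measure (leb p) (unit_ball p))"
    using measure_cap[OF p w t(1,2)] measure_cap[OF p w' t(1,2)] by (simp add: C_def)
  also have "- 3 * real p * t\<^sup>2 / 8 = - 3 * y / 8" using t(3) by simp
  finally show ?thesis
    using measure_unit_ball_pos[OF p] measure_ball_measure[OF p A] by (simp add: A_def divide_le_eq)
qed

text \<open>In the unit ball a small marginal forces a small component, so the set lies in a slab.
  The half-width of that slab has order \<open>1 / sqrt p\<close>, which makes the threshold
  independent of \<open>p\<close>.\<close>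

lemma marg_small:
  assumes p: "p \<ge> 1" and w: "ip p w w = 1" and J: "J \<ge> (1::nat)"
  shows "measure (ball_measure p) {x \<in> space (leb p). marg p w x < 1 / (36 * (real J)\<^sup>2)} \<le> 2 / real J"
proof -
  define s where "s = 1 / (6 * real J * sqrt (real p))"
  have s: "s \<ge> 0" "real p * s\<^sup>2 = 1 / (36 * (real J)\<^sup>2)" using p J by (auto simp: s_def field_simps power_divide power_mult_distrib)
  define A where "A = {x \<in> space (leb p). marg p w x < 1 / (36 * (real J)\<^sup>2)}"
  have A: "A \<in> sets (leb p)" unfolding A_def by measurable
  define S where "S = {x \<in> unit_ball p. \<bar>ip p w x\<bar> \<le> s}"
  have S: "S \<in> fmeasurable (leb p)" unfolding S_def by (intro fmeasurable_ball_Collect p) measurable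
  have sub: "unit_ball p \<inter> A \<subseteq> S"
  proof
    fix x assume x: "x \<in> unit_ball p \<inter> A"
    have "(ip p w x)\<^sup>2 \<le> s\<^sup>2"
    proof (cases "ip p x x = 0")
      case True
      then show ?thesis using ip_cauchy_schwarz[of p w x] s by simp
    next
      case False
      then have pos: "ip p x x > 0" using ip_self_nonneg[of p x] by simp
      have "real p * (ip p w x)\<^sup>2 \<le> (real p * s\<^sup>2) * ip p x x"
        using x pos s by (simp add: A_def marg_def divide_less_eq less_imp_le)
      also have "\<dots> \<le> (real p * s\<^sup>2) * 1" using x by (intro mult_left_mono) (auto simp: unit_ball_ip)
      finally show ?thesis using p by simp
    qed
    then have "\<bar>ip p w x\<bar>\<^sup>2 \<le> s\<^sup>2" by simp
    then have "\<bar>ip p w x\<bar> \<le> s" by (rule power2_le_imp_le) (rule s(1))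
    then show "x \<in> S" using x by (simp add: S_def)
  qed
  have "measure (leb p) (unit_ball p \<inter> A) \<le> measure (leb p) S"
    using A by (intro measure_mono_fmeasurable[OF sub] S) auto
  also have "\<dots> \<le> 2 / real J * measure (leb p) (unit_ball p)"
    using measure_slab[OF p w J] by (simp add: S_def s_def)
  finally show ?thesis
    using measure_unit_ball_pos[OF p] measure_ball_measure[OF p A] by (simp add: A_def divide_le_eq)
qed

text \<open>Sign flips annihilate the mixed second moments of \<open>x / |x|\<close>, transpositions
  make the pure ones equal, and these sum to 1 off the origin; hence each equals
  \<open>1 / p\<close>.\<close>

lemma marg_mean:
  assumes p: "p \<ge> 1" and w: "ip p w w = 1"
  shows "(\<integral>x. marg p w x \<partial>ball_measure p) = 1"
proof -
  interpret prob_space "ball_measure p" by (rule prob_space_ball_measure[OF p])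
  define f where "f = (\<lambda>j k x. x j * x k / ip p x x :: real)"
  have f_meas: "f j k \<in> borel_measurable (ball_measure p)" if "j < p" "k < p" for j k
  proof -
    have comp: "(\<lambda>x. x i) \<in> borel_measurable (leb p)" if "i < p" for i
      using measurable_component_singleton[of i "{..<p}" "\<lambda>_. lborel"] that by simp
    have "f j k \<in> borel_measurable (leb p)"
      unfolding f_def by (intro borel_measurable_divide borel_measurable_times comp that measurable_ip_self)
    then show ?thesis by (simp cong: measurable_cong_sets)
  qed
  have f_bd: "\<bar>f j k x\<bar> \<le> 1" if "j < p" "k < p" for j k x
  proof -
    have "(x j)\<^sup>2 \<le> ip p x x" "(x k)\<^sup>2 \<le> ip p x x" unfolding ip_self using that by (auto intro!: member_le_sum)
    moreover have "2 * \<bar>x j * x k\<bar> \<le> (x j)\<^sup>2 + (x k)\<^sup>2"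
      using sum_squares_bound[of "\<bar>x j\<bar>" "\<bar>x k\<bar>"] by (simp add: abs_mult)
    ultimately have "\<bar>x j * x k\<bar> \<le> ip p x x" by linarith
    then show ?thesis unfolding f_def abs_divide using ip_self_nonneg[of p x] by (auto simp: divide_le_eq)
  qed
  have f_int: "integrable (ball_measure p) (f j k)" if "j < p" "k < p" for j k
    using f_bd[OF that] f_meas[OF that] by (intro integrable_const_bound[of _ 1]) auto
  have invariant: "(\<integral>x. f j k x \<partial>ball_measure p) = (\<integral>x. f j k (\<lambda>i\<in>{..<p}. r i * x (\<pi> i)) \<partial>ball_measure p)"
    if "j < p" "k < p" "\<pi> permutes {..<p}" "\<And>i. i < p \<Longrightarrow> \<bar>r i\<bar> = 1" for j k \<pi> r
    using integral_distr[OF distr_ball_measure_signed_permutation(1)[where r = r, OF p that(3,4)] f_meas[OF that(1,2)]]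
      distr_ball_measure_signed_permutation(2)[where r = r, OF p that(3,4)] by simp
  define m where "m = (\<lambda>j k. \<integral>x. f j k x \<partial>ball_measure p)"
  have off: "m j k = 0" if jk: "j < p" "k < p" "j \<noteq> k" for j k
  proof -
    define r where "r = (\<lambda>i. if i = j then -1 else 1 :: real)"
    have r: "\<bar>r i\<bar> = 1" for i by (simp add: r_def)
    have "f j k (\<lambda>i\<in>{..<p}. r i * x (id i)) = - f j k x" for x
      using ip_self_signed_permutation[of id p r x, OF permutes_id r] jk by (simp add: f_def r_def)
    then have "m j k = - m j k"
      using invariant[of j k id r, OF jk(1,2) permutes_id r] by (simp add: m_def)
    then show ?thesis by simp
  qed
  have diag: "m j j = m k k" if jk: "j < p" "k < p" for j k
  proof -
    have tr: "Transposition.transpose j k permutes {..<p}" using jk by (intro permutes_swap_id) auto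
    have "f j j (\<lambda>i\<in>{..<p}. 1 * x (Transposition.transpose j k i)) = f k k x" for x
      using ip_self_signed_permutation[of _ p "\<lambda>_. 1" x, OF tr] jk by (simp add: f_def)
    then show ?thesis
      using invariant[of j j "Transposition.transpose j k" "\<lambda>_. 1", OF jk(1,1) tr] by (simp add: m_def)
  qed
  have "(\<Sum>j<p. m j j) = (\<integral>x. (\<Sum>j<p. f j j x) \<partial>ball_measure p)"
    unfolding m_def using f_int by (subst Bochner_Integration.integral_sum) auto
  also have "\<dots> = (\<integral>x. 1 \<partial>ball_measure p)"
  proof (rule integral_cong_AE)
    show "AE x in ball_measure p. (\<Sum>j<p. f j j x) = 1"
      using AE_ball_nonzero[OF p]
      by eventually_elim (simp add: f_def sum_divide_distrib[symmetric] ip_def)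
    show "(\<lambda>x. \<Sum>j<p. f j j x) \<in> borel_measurable (ball_measure p)" using f_meas by (intro borel_measurable_sum) auto
  qed simp
  also have "\<dots> = 1" using prob_space by simp
  finally have tot: "(\<Sum>j<p. m j j) = 1" .
  have mj: "m j j = 1 / real p" if "j < p" for j
  proof -
    have "(\<Sum>k<p. m k k) = (\<Sum>k<p. m j j)" by (intro sum.cong refl diag) (use that in auto)
    then show ?thesis using tot p by (simp add: field_simps)
  qed
  have "marg p w x = (\<Sum>j<p. \<Sum>k<p. real p * (w j * w k) * f j k x)" for x
  proof -
    have "(ip p w x)\<^sup>2 = (\<Sum>j<p. \<Sum>k<p. (w j * x j) * (w k * x k))"
      by (simp add: ip_def power2_eq_square sum_product)
    then show ?thesis
      by (simp add: marg_def f_def sum_distrib_left sum_divide_distrib) (simp add: mult_ac)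
  qed
  then have "(\<integral>x. marg p w x \<partial>ball_measure p) = (\<integral>x. (\<Sum>j<p. \<Sum>k<p. real p * (w j * w k) * f j k x) \<partial>ball_measure p)"
    by simp
  also have "\<dots> = (\<Sum>j<p. \<integral>x. (\<Sum>k<p. real p * (w j * w k) * f j k x) \<partial>ball_measure p)"
    by (rule Bochner_Integration.integral_sum)
      (intro Bochner_Integration.integrable_sum integrable_mult_right f_int, auto)
  also have "\<dots> = (\<Sum>j<p. \<Sum>k<p. \<integral>x. real p * (w j * w k) * f j k x \<partial>ball_measure p)"
    by (intro sum.cong refl Bochner_Integration.integral_sum integrable_mult_right f_int) auto
  also have "\<dots> = (\<Sum>j<p. \<Sum>k<p. real p * (w j * w k) * m j k)"
    by (simp add: m_def)
  also have "\<dots> = (\<Sum>j<p. \<Sum>k<p. if k = j then (w j)\<^sup>2 else 0)"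
    using off mj p by (intro sum.cong refl) (auto simp: power2_eq_square)
  also have "\<dots> = 1" using w by (simp add: ip_self)
  finally show ?thesis .
qed

section \<open>Concentration\<close>

lemma exp_le_quadratic: "exp z \<le> 1 + z + z\<^sup>2 * exp \<bar>z :: real\<bar> / 2"
proof -
  obtain t where t: "\<bar>t\<bar> \<le> \<bar>z\<bar>" "exp z = (\<Sum>m<2. z ^ m / fact m) + exp t / fact 2 * z ^ 2"
    using Maclaurin_exp_le[of z 2] by blast
  have "exp t * z\<^sup>2 \<le> exp \<bar>z\<bar> * z\<^sup>2" using t(1) by (intro mult_right_mono) auto
  then show ?thesis unfolding t(2) by (simp add: numeral_2_eq_2 mult.commute)
qed

text \<open>Sum over the integer levels of \<open>marg\<close>: per level the tail beats the growth
  by \<open>exp (- 1 / 4) \<le> 4 / 5\<close>. The value 20 is the prefactor 4 times the bound 5 for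
  the geometric series.\<close>

lemma marg_exp_moment:
  assumes p: "p \<ge> 1" and w: "ip p w w = 1"
  shows "integrable (ball_measure p) (\<lambda>x. exp (marg p w x / 8))"
    and "(\<integral>x. exp (marg p w x / 8) \<partial>ball_measure p) \<le> 20"
proof -
  interpret prob_space "ball_measure p" by (rule prob_space_ball_measure[OF p])
  have meas: "marg p w \<in> borel_measurable (ball_measure p)"
    using measurable_marg(1) by (simp cong: measurable_cong_sets)
  show int: "integrable (ball_measure p) (\<lambda>x. exp (marg p w x / 8))"
    using marg_le[OF w] meas by (intro integrable_const_bound[of _ "exp (real p / 8)"]) auto
  define A where "A = (\<lambda>k. {x \<in> space (leb p). real k \<le> marg p w x})"
  have A: "A k \<in> events" for k unfolding A_def by simp
  have "exp (marg p w x / 8) \<le> (\<Sum>k\<le>p. exp ((real k + 1) / 8) * indicator (A k) x)" if "x \<in> space (leb p)" for x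
  proof -
    define k where "k = nat \<lfloor>marg p w x\<rfloor>"
    have k: "real k \<le> marg p w x" "marg p w x \<le> real k + 1"
      using marg_nonneg[of p w x] unfolding k_def by linarith+
    then have "k \<le> p" using marg_le[OF w, of x] by linarith
    have "exp (marg p w x / 8) \<le> exp ((real k + 1) / 8) * indicator (A k) x"
      using k that by (simp add: A_def)
    also have "\<dots> \<le> (\<Sum>k\<le>p. exp ((real k + 1) / 8) * indicator (A k) x)"
      using \<open>k \<le> p\<close> by (intro member_le_sum[of k "{..p}" "\<lambda>k. exp ((real k + 1) / 8) * indicator (A k) x"]) auto
    finally show ?thesis .
  qed
  then have "(\<integral>x. exp (marg p w x / 8) \<partial>ball_measure p) \<le>
      (\<integral>x. (\<Sum>k\<le>p. exp ((real k + 1) / 8) * indicator (A k) x) \<partial>ball_measure p)"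
    using A by (intro integral_mono int Bochner_Integration.integrable_sum integrable_mult_right integrable_real_indicator)
      (auto simp: emeasure_eq_measure)
  also have "\<dots> = (\<Sum>k\<le>p. \<integral>x. exp ((real k + 1) / 8) * indicator (A k) x \<partial>ball_measure p)"
    using A by (intro Bochner_Integration.integral_sum integrable_mult_right integrable_real_indicator)
      (auto simp: emeasure_eq_measure)
  also have "\<dots> = (\<Sum>k\<le>p. exp ((real k + 1) / 8) * prob (A k))"
    using A by (intro sum.cong refl) (simp add: sets.Int_space_eq2)
  also have "\<dots> \<le> (\<Sum>k\<le>p. 4 * (4 / 5) ^ k)"
  proof (rule sum_mono)
    fix k assume "k \<in> {..p}"
    have e8: "exp (1 / 8 :: real) \<le> 2"
      using exp_bound_half[of "1 / 8 :: real"] by simp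
    have "1 + 1 / 4 \<le> exp (1 / 4 :: real)" by (rule exp_ge_add_one_self)
    then have e4: "exp (- (1 / 4) :: real) \<le> 4 / 5" by (simp add: exp_minus field_simps)
    have "exp ((real k + 1) / 8) * prob (A k) \<le> exp ((real k + 1) / 8) * (2 * exp (- 3 * real k / 8))"
      using marg_tail[OF p w, of "real k"] by (intro mult_left_mono) (auto simp: A_def)
    also have "\<dots> = 2 * exp ((real k + 1) / 8 + - 3 * real k / 8)" by (simp only: exp_add mult_ac)
    also have "(real k + 1) / 8 + - 3 * real k / 8 = 1 / 8 + real k * (- (1 / 4))" by (simp add: field_simps)
    also have "exp (1 / 8 + real k * (- (1 / 4))) = exp (1 / 8) * exp (- (1 / 4)) ^ k"
      unfolding exp_add exp_of_nat_mult ..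
    also have "2 * (exp (1 / 8) * exp (- (1 / 4) :: real) ^ k) \<le> 2 * (2 * (4 / 5) ^ k)"
      using e8 e4 by (intro mult_left_mono mult_mono power_mono) auto
    finally show "exp ((real k + 1) / 8) * prob (A k) \<le> 4 * (4 / 5) ^ k" by simp
  qed
  also have "\<dots> \<le> 20"
  proof -
    have "(\<Sum>k\<le>p. (4 / 5 :: real) ^ k) \<le> 5"
      using sum_gp_basic[of "4 / 5 :: real" p] zero_le_power[of "4 / 5 :: real" "Suc p"] by simp
    then show ?thesis by (simp add: sum_distrib_left[symmetric])
  qed
  finally show "(\<integral>x. exp (marg p w x / 8) \<partial>ball_measure p) \<le> 20" .
qed

text \<open>The linear term of the expansion integrates to zero because the marginal has mean 1; the
  quadratic remainder is controlled by the exponential moment, with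
  \<open>10240 = 512 * 20\<close>.\<close>

lemma marg_mgf:
  assumes p: "p \<ge> 1" and w: "ip p w w = 1" and s: "\<bar>s\<bar> \<le> 1 / 16"
  shows "(\<integral>\<^sup>+x. ennreal (exp (s * (marg p w x - 1))) \<partial>ball_measure p) \<le> ennreal (exp (10240 * s\<^sup>2))"
proof -
  interpret prob_space "ball_measure p" by (rule prob_space_ball_measure[OF p])
  have meas: "marg p w \<in> borel_measurable (ball_measure p)"
    using measurable_marg(1) by (simp cong: measurable_cong_sets)
  have int: "integrable (ball_measure p) (marg p w)"
    using marg_le[OF w] marg_nonneg meas by (intro integrable_const_bound[of _ "real p"]) auto
  have bound: "exp (s * (marg p w x - 1)) \<le> 1 + s * (marg p w x - 1) + 512 * s\<^sup>2 * exp (marg p w x / 8)" for x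
  proof -
    define Y where "Y = marg p w x"
    have Y: "Y \<ge> 0" by (simp add: Y_def marg_nonneg)
    \<comment> \<open>Half of the integrable exponent \<open>Y / 8\<close>, up to a shift: one
      factor \<open>exp a\<close> absorbs the polynomial \<open>(Y - 1)^2\<close>, the other the
      exponential in the remainder.\<close>
    define a where "a = (Y + 1) / 16"
    have a: "a \<ge> 0" using Y by (simp add: a_def)
    have "\<bar>s * (Y - 1)\<bar> \<le> 1 / 16 * (Y + 1)" unfolding abs_mult using s Y by (intro mult_mono) auto
    then have z: "\<bar>s * (Y - 1)\<bar> \<le> a" by (simp add: a_def)
    have "a\<^sup>2 / 2 \<le> exp a" using exp_lower_Taylor_quadratic[OF a] a by linarith
    then have "(Y + 1)\<^sup>2 \<le> 512 * exp a" by (simp add: a_def power_divide)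
    moreover have "(Y - 1)\<^sup>2 \<le> (Y + 1)\<^sup>2" using Y by (simp add: power2_eq_square algebra_simps)
    ultimately have sq: "(Y - 1)\<^sup>2 \<le> 512 * exp a" by linarith
    have "(s * (Y - 1))\<^sup>2 * exp \<bar>s * (Y - 1)\<bar> \<le> s\<^sup>2 * (512 * exp a) * exp a"
      unfolding power_mult_distrib using sq z by (intro mult_mono mult_left_mono) auto
    also have "\<dots> = 512 * s\<^sup>2 * (exp a * exp a)" by simp
    also have "exp a * exp a = exp (1 / 8) * exp (Y / 8)"
      unfolding exp_add[symmetric] by (simp add: a_def field_simps)
    also have "512 * s\<^sup>2 * (exp (1 / 8) * exp (Y / 8)) \<le> 512 * s\<^sup>2 * (2 * exp (Y / 8))"
      using exp_bound_half[of "1 / 8 :: real"] by (intro mult_left_mono mult_right_mono) auto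
    finally have "(s * (Y - 1))\<^sup>2 * exp \<bar>s * (Y - 1)\<bar> / 2 \<le> 512 * s\<^sup>2 * exp (Y / 8)" by simp
    then show ?thesis using exp_le_quadratic[of "s * (Y - 1)"] by (simp add: Y_def)
  qed
  have int1: "integrable (ball_measure p) (\<lambda>x. 1 + s * (marg p w x - 1) + 512 * s\<^sup>2 * exp (marg p w x / 8))"
    using int marg_exp_moment(1)[OF p w] by simp
  have int2: "integrable (ball_measure p) (\<lambda>x. exp (s * (marg p w x - 1)))"
    by (rule Bochner_Integration.integrable_bound[OF int1])
      (use meas bound in \<open>auto intro!: AE_I2 order_trans[OF bound]\<close>)
  have "(\<integral>x. exp (s * (marg p w x - 1)) \<partial>ball_measure p) \<le>
      (\<integral>x. 1 + s * (marg p w x - 1) + 512 * s\<^sup>2 * exp (marg p w x / 8) \<partial>ball_measure p)"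
    by (rule integral_mono[OF int2 int1]) (rule bound)
  also have "\<dots> = 1 + 512 * s\<^sup>2 * (\<integral>x. exp (marg p w x / 8) \<partial>ball_measure p)"
    using int marg_exp_moment(1)[OF p w] marg_mean[OF p w] prob_space by simp
  also have "\<dots> \<le> 1 + 512 * s\<^sup>2 * 20"
    using marg_exp_moment(2)[OF p w] by (intro add_left_mono mult_left_mono) auto
  also have "\<dots> \<le> exp (10240 * s\<^sup>2)" using exp_ge_add_one_self[of "10240 * s\<^sup>2"] by simp
  finally have "(\<integral>x. exp (s * (marg p w x - 1)) \<partial>ball_measure p) \<le> exp (10240 * s\<^sup>2)" .
  then show ?thesis using nn_integral_eq_integral[OF int2] by (simp add: ennreal_leI)
qed

text \<open>The usual Chernoff parameter is absorbed into \<open>f\<close>. Extended nonnegative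
  integrals factor over the product without any integrability condition.\<close>

lemma chernoff_iid:
  assumes D: "prob_space D" and f [measurable]: "f \<in> borel_measurable D"
    and mgf: "(\<integral>\<^sup>+x. ennreal (exp (f x)) \<partial>D) \<le> ennreal (exp k)"
  shows "measure (PiM {..<n} (\<lambda>_. D)) {\<omega> \<in> space (PiM {..<n} (\<lambda>_. D)). t \<le> (\<Sum>i<n. f (\<omega> i))} \<le> exp (real n * k - t)"
proof -
  interpret D: prob_space D by fact
  interpret product_prob_space "\<lambda>_::nat. D" by unfold_locales
  define M where "M = PiM {..<n} (\<lambda>_. D)"
  interpret M: prob_space M unfolding M_def by (rule prob_space_PiM) (rule D)
  define g where "g = (\<lambda>\<omega>. \<Prod>i<n. ennreal (exp (f (\<omega> i))))"
  have g [measurable]: "g \<in> borel_measurable M" unfolding g_def M_def by measurable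
  define A where "A = {\<omega> \<in> space M. t \<le> (\<Sum>i<n. f (\<omega> i))}"
  have gexp: "g \<omega> = ennreal (exp (\<Sum>i<n. f (\<omega> i)))" for \<omega>
    by (simp add: g_def prod_ennreal exp_sum)
  have "(\<lambda>\<omega>. \<Sum>i<n. f (\<omega> i)) \<in> borel_measurable M" unfolding M_def by measurable
  then have "emeasure M A \<le> ennreal (exp (- t)) * (\<integral>\<^sup>+\<omega>. g \<omega> * indicator (space M) \<omega> \<partial>M)"
    using Chernoff_ineq_nn_integral_ge[of 1 "space M" M "\<lambda>\<omega>. \<Sum>i<n. f (\<omega> i)" t] by (simp add: A_def gexp)
  also have "(\<integral>\<^sup>+\<omega>. g \<omega> * indicator (space M) \<omega> \<partial>M) = (\<integral>\<^sup>+\<omega>. g \<omega> \<partial>M)"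
    by (intro nn_integral_cong) (simp add: indicator_def)
  also have "\<dots> = (\<Prod>i<n. \<integral>\<^sup>+x. ennreal (exp (f x)) \<partial>D)"
    unfolding g_def M_def by (rule product_nn_integral_prod) auto
  also have "\<dots> \<le> (\<Prod>i<n. ennreal (exp k))" using mgf by (intro prod_mono_ennreal) auto
  also have "\<dots> = ennreal (exp (real n * k))" by (simp add: ennreal_power exp_of_nat_mult)
  also have "ennreal (exp (- t)) * ennreal (exp (real n * k)) = ennreal (exp (real n * k - t))"
    by (subst ennreal_mult[symmetric]) (auto simp: exp_add[symmetric])
  finally have "emeasure M A \<le> ennreal (exp (real n * k - t))" by (simp add: mult_left_mono)
  then show ?thesis unfolding M.emeasure_eq_measure by (simp add: A_def M_def)
qed

text \<open>
  A net of the sphere: one representative for each cell of a grid that meets the sphere. The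
  cardinality is far from optimal, but costs only a factor \<open>log p\<close> in the sample size.
\<close>

lemma sphere_net:
  assumes N: "N \<ge> (1 :: nat)"
  shows "\<exists>G. finite G \<and> card G \<le> (2 * N + 1) ^ p \<and> (\<forall>w\<in>G. ip p w w = 1) \<and>
    (\<forall>w. ip p w w = 1 \<longrightarrow> (\<exists>w'\<in>G. \<forall>i<p. \<bar>w i - w' i\<bar> \<le> 1 / real N))"
proof -
  define cell where "cell = (\<lambda>w :: nat \<Rightarrow> real. \<lambda>i\<in>{..<p}. \<lfloor>real N * w i\<rfloor>)"
  define S where "S = {w :: nat \<Rightarrow> real. ip p w w = 1}"
  define G where "G = inv_into S cell ` (cell ` S)"
  have cell: "cell ` S \<subseteq> PiE {..<p} (\<lambda>_. {- int N..int N})"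
  proof (rule image_subsetI)
    fix w assume w: "w \<in> S"
    have "\<lfloor>real N * w i\<rfloor> \<in> {- int N..int N}" if "i < p" for i
    proof -
      have "(w i)\<^sup>2 \<le> ip p w w" unfolding ip_self using that by (intro member_le_sum) auto
      then have "\<bar>w i\<bar> \<le> 1" using w by (simp add: S_def abs_square_le_1)
      then have "\<bar>real N * w i\<bar> \<le> real N" by (simp add: abs_mult mult_left_le)
      then show ?thesis by (auto simp: le_floor_iff floor_le_iff abs_le_iff)
    qed
    then show "cell w \<in> PiE {..<p} (\<lambda>_. {- int N..int N})" by (auto simp: cell_def)
  qed
  have fin: "finite (PiE {..<p} (\<lambda>_. {- int N..int N}))" by (intro finite_PiE) auto
  have "card G \<le> card (cell ` S)" unfolding G_def using finite_subset[OF cell fin] by (rule card_image_le)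
  also have "\<dots> \<le> card (PiE {..<p} (\<lambda>_. {- int N..int N}))" by (rule card_mono[OF fin cell])
  also have "\<dots> = (2 * N + 1) ^ p"
  proof -
    have "nat (2 * int N + 1) = 2 * N + 1" by linarith
    then show ?thesis by (simp add: card_PiE)
  qed
  finally have "card G \<le> (2 * N + 1) ^ p" .
  moreover have "finite G" unfolding G_def using finite_subset[OF cell fin] by simp
  moreover have "\<forall>w\<in>G. ip p w w = 1" using inv_into_into[of _ cell S] by (auto simp: G_def S_def)
  moreover have "\<exists>w'\<in>G. \<forall>i<p. \<bar>w i - w' i\<bar> \<le> 1 / real N" if "ip p w w = 1" for w
  proof (intro bexI[of _ "inv_into S cell (cell w)"] allI impI)
    have w: "w \<in> S" using that by (simp add: S_def)
    then show "inv_into S cell (cell w) \<in> G" by (simp add: G_def)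
    fix i assume i: "i < p"
    define w' where "w' = inv_into S cell (cell w)"
    have "cell w' = cell w" unfolding w'_def by (rule f_inv_into_f[OF imageI[OF w]])
    then have "\<lfloor>real N * w' i\<rfloor> = \<lfloor>real N * w i\<rfloor>" using i by (metis cell_def lessThan_iff restrict_apply')
    then have "\<bar>real N * w i - real N * w' i\<bar> \<le> 1" by linarith
    moreover have "real N * \<bar>w i - w' i\<bar> = \<bar>real N * w i - real N * w' i\<bar>"
      unfolding right_diff_distrib[symmetric] abs_mult by simp
    ultimately have "real N * \<bar>w i - w' i\<bar> \<le> 1" by simp
    then show "\<bar>w i - inv_into S cell (cell w) i\<bar> \<le> 1 / real N" using N by (simp add: w'_def field_simps)
  qed
  ultimately show ?thesis by blast
qed

text \<open>A difference of two squares is factored. Uniformity in \<open>x\<close> holds because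
  \<open>marg\<close> depends on the direction of \<open>x\<close> only; at the origin both values
  are 0 by the convention for division.\<close>

lemma marg_lipschitz:
  assumes N: "N \<ge> (1 :: nat)" and w: "ip p w w = 1" "ip p w' w' = 1"
    and near: "\<And>i. i < p \<Longrightarrow> \<bar>w i - w' i\<bar> \<le> 1 / real N"
  shows "\<bar>marg p w x - marg p w' x\<bar> \<le> 2 * (real p)\<^sup>2 / real N"
proof (cases "ip p x x = 0")
  case False
  then have pos: "ip p x x > 0" using ip_self_nonneg[of p x] by simp
  define r where "r = sqrt (ip p x x)"
  have r: "r > 0" "ip p x x = r\<^sup>2" using pos by (auto simp: r_def)
  define v where "v = (\<lambda>i. w i - w' i)"
  have "ip p v v \<le> (\<Sum>i<p. (1 / real N)\<^sup>2)" unfolding ip_self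
    using near by (intro sum_mono) (simp add: v_def abs_le_square_iff[symmetric])
  also have "\<dots> = real p * (1 / real N)\<^sup>2" by simp
  also have "\<dots> \<le> (real p)\<^sup>2 * (1 / real N)\<^sup>2"
    using of_nat_mono[OF le_square[of p], where ?'a = real]
    by (intro mult_right_mono) (auto simp: power2_eq_square)
  finally have vv: "ip p v v \<le> (real p / real N)\<^sup>2" by (simp add: power_divide)
  have ipv: "ip p v x = ip p w x - ip p w' x" by (simp add: ip_def v_def algebra_simps sum_subtractf)
  have "(ip p v x)\<^sup>2 \<le> ip p v v * r\<^sup>2" using ip_cauchy_schwarz[of p v x] r by simp
  also have "\<dots> \<le> (real p / real N)\<^sup>2 * r\<^sup>2" by (intro mult_right_mono vv) simp
  finally have "(ip p v x)\<^sup>2 \<le> (real p / real N * r)\<^sup>2" by (simp add: power_mult_distrib power_divide)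
  then have d: "\<bar>ip p w x - ip p w' x\<bar> \<le> real p / real N * r"
    using r ipv abs_le_square_iff[of "ip p v x" "real p / real N * r"] by simp
  have le: "\<bar>ip p v x\<bar> \<le> r" if "ip p v v = 1" for v
    using ip_cauchy_schwarz[of p v x] that r abs_le_square_iff[of "ip p v x" r] by simp
  have "\<bar>ip p w x + ip p w' x\<bar> \<le> 2 * r" using le[OF w(1)] le[OF w(2)] by linarith
  then have "\<bar>(ip p w x - ip p w' x) * (ip p w x + ip p w' x)\<bar> \<le> real p / real N * r * (2 * r)"
    unfolding abs_mult using d r by (intro mult_mono) auto
  then have "\<bar>(ip p w x)\<^sup>2 - (ip p w' x)\<^sup>2\<bar> \<le> 2 * real p / real N * r\<^sup>2"
    by (simp add: power2_eq_square algebra_simps)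
  then have "real p * \<bar>(ip p w x)\<^sup>2 - (ip p w' x)\<^sup>2\<bar> / r\<^sup>2 \<le> real p * (2 * real p / real N * r\<^sup>2) / r\<^sup>2"
    by (intro divide_right_mono mult_left_mono) auto
  also have "\<dots> = 2 * (real p)\<^sup>2 / real N" using r by (simp add: power2_eq_square)
  also have "real p * \<bar>(ip p w x)\<^sup>2 - (ip p w' x)\<^sup>2\<bar> / r\<^sup>2 = \<bar>marg p w x - marg p w' x\<bar>"
    unfolding marg_def r(2) using r by (simp add: diff_divide_distrib[symmetric] right_diff_distrib[symmetric] abs_mult)
  finally show ?thesis .
qed (simp add: marg_def)

section \<open>Whitened samples\<close>

definition whiten :: "nat \<Rightarrow> real mat \<Rightarrow> (nat \<Rightarrow> real) \<Rightarrow> nat \<Rightarrow> real" where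
  "whiten p \<Sigma> x = (\<lambda>i\<in>{..<p}. (mat_inv (mat_sqrt p \<Sigma>) *\<^sub>v vec p x) $ i)"

lemma measurable_whiten:
  assumes "pos_def_mat p \<Sigma>" shows "whiten p \<Sigma> \<in> measurable (vec_space p) (vec_space p)"
proof -
  have I: "mat_inv (mat_sqrt p \<Sigma>) \<in> carrier_mat p p"
    using mat_inv_pos_def(1)[OF mat_sqrt_props(1)[OF assms]] .
  have "whiten p \<Sigma> = (\<lambda>x. \<lambda>i\<in>{..<p}. \<Sum>j<p. mat_inv (mat_sqrt p \<Sigma>) $$ (i, j) * x j)"
    using I by (auto simp: whiten_def fun_eq_iff restrict_def scalar_prod_def lessThan_atLeast0)
  then show ?thesis by simp
qed

lemma sqrt_bilinear:
  assumes S: "pos_def_mat p \<Sigma>" and u: "u \<in> carrier_vec p"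
  defines "a \<equiv> mat_sqrt p \<Sigma> *\<^sub>v u"
  shows "ip p (\<lambda>i. a $ i) (\<lambda>i. a $ i) = qf \<Sigma> u" "ip p (\<lambda>i. a $ i) (whiten p \<Sigma> x) = u \<bullet> vec p x"
    "ip p (whiten p \<Sigma> x) (whiten p \<Sigma> x) = qf (mat_inv \<Sigma>) (vec p x)"
proof -
  define R where "R = mat_sqrt p \<Sigma>"
  note Rp = mat_sqrt_props[OF S, folded R_def]
  note R = pos_def_matD(1,2)[OF Rp(1)] and I = mat_inv_pos_def[OF Rp(1)]
  define v where "v = vec p x"
  have v: "v \<in> carrier_vec p" by (simp add: v_def)
  define y where "y = mat_inv R *\<^sub>v v"
  have y: "y \<in> carrier_vec p" using I v by (simp add: y_def)
  have a: "a \<in> carrier_vec p" using R u by (simp add: a_def R_def)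
  have Ry: "R *\<^sub>v y = v" unfolding y_def using assoc_mult_mat_vec[OF R(1) I(1) v] I(2) v by simp
  have ipv: "ip p (\<lambda>i. b $ i) (\<lambda>i. c $ i) = b \<bullet> c" if "c \<in> carrier_vec p" for b c
    using that by (simp add: ip_def scalar_prod_def lessThan_atLeast0)
  have wh: "ip p f (whiten p \<Sigma> x) = ip p f (\<lambda>i. y $ i)" for f
    by (simp add: ip_def whiten_def y_def v_def R_def)
  show "ip p (\<lambda>i. a $ i) (\<lambda>i. a $ i) = qf \<Sigma> u" 
    using ipv[OF a] qf_sqrt(1)[OF S u] by (simp add: a_def)
  have "a \<bullet> y = u \<bullet> (R *\<^sub>v y)" using bilinear_form_sym[OF R u y] comm_scalar_prod[OF a y] by (simp add: a_def R_def)
  then show "ip p (\<lambda>i. a $ i) (whiten p \<Sigma> x) = u \<bullet> vec p x" unfolding wh ipv[OF y] by (simp add: Ry v_def)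
  have yy: "y \<bullet> y = qf (mat_inv \<Sigma>) v" using qf_sqrt(2)[OF S y] by (simp add: Ry[unfolded R_def])
  have "ip p (whiten p \<Sigma> x) (whiten p \<Sigma> x) = ip p (\<lambda>i. y $ i) (\<lambda>i. y $ i)"
    unfolding wh by (subst (1 2) ip_commute) (rule wh)
  then show "ip p (whiten p \<Sigma> x) (whiten p \<Sigma> x) = qf (mat_inv \<Sigma>) (vec p x)"
    unfolding ipv[OF y] yy v_def .
qed

text \<open>The witness is \<open>\<Sigma>^(1/2) u\<close>, normalized. It turns both regularity
  conditions into statements about marginals of the whitened sample in a unit direction.\<close>

lemma marg_whiten:
  assumes S: "pos_def_mat p \<Sigma>" and u: "u \<in> carrier_vec p" "u \<noteq> 0\<^sub>v p"
  shows "\<exists>w. ip p w w = 1 \<and> (\<forall>x. marg p w (whiten p \<Sigma> x) =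
    real p * (u \<bullet> vec p x)\<^sup>2 / (qf \<Sigma> u * qf (mat_inv \<Sigma>) (vec p x)))"
proof -
  define a where "a = mat_sqrt p \<Sigma> *\<^sub>v u"
  define r where "r = sqrt (qf \<Sigma> u)"
  have r: "r > 0" "r\<^sup>2 = qf \<Sigma> u" "qf \<Sigma> u \<noteq> 0" using qf_pos[OF S u] by (auto simp: r_def)
  define w where "w = (\<lambda>i. a $ i / r)"
  have sc: "ip p w f = ip p (\<lambda>i. a $ i) f / r" for f by (simp add: ip_def w_def sum_divide_distrib)
  have "ip p w w = ip p (\<lambda>i. a $ i) (\<lambda>i. a $ i) / r / r"
    unfolding sc by (subst ip_commute) (simp add: sc)
  then have w: "ip p w w = 1" using sqrt_bilinear(1)[OF S u(1)] r by (simp add: a_def power2_eq_square[symmetric])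
  have "ip p w (whiten p \<Sigma> x) = (u \<bullet> vec p x) / r" for x
    unfolding sc using sqrt_bilinear(2)[OF S u(1)] by (simp add: a_def)
  then show ?thesis using w r
    by (intro exI[of _ w]) (auto simp: marg_def sqrt_bilinear(3)[OF S u(1)] power_divide)
qed

text \<open>Whitening turns \<open>u \<Sigma>^(1/2) V\<close> into \<open>u V\<close>. Invariance of
  \<open>h\<close> under nonzero factors removes \<open>u\<close>, whatever its law, and also the
  normalization \<open>x / |x|\<close> in the sphere law, which leaves the ball.\<close>

lemma nn_integral_elliptical_whiten:
  assumes p: "p \<ge> 1" and D: "D = elliptical_law p \<Sigma> \<nu>" and S: "pos_def_mat p \<Sigma>"
    and nu: "prob_space \<nu>" "sets \<nu> = sets borel" "AE u in \<nu>. u \<noteq> 0"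
    and h [measurable]: "h \<in> borel_measurable (vec_space p)"
    and scale: "\<And>c x. c \<noteq> 0 \<Longrightarrow> x \<in> space (vec_space p) \<Longrightarrow> h (\<lambda>i\<in>{..<p}. c * x i) = h x"
  shows "(\<integral>\<^sup>+x. h (whiten p \<Sigma> x) \<partial>D) = (\<integral>\<^sup>+x. h x \<partial>ball_measure p)"
proof -
  interpret nu: prob_space \<nu> by fact
  define R where "R = mat_sqrt p \<Sigma>"
  note Rp = mat_sqrt_props[OF S, folded R_def]
  note R = pos_def_matD(1,2)[OF Rp(1)] and I = mat_inv_pos_def[OF Rp(1)]
  define sph where "sph = uniform_sphere p"
  interpret sph: prob_space sph unfolding sph_def by (rule prob_space_uniform_sphere[OF p])
  have s [measurable_cong]: "sets \<nu> = sets borel" "sets sph = sets (vec_space p)"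
    using nu by (auto simp: uniform_sphere_def sph_def)
  define f where "f = (\<lambda>(u :: real, v). \<lambda>i\<in>{..<p}. (u \<cdot>\<^sub>v (R *\<^sub>v vec p v)) $ i)"
  have f_eq: "f = (\<lambda>(u, v). \<lambda>i\<in>{..<p}. u * (\<Sum>j<p. R $$ (i,j) * v j))"
    using R by (auto simp: f_def fun_eq_iff restrict_def scalar_prod_def lessThan_atLeast0 intro!: sum.cong)
  have f [measurable]: "f \<in> measurable (\<nu> \<Otimes>\<^sub>M sph) (vec_space p)" unfolding f_eq by measurable
  have Dd: "D = distr (\<nu> \<Otimes>\<^sub>M sph) (vec_space p) f" by (simp add: D elliptical_law_def f_def R_def sph_def)
  note [measurable] = measurable_whiten[OF S]
  have wf: "whiten p \<Sigma> (f (u, v)) = (\<lambda>i\<in>{..<p}. u * v i)" for u v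
  proof -
    have v: "vec p v \<in> carrier_vec p" by simp
    have "vec p (f (u, v)) = u \<cdot>\<^sub>v (R *\<^sub>v vec p v)" using R by (intro eq_vecI) (auto simp: f_def)
    then have "mat_inv R *\<^sub>v vec p (f (u, v)) = u \<cdot>\<^sub>v (mat_inv R *\<^sub>v (R *\<^sub>v vec p v))"
      using mult_mat_vec[OF I(1), of "R *\<^sub>v vec p v" u] R by simp
    also have "mat_inv R *\<^sub>v (R *\<^sub>v vec p v) = vec p v"
      using assoc_mult_mat_vec[OF I(1) R(1) v] I(3) by simp
    finally show ?thesis by (auto simp: whiten_def R_def fun_eq_iff restrict_def)
  qed
  have "(\<integral>\<^sup>+x. h (whiten p \<Sigma> x) \<partial>D) = (\<integral>\<^sup>+z. h (whiten p \<Sigma> (f z)) \<partial>(\<nu> \<Otimes>\<^sub>M sph))"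
    unfolding Dd by (subst nn_integral_distr) auto
  also have "\<dots> = (\<integral>\<^sup>+u. \<integral>\<^sup>+v. h (whiten p \<Sigma> (f (u, v))) \<partial>sph \<partial>\<nu>)"
    by (rule sph.nn_integral_fst[symmetric]) measurable
  also have "\<dots> = (\<integral>\<^sup>+u. (\<integral>\<^sup>+v. h v \<partial>sph) \<partial>\<nu>)"
  proof (rule nn_integral_cong_AE)
    show "AE u in \<nu>. (\<integral>\<^sup>+v. h (whiten p \<Sigma> (f (u, v))) \<partial>sph) = (\<integral>\<^sup>+v. h v \<partial>sph)"
      using nu(3)
    proof eventually_elim
      case (elim u)
      then show ?case unfolding wf
        by (intro nn_integral_cong scale) (auto simp: sets_eq_imp_space_eq[OF s(2)])
    qed
  qed
  also have "\<dots> = (\<integral>\<^sup>+v. h v \<partial>sph)" by (simp add: nu.emeasure_space_1)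
  also have "\<dots> = (\<integral>\<^sup>+x. h (\<lambda>i\<in>{..<p}. x i / sqrt (\<Sum>j<p. (x j)\<^sup>2)) \<partial>ball_measure p)"
    unfolding sph_def uniform_sphere_def ball_measure_def[symmetric]
    by (subst nn_integral_distr) (auto cong: measurable_cong_sets)
  also have "\<dots> = (\<integral>\<^sup>+x. h x \<partial>ball_measure p)"
  proof (rule nn_integral_cong_AE)
    show "AE x in ball_measure p. h (\<lambda>i\<in>{..<p}. x i / sqrt (\<Sum>j<p. (x j)\<^sup>2)) = h x"
      using AE_ball_nonzero[OF p] AE_space
    proof eventually_elim
      case (elim x)
      have "(\<lambda>i\<in>{..<p}. x i / sqrt (\<Sum>j<p. (x j)\<^sup>2)) = (\<lambda>i\<in>{..<p}. (1 / sqrt (ip p x x)) * x i)"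
        by (simp add: ip_self)
      then show ?case using scale[of "1 / sqrt (ip p x x)" x] elim ip_self_nonneg[of p x]
        by (simp add: space_PiM)
    qed
  qed
  finally show ?thesis .
qed

lemma marg_scale: "c \<noteq> 0 \<Longrightarrow> marg p w (\<lambda>i\<in>{..<p}. c * x i) = marg p w x"
proof -
  assume c: "c \<noteq> 0"
  have 1: "ip p f (\<lambda>i\<in>{..<p}. c * x i) = c * ip p f x" for f
    by (simp add: ip_def sum_distrib_left mult.left_commute)
  have "ip p (\<lambda>i\<in>{..<p}. c * x i) (\<lambda>i\<in>{..<p}. c * x i) = c * (c * ip p x x)"
    unfolding 1 by (subst ip_commute) (simp add: 1)
  then show ?thesis using c unfolding marg_def 1 by (simp add: power2_eq_square)
qed

text \<open>The tolerance \<open>\<tau> / 8\<close> is shared equally by the passage to a net point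
  and the fluctuation there. Small marginals are counted at level \<open>2 * \<tau>\<close>, since a
  marginal below \<open>\<tau>\<close> is below \<open>\<tau> + \<tau> / 16\<close> at the net
  point.\<close>

lemma tyler_regularI:
  fixes \<omega> :: "nat \<Rightarrow> nat \<Rightarrow> real"
  assumes p: "p \<ge> 1" and n: "n \<ge> 1" and S: "pos_def_mat p \<Sigma>" and tau: "0 < \<tau>" "\<tau> \<le> 1"
    and nz: "\<And>i. i < n \<Longrightarrow> ip p (whiten p \<Sigma> (\<omega> i)) (whiten p \<Sigma> (\<omega> i)) \<noteq> 0"
    and net: "\<And>w. ip p w w = 1 \<Longrightarrow> \<exists>w'\<in>G. \<forall>x. \<bar>marg p w x - marg p w' x\<bar> \<le> \<tau> / 16"
    and avg: "\<And>w. w \<in> G \<Longrightarrow> \<bar>\<Sum>i<n. marg p w (whiten p \<Sigma> (\<omega> i)) - 1\<bar> \<le> \<tau> / 16 * real n"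
    and small: "\<And>w. w \<in> G \<Longrightarrow>
      (\<Sum>i<n. if marg p w (whiten p \<Sigma> (\<omega> i)) < 2 * \<tau> then 1 else 0) \<le> real n / 4"
  shows "tyler_regular p n (\<lambda>i. vec p (\<omega> i)) \<Sigma> \<tau>"
proof -
  define x where "x = (\<lambda>i. vec p (\<omega> i))"
  define g where "g = (\<lambda>i. qf (mat_inv \<Sigma>) (x i))"
  have xc: "x i \<in> carrier_vec p" for i by (simp add: x_def)
  have g: "g i \<noteq> 0" if "i < n" for i
    using nz[OF that] sqrt_bilinear(3)[OF S, of "0\<^sub>v p" "\<omega> i"] by (simp add: g_def x_def)
  have x0: "x i \<noteq> 0\<^sub>v p" if "i < n" for i
    using g[OF that] qf_zero[OF mat_inv_pos_def(1)[OF S]] by (auto simp: g_def)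
  interpret tyler_data p n x using p n xc x0 by unfold_locales auto
  have gpos: "g i > 0" if "i < n" for i using qf_inv_pos[OF S xc x0[OF that]] by (simp add: g_def)
  have key: "(1 - \<tau> / 8) * qf \<Sigma> u \<le> qf (F \<Sigma>) u \<and> qf (F \<Sigma>) u \<le> (1 + \<tau> / 8) * qf \<Sigma> u \<and>
      real (card {i. i < n \<and> real p * (u \<bullet> x i)\<^sup>2 < \<tau> * g i * qf \<Sigma> u}) \<le> real n / 4"
    if u: "u \<in> carrier_vec p" "u \<noteq> 0\<^sub>v p" for u
  proof -
    have q: "qf \<Sigma> u > 0" by (rule qf_pos[OF S u])
    from marg_whiten[OF S u] obtain w where w: "ip p w w = 1"
      and ws: "\<And>y. marg p w (whiten p \<Sigma> y) = real p * (u \<bullet> vec p y)\<^sup>2 / (qf \<Sigma> u * qf (mat_inv \<Sigma>) (vec p y))"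
      by blast
    define m where "m = (\<lambda>w i. marg p w (whiten p \<Sigma> (\<omega> i)))"
    have m: "m w i = real p * (u \<bullet> x i)\<^sup>2 / (qf \<Sigma> u * g i)" for i
      using ws[of "\<omega> i"] by (simp add: m_def g_def x_def)
    obtain w' where w': "w' \<in> G" "\<And>i. \<bar>m w i - m w' i\<bar> \<le> \<tau> / 16"
      using net[OF w] by (auto simp: m_def)
    have "\<bar>\<Sum>i<n. m w i - m w' i\<bar> \<le> (\<Sum>i<n. \<tau> / 16)" by (rule order_trans[OF sum_abs sum_mono]) (rule w'(2))
    moreover have "(\<Sum>i<n. m w i - 1) = (\<Sum>i<n. m w i - m w' i) + (\<Sum>i<n. m w' i - 1)"
      by (simp add: sum_subtractf)
    moreover have "\<bar>\<Sum>i<n. m w' i - 1\<bar> \<le> \<tau> / 16 * real n" using avg[OF w'(1)] by (simp add: m_def)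
    moreover have "\<bar>s + s'\<bar> \<le> \<tau> / 8 * real n" if "\<bar>s\<bar> \<le> (\<Sum>i<n. \<tau> / 16)" "\<bar>s'\<bar> \<le> \<tau> / 16 * real n" for s s'
      using that abs_triangle_ineq[of s s'] by (simp add: mult.commute)
    ultimately have "\<bar>\<Sum>i<n. m w i - 1\<bar> \<le> \<tau> / 8 * real n" by simp
    then have sm: "\<bar>(\<Sum>i<n. m w i) - real n\<bar> \<le> \<tau> / 8 * real n" by (simp add: sum_subtractf)
    have "real p / real n * ((u \<bullet> x i)\<^sup>2 / g i) = qf \<Sigma> u / real n * m w i" for i
      using q by (simp add: m)
    then have F: "qf (F \<Sigma>) u = qf \<Sigma> u / real n * (\<Sum>i<n. m w i)"
      unfolding qf_tyler_map[OF u(1)] sum_distrib_left by (simp add: g_def)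
    have bounds: "(1 - \<tau> / 8) * real n \<le> (\<Sum>i<n. m w i)" "(\<Sum>i<n. m w i) \<le> (1 + \<tau> / 8) * real n"
      using abs_le_D1[OF sm] abs_le_D2[OF sm] by (simp_all add: left_diff_distrib distrib_right)
    have "qf \<Sigma> u / real n * ((1 - \<tau> / 8) * real n) \<le> qf \<Sigma> u / real n * (\<Sum>i<n. m w i)"
      using q bounds by (intro mult_left_mono) auto
    moreover have "qf \<Sigma> u / real n * (\<Sum>i<n. m w i) \<le> qf \<Sigma> u / real n * ((1 + \<tau> / 8) * real n)"
      using q bounds by (intro mult_left_mono) auto
    moreover have "real (card {i. i < n \<and> real p * (u \<bullet> x i)\<^sup>2 < \<tau> * g i * qf \<Sigma> u}) \<le> real n / 4"
    proof -
      have "{i. i < n \<and> real p * (u \<bullet> x i)\<^sup>2 < \<tau> * g i * qf \<Sigma> u} \<subseteq> {i \<in> {..<n}. m w' i < 2 * \<tau>}"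
      proof safe
        fix i assume i: "i < n" "real p * (u \<bullet> x i)\<^sup>2 < \<tau> * g i * qf \<Sigma> u"
        then have "m w i < \<tau>" using q gpos[OF i(1)] by (simp add: m divide_less_eq mult_ac)
        then show "m w' i < 2 * \<tau>" using w'(2)[of i] tau by linarith
      qed
      then have "real (card {i. i < n \<and> real p * (u \<bullet> x i)\<^sup>2 < \<tau> * g i * qf \<Sigma> u}) \<le>
          real (card {i \<in> {..<n}. m w' i < 2 * \<tau>})" by (simp add: card_mono)
      also have "\<dots> = (\<Sum>i<n. if m w' i < 2 * \<tau> then 1 else 0)"
        by (simp add: sum.If_cases Int_def)
      also have "\<dots> \<le> real n / 4" using small[OF w'(1)] by (simp add: m_def)
      finally show ?thesis .
    qed
    ultimately show ?thesis using n unfolding F by (simp add: mult.commute)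
  qed
  have "tyler_regular p n x \<Sigma> \<tau>"
  proof unfold_locales
    show "sandwiched p (1 - \<tau> / 8) (1 + \<tau> / 8) \<Sigma> (F \<Sigma>)" unfolding sandwiched_def
    proof (intro ballI)
      fix u :: "real vec" assume u: "u \<in> carrier_vec p"
      show "(1 - \<tau> / 8) * qf \<Sigma> u \<le> qf (F \<Sigma>) u \<and> qf (F \<Sigma>) u \<le> (1 + \<tau> / 8) * qf \<Sigma> u"
        using key[OF u] qf_zero[OF tyler_map_carrier] qf_zero[OF pos_def_matD(1)[OF S]] by (cases "u = 0\<^sub>v p") auto
    qed
    fix u :: "real vec" assume u: "u \<in> carrier_vec p"
    show "real (card {i. i < n \<and> real p * (u \<bullet> x i)\<^sup>2 < \<tau> * qf (mat_inv \<Sigma>) (x i) * qf \<Sigma> u}) \<le> real n / 4"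
      using key[OF u] qf_zero[OF pos_def_matD(1)[OF S]] xc unfolding g_def by (cases "u = 0\<^sub>v p") auto
  qed (use S tau in auto)
  then show ?thesis by (simp add: x_def)
qed

lemma spread_bounds:
  assumes "real J \<ge> 2 * exp 8" and "\<tau> = 1 / (72 * (real J)\<^sup>2)"
  shows "0 < \<tau>" "\<tau> \<le> 1 / 4"
proof -
  have J: "real J \<ge> 1" using assms(1) exp_ge_add_one_self[of 8] by linarith
  then show "0 < \<tau>" unfolding assms(2) by simp
  show "\<tau> \<le> 1 / 4"
    unfolding assms(2) by (rule frac_le) (use one_le_power[OF J, of 2] in linarith)+
qed

section \<open>Regularity of elliptical samples with high probability\<close>

locale elliptical_sample =
  fixes p n :: nat and \<Sigma> :: "real mat" and D :: "(nat \<Rightarrow> real) measure"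
  assumes p: "p \<ge> 1" and n: "n \<ge> 1" and elliptical: "centered_elliptical p \<Sigma> D"
begin

lemma Sigma: "pos_def_mat p \<Sigma>" and trace: "mat_trace \<Sigma> = real p"
  using elliptical by (auto simp: centered_elliptical_def)

lemma sets_D [measurable_cong]: "sets D = sets (vec_space p)"
  using elliptical by (auto simp: centered_elliptical_def elliptical_law_def)

lemma prob_space_D: "prob_space D"
  using elliptical prob_space_elliptical_law[OF p] pos_def_matD(1)[OF mat_sqrt_props(1)[OF Sigma]]
  by (auto simp: centered_elliptical_def)

lemma nn_integral_whiten:
  assumes "h \<in> borel_measurable (vec_space p)"
    "\<And>c x. c \<noteq> 0 \<Longrightarrow> x \<in> space (vec_space p) \<Longrightarrow> h (\<lambda>i\<in>{..<p}. c * x i) = h x"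
  shows "(\<integral>\<^sup>+x. h (whiten p \<Sigma> x) \<partial>D) = (\<integral>\<^sup>+x. h x \<partial>ball_measure p)"
proof -
  obtain \<nu> where "prob_space \<nu>" "sets \<nu> = sets borel" "AE u in \<nu>. u \<noteq> 0" "D = elliptical_law p \<Sigma> \<nu>"
    using elliptical by (auto simp: centered_elliptical_def)
  then show ?thesis using assms by (intro nn_integral_elliptical_whiten[OF p _ Sigma]) auto
qed

abbreviation "y \<equiv> whiten p \<Sigma>"

abbreviation "P \<equiv> PiM {..<n} (\<lambda>_. D)"

sublocale P: prob_space P
  by (rule prob_space_PiM) (rule prob_space_D)

lemma measurable_whiten_D [measurable]: "whiten p \<Sigma> \<in> measurable D (vec_space p)"
  using measurable_whiten[OF Sigma] by (simp cong: measurable_cong_sets)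

lemma AE_whiten_nonzero: "AE \<omega> in P. \<forall>i<n. ip p (y (\<omega> i)) (y (\<omega> i)) \<noteq> 0"
proof -
  define h where "h = (\<lambda>x. indicator {x \<in> space (vec_space p). ip p x x = 0} x :: ennreal)"
  have h [measurable]: "h \<in> borel_measurable (vec_space p)" unfolding h_def by measurable
  have "(\<integral>\<^sup>+x. h (y x) \<partial>D) = (\<integral>\<^sup>+x. h x \<partial>ball_measure p)"
  proof (rule nn_integral_whiten[OF h])
    fix c :: real and x :: "nat \<Rightarrow> real" assume "c \<noteq> 0" "x \<in> space (vec_space p)"
    moreover have "ip p (\<lambda>i\<in>{..<p}. c * x i) (\<lambda>i\<in>{..<p}. c * x i) = c * c * ip p x x"
      by (simp add: ip_def sum_distrib_left mult_ac)
    ultimately show "h (\<lambda>i\<in>{..<p}. c * x i) = h x" by (simp add: h_def indicator_def space_PiM)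
  qed
  also have "\<dots> = (\<integral>\<^sup>+x. 0 \<partial>ball_measure p)"
    using AE_ball_nonzero[OF p] by (intro nn_integral_cong_AE) (auto simp: h_def)
  finally have "(\<integral>\<^sup>+x. h (y x) \<partial>D) = 0" by simp
  then have "AE x in D. h (y x) = 0" by (subst (asm) nn_integral_0_iff_AE) auto
  then have "AE x in D. ip p (y x) (y x) \<noteq> 0"
  proof (rule AE_mp, intro AE_I2 impI)
    fix x assume "x \<in> space D" "h (y x) = 0"
    then show "ip p (y x) (y x) \<noteq> 0"
      using measurable_space[OF measurable_whiten_D] by (auto simp: h_def indicator_def split: if_splits)
  qed
  then have "\<forall>i\<in>{..<n}. AE \<omega> in P. ip p (y (\<omega> i)) (y (\<omega> i)) \<noteq> 0"
    using prob_space_D by (intro ballI AE_PiM_component) auto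
  then have "AE \<omega> in P. \<forall>i\<in>{..<n}. ip p (y (\<omega> i)) (y (\<omega> i)) \<noteq> 0"
    by (intro AE_finite_allI) auto
  then show ?thesis by eventually_elim simp
qed

lemma whitened_chernoff:
  assumes w: "ip p w w = 1" and f [measurable]: "f \<in> borel_measurable borel"
    and mgf: "(\<integral>\<^sup>+x. ennreal (exp (f (marg p w x))) \<partial>ball_measure p) \<le> ennreal (exp k)"
  shows "P.prob {\<omega> \<in> space P. t \<le> (\<Sum>i<n. f (marg p w (y (\<omega> i))))} \<le> exp (real n * k - t)"
proof (rule chernoff_iid[OF prob_space_D])
  show "(\<lambda>x. f (marg p w (y x))) \<in> borel_measurable D" by measurable
  have "(\<integral>\<^sup>+x. ennreal (exp (f (marg p w (y x)))) \<partial>D) = (\<integral>\<^sup>+x. ennreal (exp (f (marg p w x))) \<partial>ball_measure p)"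
    by (rule nn_integral_whiten) (auto simp: marg_scale)
  then show "(\<integral>\<^sup>+x. ennreal (exp (f (marg p w (y x)))) \<partial>D) \<le> ennreal (exp k)" using mgf by simp
qed

lemma average_deviation:
  assumes w: "ip p w w = 1" and tau: "0 < \<tau>" "\<tau> \<le> 1"
  shows "P.prob {\<omega> \<in> space P. \<tau> / 16 * real n \<le> \<bar>\<Sum>i<n. marg p w (y (\<omega> i)) - 1\<bar>} \<le>
    2 * exp (- (\<tau>\<^sup>2 / 10485760 * real n))"
proof -
  \<comment> \<open>\<open>327680 = 2 * 10240 * 16\<close>: this \<open>s\<close> minimizes
    \<open>10240 * s^2 - s * \<tau> / 16\<close>, and the minimum is
    \<open>- \<tau>^2 / 10485760\<close>.\<close>
  define s where "s = \<tau> / 327680"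
  define Z where "Z = (\<lambda>\<omega>. \<Sum>i<n. marg p w (y (\<omega> i)) - 1)"
  define t where "t = s * (\<tau> / 16 * real n)"
  have s: "s > 0" "\<bar>s\<bar> \<le> 1 / 16" "\<bar>- s\<bar> \<le> 1 / 16" using tau by (auto simp: s_def)
  have Z [measurable]: "Z \<in> borel_measurable P" unfolding Z_def by measurable
  have e: "real n * (10240 * s\<^sup>2) - t = - (\<tau>\<^sup>2 / 10485760 * real n)"
    by (simp add: s_def t_def power2_eq_square field_simps)
  have b: "P.prob {\<omega> \<in> space P. t \<le> r * Z \<omega>} \<le> exp (- (\<tau>\<^sup>2 / 10485760 * real n))" if r: "\<bar>r\<bar> \<le> 1 / 16" "r\<^sup>2 = s\<^sup>2" for r
    using whitened_chernoff[where f = "\<lambda>y. r * (y - 1)" and t = t, OF w _ marg_mgf[OF p w r(1)]] e r(2)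
    by (simp add: Z_def sum_distrib_left)
  have "{\<omega> \<in> space P. \<tau> / 16 * real n \<le> \<bar>Z \<omega>\<bar>} \<subseteq> {\<omega> \<in> space P. t \<le> s * Z \<omega>} \<union> {\<omega> \<in> space P. t \<le> (- s) * Z \<omega>}"
  proof
    fix \<omega> assume "\<omega> \<in> {\<omega> \<in> space P. \<tau> / 16 * real n \<le> \<bar>Z \<omega>\<bar>}"
    then have "\<omega> \<in> space P" "t \<le> s * \<bar>Z \<omega>\<bar>" using s by (auto simp: t_def)
    then show "\<omega> \<in> {\<omega> \<in> space P. t \<le> s * Z \<omega>} \<union> {\<omega> \<in> space P. t \<le> (- s) * Z \<omega>}"
      by (cases "Z \<omega> \<ge> 0") auto
  qed
  then have "P.prob {\<omega> \<in> space P. \<tau> / 16 * real n \<le> \<bar>Z \<omega>\<bar>} \<le>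
      P.prob ({\<omega> \<in> space P. t \<le> s * Z \<omega>} \<union> {\<omega> \<in> space P. t \<le> (- s) * Z \<omega>})"
    by (rule P.finite_measure_mono) measurable
  also have "\<dots> \<le> P.prob {\<omega> \<in> space P. t \<le> s * Z \<omega>} + P.prob {\<omega> \<in> space P. t \<le> (- s) * Z \<omega>}"
    by (intro measure_Un_le) measurable
  also have "\<dots> \<le> 2 * exp (- (\<tau>\<^sup>2 / 10485760 * real n))"
    using b[of s] b[of "- s"] s by simp
  finally show ?thesis by (simp add: Z_def)
qed

text \<open>Chernoff for 8 times the indicator of a small marginal: a count of \<open>n / 4\<close>
  means a sum of \<open>2 * n\<close>. The choice of \<open>J\<close> gives a small marginal
  probability at most \<open>exp (- 8)\<close>, so the moment is at most \<open>exp 1\<close> and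
  the exponent is \<open>n - 2 * n\<close>.\<close>

lemma small_marg_count:
  assumes w: "ip p w w = 1" and J: "real J \<ge> 2 * exp 8"
  shows "P.prob {\<omega> \<in> space P. real n / 4 \<le>
      (\<Sum>i<n. if marg p w (y (\<omega> i)) < 1 / (36 * (real J)\<^sup>2) then 1 else 0)} \<le> exp (- real n)"
proof -
  have "real J > 0" using J by (rule less_le_trans[rotated]) simp
  then have J1: "J \<ge> 1" by simp
  define f where "f = (\<lambda>y :: real. if y < 1 / (36 * (real J)\<^sup>2) then 8 else 0 :: real)"
  have f [measurable]: "f \<in> borel_measurable borel" unfolding f_def by measurable
  interpret B: prob_space "ball_measure p" by (rule prob_space_ball_measure[OF p])
  define A where "A = {x \<in> space (leb p). marg p w x < 1 / (36 * (real J)\<^sup>2)}"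
  have A: "A \<in> B.events" unfolding A_def by simp
  have "(\<integral>\<^sup>+x. ennreal (exp (f (marg p w x))) \<partial>ball_measure p) \<le>
      (\<integral>\<^sup>+x. 1 + ennreal (exp 8) * indicator A x \<partial>ball_measure p)"
    by (intro nn_integral_mono) (auto simp: f_def A_def indicator_def)
  also have "\<dots> = 1 + ennreal (exp 8) * ennreal (B.prob A)"
    using A B.emeasure_space_1
    by (subst nn_integral_add) (auto simp: nn_integral_cmult_indicator B.emeasure_eq_measure simp del: space_ball_measure)
  also have "\<dots> = ennreal (1 + exp 8 * B.prob A)"
    by (simp add: ennreal_mult)
  also have "\<dots> \<le> ennreal (exp 1)"
  proof (rule ennreal_leI)
    have "exp 8 * B.prob A \<le> exp 8 * (2 / real J)"
      using marg_small[OF p w J1] by (intro mult_left_mono) (auto simp: A_def)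
    also have "\<dots> \<le> 1" using J \<open>real J > 0\<close> by (simp add: field_simps)
    finally show "1 + exp 8 * B.prob A \<le> exp 1" using exp_ge_add_one_self[of 1] by linarith
  qed
  finally have "P.prob {\<omega> \<in> space P. 2 * real n \<le> (\<Sum>i<n. f (marg p w (y (\<omega> i))))} \<le> exp (real n * 1 - 2 * real n)"
    by (rule whitened_chernoff[OF w f])
  moreover have "(\<Sum>i<n. f (marg p w (y (\<omega> i)))) =
      8 * (\<Sum>i<n. if marg p w (y (\<omega> i)) < 1 / (36 * (real J)\<^sup>2) then 1 else 0)" for \<omega>
    unfolding sum_distrib_left by (intro sum.cong) (auto simp: f_def)
  ultimately show ?thesis by (simp add: field_simps)
qed

text \<open>Union bound over the net; \<open>3 = 2 + 1\<close> comes from the two-sided deviation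
  and the count. The 72 makes \<open>2 * \<tau>\<close> equal to the threshold of the small-marginal
  bound.\<close>

lemma regular_event:
  assumes G: "finite G" "\<And>w. w \<in> G \<Longrightarrow> ip p w w = 1"
    and net: "\<And>w. ip p w w = 1 \<Longrightarrow> \<exists>w'\<in>G. \<forall>x. \<bar>marg p w x - marg p w' x\<bar> \<le> \<tau> / 16"
    and J: "real J \<ge> 2 * exp 8" and tau: "\<tau> = 1 / (72 * (real J)\<^sup>2)"
  shows "\<exists>E \<in> sets P. P.prob E \<ge> 1 - real (card G) * (3 * exp (- (\<tau>\<^sup>2 / 10485760 * real n))) \<and>
    (\<forall>\<omega>\<in>E. tyler_regular p n (\<lambda>i. vec p (\<omega> i)) \<Sigma> \<tau>)"
proof -
  have tau01: "0 < \<tau>" "\<tau> \<le> 1" using spread_bounds[OF J tau] by auto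
  define N where "N = {\<omega> \<in> space P. \<not> (\<forall>i<n. ip p (y (\<omega> i)) (y (\<omega> i)) \<noteq> 0)}"
  define A where "A = (\<lambda>w. {\<omega> \<in> space P. \<tau> / 16 * real n \<le> \<bar>\<Sum>i<n. marg p w (y (\<omega> i)) - 1\<bar>})"
  define B where "B = (\<lambda>w. {\<omega> \<in> space P. real n / 4 \<le> (\<Sum>i<n. if marg p w (y (\<omega> i)) < 2 * \<tau> then 1 else 0 :: real)})"
  have y [measurable]: "(\<lambda>\<omega>. y (\<omega> i)) \<in> measurable P (vec_space p)" if "i < n" for i
    using measurable_component_singleton[of i "{..<n}" "\<lambda>_. D"] that
    by (intro measurable_compose[OF _ measurable_whiten_D]) auto
  have [measurable]: "N \<in> sets P" unfolding N_def by measurable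
  have [measurable]: "A w \<in> sets P" "B w \<in> sets P" for w unfolding A_def B_def by measurable
  have N: "P.prob N = 0"
  proof -
    have "AE \<omega> in P. \<omega> \<notin> N" using AE_whiten_nonzero by eventually_elim (auto simp: N_def)
    then show ?thesis using P.prob_eq_0[of N] by simp
  qed
  define a where "a = \<tau>\<^sup>2 / 10485760"
  have a1: "a \<le> 1" using tau01 power_le_one[of \<tau> 2] by (simp add: a_def)
  have AB: "P.prob (A w \<union> B w) \<le> 3 * exp (- (a * real n))" if "w \<in> G" for w
  proof -
    have "P.prob (A w \<union> B w) \<le> P.prob (A w) + P.prob (B w)" by (intro measure_Un_le) measurable
    also have "P.prob (A w) \<le> 2 * exp (- (a * real n))"
      using average_deviation[OF G(2)[OF that] tau01] by (simp add: A_def a_def)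
    also have "P.prob (B w) \<le> exp (- real n)"
    proof -
      have "2 * \<tau> = 1 / (36 * (real J)\<^sup>2)" by (simp add: tau)
      then show ?thesis using small_marg_count[OF G(2)[OF that] J] by (simp add: B_def)
    qed
    also have "exp (- real n) \<le> exp (- (a * real n))" using mult_right_mono[OF a1, of "real n"] by simp
    finally show ?thesis by simp
  qed
  have U [measurable]: "(\<Union>w\<in>G. A w \<union> B w) \<in> sets P" using G(1) by (intro sets.finite_UN) auto
  define E where "E = space P - (N \<union> (\<Union>w\<in>G. A w \<union> B w))"
  have "P.prob (N \<union> (\<Union>w\<in>G. A w \<union> B w)) \<le> P.prob N + P.prob (\<Union>w\<in>G. A w \<union> B w)"
    by (intro measure_Un_le) measurable
  also have "P.prob (\<Union>w\<in>G. A w \<union> B w) \<le> (\<Sum>w\<in>G. P.prob (A w \<union> B w))"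
    using G(1) by (intro measure_UNION_le) auto
  also have "\<dots> \<le> (\<Sum>w\<in>G. 3 * exp (- (a * real n)))" by (intro sum_mono AB)
  finally have "P.prob (N \<union> (\<Union>w\<in>G. A w \<union> B w)) \<le> real (card G) * (3 * exp (- (a * real n)))" by (simp add: N)
  moreover have "P.prob E = 1 - P.prob (N \<union> (\<Union>w\<in>G. A w \<union> B w))"
    unfolding E_def by (intro P.prob_compl) measurable
  ultimately have "P.prob E \<ge> 1 - real (card G) * (3 * exp (- (a * real n)))" by simp
  moreover have "tyler_regular p n (\<lambda>i. vec p (\<omega> i)) \<Sigma> \<tau>" if "\<omega> \<in> E" for \<omega>
    by (rule tyler_regularI[OF p n Sigma tau01 _ net])
      (use that in \<open>auto simp: E_def N_def A_def B_def not_le less_imp_le\<close>)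
  moreover have "E \<in> sets P" unfolding E_def by measurable
  ultimately show ?thesis unfolding a_def by blast
qed

text \<open>In dimension one every normalized sample is \<open>\<plusminus>1\<close>, so no concentration is needed.\<close>

lemma regular_event_dim_1:
  assumes p1: "p = 1" and tau: "0 < \<tau>" "\<tau> \<le> 1 / 4"
  shows "\<exists>E \<in> sets P. P.prob E = 1 \<and> (\<forall>\<omega>\<in>E. tyler_regular p n (\<lambda>i. vec p (\<omega> i)) \<Sigma> \<tau>)"
proof -
  define E where "E = {\<omega> \<in> space P. \<forall>i<n. ip p (y (\<omega> i)) (y (\<omega> i)) \<noteq> 0}"
  have E: "E \<in> sets P" unfolding E_def by measurable
  have "AE \<omega> in P. \<omega> \<in> E" using AE_whiten_nonzero AE_space by eventually_elim (simp add: E_def)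
  then have "P.prob E = 1" using P.prob_eq_1[OF E] by simp
  moreover have "tyler_regular p n (\<lambda>i. vec p (\<omega> i)) \<Sigma> \<tau>" if \<omega>: "\<omega> \<in> E" for \<omega>
  proof (rule tyler_regularI[where G = "{w. ip p w w = 1}", OF p n Sigma])
    have m: "marg p w (y (\<omega> i)) = 1" if "i < n" "ip p w w = 1" for w i
    proof -
      have "w 0 * w 0 = 1" using that by (simp add: ip_def p1)
      moreover have "y (\<omega> i) 0 \<noteq> 0" using \<omega> that by (auto simp: E_def ip_def p1)
      moreover have "(w 0 * y)\<^sup>2 = (w 0 * w 0) * (y * y)" for y
        by (simp add: power2_eq_square algebra_simps)
      ultimately show ?thesis by (simp add: marg_def ip_def p1)
    qed
    show "\<bar>\<Sum>i<n. marg p w (y (\<omega> i)) - 1\<bar> \<le> \<tau> / 16 * real n" if "w \<in> {w. ip p w w = 1}" for w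
      using that tau m by simp
    show "(\<Sum>i<n. if marg p w (y (\<omega> i)) < 2 * \<tau> then 1 else 0) \<le> real n / 4" if "w \<in> {w. ip p w w = 1}" for w
      using that tau m by simp
    show "\<exists>w'\<in>{w. ip p w w = 1}. \<forall>x. \<bar>marg p w x - marg p w' x\<bar> \<le> \<tau> / 16" if "ip p w w = 1" for w
      using that tau by (intro bexI[of _ w]) auto
  qed (use \<omega> tau in \<open>auto simp: E_def\<close>)
  ultimately show ?thesis using E by blast
qed

text \<open>The union bound costs at most \<open>exp (b * p * (ln p)^2)\<close>, and the lower bound
  on \<open>n\<close> makes this at most the square root of the gain \<open>exp (a * n)\<close>. The
  remaining \<open>exp (- a * n / 2)\<close> is at least as strong as the claim.\<close>

lemma regular_event_high_dim:
  assumes p2: "p \<ge> 2" and J: "real J \<ge> 2 * exp 8" and tau: "\<tau> = 1 / (72 * (real J)\<^sup>2)"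
    and a: "a = \<tau>\<^sup>2 / 10485760" and b: "b = 4 + 4 * (ln 3 + ln (67 / \<tau>))"
    and large: "real n \<ge> 2 * b / a * real p * (ln (real p))\<^sup>2"
  shows "\<exists>E \<in> sets P. P.prob E \<ge> 1 - exp (- (a / 4) * (real n / (real p * (ln (real p))\<^sup>2))) \<and>
    (\<forall>\<omega>\<in>E. tyler_regular p n (\<lambda>i. vec p (\<omega> i)) \<Sigma> \<tau>)"
proof -
  have t: "0 < \<tau>" "\<tau> \<le> 1" using spread_bounds[OF J tau] by auto
  have a0: "a > 0" using t by (simp add: a)
  \<comment> \<open>The mesh makes the Lipschitz error \<open>2 * p^2 / N\<close> at most
    \<open>\<tau> / 16\<close>.\<close>
  define N where "N = nat \<lceil>32 * (real p)\<^sup>2 / \<tau>\<rceil>"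
  have pp: "real p \<ge> 2" "(real p)\<^sup>2 \<ge> 1" using p2 by (auto simp: one_le_power)
  have pt: "(real p)\<^sup>2 \<le> (real p)\<^sup>2 / \<tau>" using t by (simp add: le_divide_eq mult_left_le)
  have N: "32 * (real p)\<^sup>2 / \<tau> \<le> real N" "real N \<le> 32 * (real p)\<^sup>2 / \<tau> + 1"
    using t unfolding N_def by (auto intro: of_nat_ceiling)
  have N1: "N \<ge> 1" using N(1) pt pp by (cases N) auto
  obtain G where G: "finite G" "card G \<le> (2 * N + 1) ^ p" "\<And>w. w \<in> G \<Longrightarrow> ip p w w = 1"
    and net: "\<And>w. ip p w w = 1 \<Longrightarrow> \<exists>w'\<in>G. \<forall>i<p. \<bar>w i - w' i\<bar> \<le> 1 / real N"
    using sphere_net[OF N1, of p] by blast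
  have N16: "2 * (real p)\<^sup>2 / real N \<le> \<tau> / 16"
    using N(1) N1 t by (simp add: field_simps)
  have net': "\<exists>w'\<in>G. \<forall>x. \<bar>marg p w x - marg p w' x\<bar> \<le> \<tau> / 16" if w: "ip p w w = 1" for w
  proof -
    obtain w' where w': "w' \<in> G" "\<forall>i<p. \<bar>w i - w' i\<bar> \<le> 1 / real N" using net[OF w] by blast
    have "\<bar>marg p w x - marg p w' x\<bar> \<le> \<tau> / 16" for x
      using marg_lipschitz[OF N1 w G(3)[OF w'(1)], of x] w'(2) N16 by force
    then show ?thesis using w'(1) by blast
  qed
  define L where "L = ln (real p)"
  \<comment> \<open>For \<open>p \<ge> 2\<close> the logarithm is bounded below, so constants and
    the single power of \<open>ln p\<close> in the exponent of the net size are dominated by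
    multiples of \<open>(ln p)^2\<close>.\<close>
  have "ln 2 \<le> L" using pp by (simp add: L_def)
  then have L: "L \<ge> 1 / 2" using ln2_ge_two_thirds by linarith
  have "(1 / 2) * (1 / 2) \<le> L * L" using L by (intro mult_mono) auto
  then have L2: "1 \<le> 4 * L\<^sup>2" by (simp add: power2_eq_square)
  have LL: "2 * L \<le> 4 * L\<^sup>2" using mult_right_mono[OF L, of "4 * L"] L by (simp add: power2_eq_square)
  have k0: "ln 3 + ln (67 / \<tau>) \<ge> 0" using t by simp
  have card: "real (card G) * 3 \<le> exp (b * (real p * L\<^sup>2))"
  proof -
    have "real (card G) \<le> real ((2 * N + 1) ^ p)" using G(2) by (simp only: of_nat_le_iff)
    also have "\<dots> = (2 * real N + 1) ^ p" unfolding of_nat_power by (simp add: add.commute)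
    also have "\<dots> \<le> (67 * (real p)\<^sup>2 / \<tau>) ^ p"
    proof (rule power_mono)
      \<comment> \<open>\<open>67 = 2 * 32 + 2 + 1\<close>, by \<open>X \<ge> 1\<close>.\<close>
      define X where "X = (real p)\<^sup>2 / \<tau>"
      have "X \<ge> 1" "real N \<le> 32 * X + 1" using pt pp(2) N(2) by (auto simp: X_def)
      then have "2 * real N + 1 \<le> 67 * X" by linarith
      then show "2 * real N + 1 \<le> 67 * (real p)\<^sup>2 / \<tau>" by (simp add: X_def)
    qed simp
    finally have "real (card G) * 3 \<le> (67 * (real p)\<^sup>2 / \<tau>) ^ p * 3 ^ p"
      using power_increasing[of 1 p "3 :: real"] p by (intro mult_mono) auto
    also have "\<dots> = (3 * (67 / \<tau>) * (real p)\<^sup>2) ^ p" by (simp add: power_mult_distrib[symmetric] mult_ac)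
    also have "3 * (67 / \<tau>) * (real p)\<^sup>2 = exp (ln 3 + ln (67 / \<tau>) + 2 * L)"
      using t pp by (simp add: exp_add L_def exp_double power2_eq_square)
    also have "\<dots> ^ p = exp (real p * (ln 3 + ln (67 / \<tau>) + 2 * L))" by (simp add: exp_of_nat_mult)
    also have "\<dots> \<le> exp (b * (real p * L\<^sup>2))"
    proof -
      have "ln 3 + ln (67 / \<tau>) \<le> (ln 3 + ln (67 / \<tau>)) * (4 * L\<^sup>2)" using mult_left_mono[OF L2 k0] by simp
      then have "ln 3 + ln (67 / \<tau>) + 2 * L \<le> b * L\<^sup>2" using LL unfolding b by (simp add: algebra_simps)
      from mult_left_mono[OF this, of "real p"] show ?thesis by (simp add: mult_ac)
    qed
    finally show ?thesis .
  qed
  have bn: "b * (real p * L\<^sup>2) \<le> a / 2 * real n"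
    using mult_left_mono[OF large, of "a / 2"] a0 by (simp add: L_def)
  \<comment> \<open>The origin of \<open>a / 4\<close>: by this bound \<open>n / (p * L^2)\<close>
    is at most \<open>2 * n\<close>.\<close>
  have pL: "real p * L\<^sup>2 \<ge> 1 / 2" using mult_mono[of 2 "real p" "1 / 4" "L\<^sup>2"] pp L2 by simp
  have "real (card G) * (3 * exp (- (a * real n))) \<le> exp (b * (real p * L\<^sup>2)) * exp (- (a * real n))"
    using mult_right_mono[OF card, of "exp (- (a * real n))"] by simp
  also have "\<dots> \<le> exp (- (a / 2 * real n))" unfolding exp_add[symmetric] using bn by simp
  also have "\<dots> \<le> exp (- (a / 4) * (real n / (real p * L\<^sup>2)))"
  proof -
    have "real n / (real p * L\<^sup>2) \<le> real n / (1 / 2)" using pL by (intro divide_left_mono) auto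
    from mult_left_mono[OF this, of "a / 4"] a0 show ?thesis by simp
  qed
  finally have "1 - exp (- (a / 4) * (real n / (real p * L\<^sup>2))) \<le> 1 - real (card G) * (3 * exp (- (a * real n)))" by simp
  moreover obtain E where "E \<in> sets P" "P.prob E \<ge> 1 - real (card G) * (3 * exp (- (a * real n)))"
    "\<forall>\<omega>\<in>E. tyler_regular p n (\<lambda>i. vec p (\<omega> i)) \<Sigma> \<tau>"
    using regular_event[OF G(1,3) net' J tau] unfolding a by blast
  ultimately show ?thesis unfolding L_def by (intro bexI[of _ E]) auto
qed

end

text \<open>For \<open>p = 1\<close> the exponent has denominator 0 and is read as infinite, so
  probability 1 is claimed; the convention \<open>n / 0 = 0\<close> would make the bound trivial
  there, hence the case distinction. The measurable event \<open>E\<close> is chosen before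
  \<open>\<epsilon>\<close>, so a single event serves all accuracies.\<close>

theorem theorem1p3:
  shows "\<exists>C C' c :: real. C > 0 \<and> C' > 0 \<and> c > 0 \<and>
    (\<forall>(p::nat) (n::nat) (\<Sigma>::real mat) (D::(nat \<Rightarrow> real) measure).
      1 \<le> p \<longrightarrow> 1 \<le> n \<longrightarrow> centered_elliptical p \<Sigma> D \<longrightarrow>
      real n \<ge> C * real p * (ln (real p))\<^sup>2 \<longrightarrow>
      (\<exists>E \<in> sets (PiM {..<n} (\<lambda>_. D)).
        measure (PiM {..<n} (\<lambda>_. D)) E
          \<ge> 1 - (if p = 1 then 0 else exp (- c * (real n / (real p * (ln (real p))\<^sup>2)))) \<and>
        (\<forall>\<omega>\<in>E. \<exists>S. is_tyler_estimator p n (\<lambda>i. vec p (\<omega> i)) S \<and>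
          (\<forall>\<epsilon>::real. 0 < \<epsilon> \<and> \<epsilon> < 1 \<longrightarrow>
            (\<exists>T::nat.
              real T \<le> C' * (\<bar>ln (det \<Sigma>)\<bar> + real p + ln (1 / \<epsilon>)) \<and>
              frobenius_norm
                (1\<^sub>m p - mat_sqrt p S * mat_inv (tyler_output p n (\<lambda>i. vec p (\<omega> i)) T)
                          * mat_sqrt p S) \<le> \<epsilon>)))))"
proof -
  \<comment> \<open>\<open>2 / J \<le> exp (- 8)\<close> is what the count of small marginals
    requires; the remaining constants derive from \<open>J\<close> through
    \<open>\<tau>\<close>.\<close>
  define J where "J = nat \<lceil>2 * exp 8 :: real\<rceil>"
  have J: "real J \<ge> 2 * exp 8" unfolding J_def by (rule of_nat_ceiling)
  define \<tau> where "\<tau> = 1 / (72 * (real J)\<^sup>2)"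
  define a where "a = \<tau>\<^sup>2 / 10485760"
  define b where "b = 4 + 4 * (ln 3 + ln (67 / \<tau>))"
  note tau = spread_bounds[OF J \<tau>_def]
  have "a > 0" using tau by (simp add: a_def)
  moreover have "ln (67 / \<tau>) \<ge> 0" "ln (3 :: real) \<ge> 0" using tau by auto
  then have "b > 0" unfolding b_def by (intro add_pos_nonneg mult_nonneg_nonneg add_nonneg_nonneg) auto
  ultimately have pos: "2 * b / a > 0" "a / 4 > 0" "73 / \<tau> > 0" using tau by auto
  show ?thesis
  proof (rule exI[of _ "2 * b / a"], rule exI[of _ "73 / \<tau>"], rule exI[of _ "a / 4"],
      intro conjI pos allI impI, goal_cases)
    case (1 p n \<Sigma> D)
    note large = 1(4)
    interpret elliptical_sample p n \<Sigma> D using 1 by unfold_locales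
    have "\<exists>E \<in> sets P. P.prob E \<ge> 1 - (if p = 1 then 0 else exp (- (a / 4) * (real n / (real p * (ln (real p))\<^sup>2)))) \<and>
      (\<forall>\<omega>\<in>E. tyler_regular p n (\<lambda>i. vec p (\<omega> i)) \<Sigma> \<tau>)"
    proof (cases "p = 1")
      case True
      obtain E where "E \<in> sets P" "P.prob E = 1" "\<forall>\<omega>\<in>E. tyler_regular p n (\<lambda>i. vec p (\<omega> i)) \<Sigma> \<tau>"
        using regular_event_dim_1[OF True tau] by blast
      then show ?thesis using True by (intro bexI[of _ E]) simp_all
    next
      case False
      then have "p \<ge> 2" using p by simp
      from regular_event_high_dim[OF this J \<tau>_def a_def b_def large] show ?thesis using False by simp
    qed
    then obtain E where E: "E \<in> sets P"
      "P.prob E \<ge> 1 - (if p = 1 then 0 else exp (- (a / 4) * (real n / (real p * (ln (real p))\<^sup>2))))"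
      "\<And>\<omega>. \<omega> \<in> E \<Longrightarrow> tyler_regular p n (\<lambda>i. vec p (\<omega> i)) \<Sigma> \<tau>" by blast
    show ?case
      by (intro bexI[OF _ E(1)] conjI[OF E(2)] ballI tyler_regular.tyler_iteration_converges[OF E(3) trace])
  qed
qed

end
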